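(* Assume $A$ is associative. Let $\Omega$ be a domain in $V$ and let $f:\Omega\to A$ be $T$-regular. Fix $J\in\mathbb{T}$ and a bounded domain $G$ in $\mathbb{R}_J^{t_0+\tau+1}$, with a $\mathscr{C}^1$ boundary $\partial G$, such that $\overline{G}\subset\Omega_J$. Then \[\frac{1}{\sigma_{t_0+\tau}}\int_{\partial G}\frac{(y-x)^c}{\|y-x\|^{t_0+\tau+1}}\,dy^*\,f_J(y)=\begin{cases}f(x)&\text{if }x\in G,\\0&\text{if }x\in\mathbb{R}_J^{t_0+\tau+1}\setminus\overline{G}.\end{cases}\]
   Context: $\mathbb{N}$ includes $0$. $A$ is a finite-dimensional alternative (unital) real $*$-algebra: a finite-dimensional real vector space with an $\mathbb{R}$-bilinear multiplication such that $x(xy)=x^2y$, $(xy)y=xy^2$ (automatic if $A$ is associative), and with an involutive real-linear antiautomorphism $x\mapsto x^c$; $\mathbb{R}$ is identified with $\mathbb{R}1$. Set $t(x)=x+x^c$, $n(x)=xx^c$, $\mathbb{S}_A=\{x\in A:t(x)=0,\ n(x)=1\}$, assumed nonempty. Let $Q_A=\bigcup_{J\in\mathbb{S}_A}(\mathbb{R}+J\mathbb{R})$. A hypercomplex subspace of $A$ is a real vector subspace $V$ with $\mathbb{R}\subsetneq V\subseteq Q_A$; a hypercomplex basis of $V$ is an ordered real basis $(v_0,\ldots,v_n)$ with $n\ge1$, $v_0=1$, $v_s\in\mathbb{S}_A$ and $v_sv_u=-v_uv_s$ for distinct $s,u\in\{1,\ldots,n\}$. Setting. $V$ is a hypercomplex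 subspace of $A$ with hypercomplex basis $\mathcal{B}=(v_0,\ldots,v_n)$, completed to a real basis $\mathcal{B}'=(v_0,\ldots,v_d)$ of $A$; $\langle\cdot,\cdot\rangle$ and $\|\cdot\|$ are the Euclidean scalar product and norm on $A$ making $\mathcal{B}'$ orthonormal. A domain is a nonempty connected open subset. Fix $\tau\in\{0,\ldots,n\}$ and a list of steps $T=(t_0,\ldots,t_\tau)\in\mathbb{N}^{\tau+1}$ with $0\le t_0<t_1<\cdots<t_\tau=n$. For $0\le\ell\le m\le n$, $\mathbb{R}_{\ell,m}=\mathrm{Span}(v_\ell,\ldots,v_m)$ and $\mathbb{S}_{\ell,m}$ is its unit sphere. The $T$-torus is $\mathbb{T}=\mathbb{S}_{t_0+1,t_1}\times\cdots\times\mathbb{S}_{t_{\tau-1}+1,t_\tau}$ if $\tau\ge1$. For $J=(J_1,\ldots,J_\tau)\in\mathbb{T}$, $\mathcal{B}_J=(v_0,v_1,\ldots,v_{t_0},J_1,\ldots,J_\tau)$ and $\mathbb{R}_J^{t_0+\tau+1}=\mathrm{Span}(\mathcal{B}_J)$, with elements written $x_0+v_1x_1+\cdots+v_{t_0}x_{t_0}+\beta_1J_1+\cdots+\beta_\tau J_\tau$. If $\tau=0$, "$J\in\mathbb{T}$" is read as $J=\emptyset$, with $\mathcal{B}_\emptyset=\mathcal{B}$ and $\mathbb{R}_\emptyset^{t_0+1}=V$. For $Y\subseteq V$ and $f:Y\to A$: $Y_J=Y\cap\mathbb{R}_J^{t_0+\tau+1}$ and $f_J=f|_{Y_J}$. A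 function $f:\Omega\to A$ on a domain $\Omega\subseteq V$ is $T$-regular if for every $J\in\mathbb{T}$ the restriction $f_J$ is $J$-monogenic, i.e. of class $\mathscr{C}^1$ on the open subset $\Omega_J$ of $\mathbb{R}_J^{t_0+\tau+1}$ with $(\partial_{x_0}+v_1\partial_{x_1}+\cdots+v_{t_0}\partial_{x_{t_0}}+J_1\partial_{\beta_1}+\cdots+J_\tau\partial_{\beta_\tau})f_J\equiv0$ (vacuous if $\Omega_J=\emptyset$). Put $m=t_0+\tau$, write $\mathcal{B}_J=(w_0,\ldots,w_m)$ and let $y_0,\ldots,y_m$ be the corresponding real coordinates on $\mathbb{R}_J^{m+1}$. Then $dy^*=\sum_{s=0}^mw_s\,dy_s^*$, with $dy_s^*=(-1)^sdy_0\wedge\cdots\wedge dy_{s-1}\wedge dy_{s+1}\wedge\cdots\wedge dy_m$, is an $A$-valued $m$-form; $\int_{\partial G}\psi\,dy^*\,\phi$ is the integral over $\partial G$ (with its orientation as boundary of $G$) of the $A$-valued form $\sum_s\psi w_s\phi\,dy_s^*$, i.e. $\int_{\partial G}\psi\,\nu\,\phi\,dS$ with $\nu$ the outward unit normal regarded as an element of $\mathbb{R}_J^{m+1}\subset A$ and $dS$ the surface measure. $\sigma_m:=2\,\Gamma(\tfrac12)^{m+1}/\Gamma(\tfrac{m+1}{2})$ is the surface volume of the unit $m$-sphere in $\mathbb{R}^{m+1}$. *)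

theory Defs
  imports "HOL-Analysis.Analysis"
begin

text \<open>
  The algebra is a type of sort \<open>{real_algebra_1, euclidean_space}\<close>: an associative unital
  real algebra of finite dimension, with a scalar product. No relation between product and scalar
  product is built in; the scalar product is tied to the algebra by requiring the chosen
  basis to be orthonormal, see \<open>orthonormal_family\<close>.
\<close>

section \<open>Real star-algebras, hypercomplex subspaces and bases\<close>

definition star_involution :: "('a::real_algebra_1 \<Rightarrow> 'a) \<Rightarrow> bool" where
  "star_involution cj \<longleftrightarrow>
     linear cj \<and> (\<forall>x. cj (cj x) = x) \<and> (\<forall>x y. cj (x * y) = cj y * cj x)"

definition imag_units :: "('a::real_algebra_1 \<Rightarrow> 'a) \<Rightarrow> 'a set" where
  "imag_units cj = {x. x + cj x = 0 \<and> x * cj x = 1}"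

definition quadratic_cone :: "('a::real_algebra_1 \<Rightarrow> 'a) \<Rightarrow> 'a set" where
  "quadratic_cone cj = (\<Union>J\<in>imag_units cj. {of_real a + b *\<^sub>R J | a b. True})"

definition hypercomplex_subspace :: "('a::real_algebra_1 \<Rightarrow> 'a) \<Rightarrow> 'a set \<Rightarrow> bool" where
  "hypercomplex_subspace cj V \<longleftrightarrow>
     subspace V \<and> range of_real \<subset> V \<and> V \<subseteq> quadratic_cone cj"

definition ordered_basis :: "nat \<Rightarrow> (nat \<Rightarrow> 'a::real_vector) \<Rightarrow> 'a set \<Rightarrow> bool" where
  "ordered_basis n v V \<longleftrightarrow>
     inj_on v {..n} \<and> independent (v ` {..n}) \<and> span (v ` {..n}) = V"

definition hypercomplex_basis ::
  "('a::real_algebra_1 \<Rightarrow> 'a) \<Rightarrow> 'a set \<Rightarrow> nat \<Rightarrow> (nat \<Rightarrow> 'a) \<Rightarrow> bool" where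
  "hypercomplex_basis cj V n v \<longleftrightarrow>
     1 \<le> n \<and> ordered_basis n v V \<and> v 0 = 1 \<and>
     (\<forall>s\<in>{1..n}. v s \<in> imag_units cj) \<and>
     (\<forall>s\<in>{1..n}. \<forall>u\<in>{1..n}. s \<noteq> u \<longrightarrow> v s * v u = - (v u * v s))"

definition orthonormal_family :: "nat \<Rightarrow> (nat \<Rightarrow> 'a::real_inner) \<Rightarrow> bool" where
  "orthonormal_family d v \<longleftrightarrow> (\<forall>i\<le>d. \<forall>j\<le>d. v i \<bullet> v j = (if i = j then 1 else 0))"

section \<open>Steps, torus, slices\<close>

definition step_list :: "nat \<Rightarrow> nat \<Rightarrow> (nat \<Rightarrow> nat) \<Rightarrow> bool" where
  "step_list n \<tau> t \<longleftrightarrow> \<tau> \<le> n \<and> strict_mono_on {..\<tau>} t \<and> t \<tau> = n"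

definition sphere_between :: "(nat \<Rightarrow> 'a::real_normed_vector) \<Rightarrow> nat \<Rightarrow> nat \<Rightarrow> 'a set" where
  "sphere_between v l m = {x \<in> span (v ` {l..m}). norm x = 1}"

text \<open>For \<open>\<tau> = 0\<close> the torus has exactly one element, which plays the role of the empty tuple.\<close>

definition torus ::
  "(nat \<Rightarrow> 'a::real_normed_vector) \<Rightarrow> nat \<Rightarrow> (nat \<Rightarrow> nat) \<Rightarrow> (nat \<Rightarrow> 'a) set" where
  "torus v \<tau> t = (\<Pi>\<^sub>E k\<in>{1..\<tau>}. sphere_between v (t (k - 1) + 1) (t k))"

definition slice_basis :: "(nat \<Rightarrow> 'a) \<Rightarrow> (nat \<Rightarrow> nat) \<Rightarrow> (nat \<Rightarrow> 'a) \<Rightarrow> nat \<Rightarrow> 'a" where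
  "slice_basis v t J s = (if s \<le> t 0 then v s else J (s - t 0))"

definition slice ::
  "(nat \<Rightarrow> 'a::real_vector) \<Rightarrow> nat \<Rightarrow> (nat \<Rightarrow> nat) \<Rightarrow> (nat \<Rightarrow> 'a) \<Rightarrow> 'a set" where
  "slice v \<tau> t J = span (slice_basis v t J ` {..t 0 + \<tau>})"

section \<open>Regular functions\<close>

definition domain_in :: "'a::topological_space set \<Rightarrow> 'a set \<Rightarrow> bool" where
  "domain_in W Y \<longleftrightarrow> openin (top_of_set W) Y \<and> Y \<noteq> {} \<and> connected Y"

text \<open>
  Here \<open>Y\<close> is a relatively open subset of the linear subspace \<open>W\<close>. The derivative within \<open>Y\<close> is
  only determined on vectors of \<open>W\<close>, so continuity is required for these only.
\<close>

definition C1_on ::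
  "'a::euclidean_space set \<Rightarrow> 'a set \<Rightarrow> ('a \<Rightarrow> 'b::real_normed_vector) \<Rightarrow> bool" where
  "C1_on W Y f \<longleftrightarrow>
     (\<exists>f'. (\<forall>y\<in>Y. (f has_derivative f' y) (at y within Y)) \<and>
           (\<forall>u\<in>W. continuous_on Y (\<lambda>y. f' y u)))"

definition dir_deriv ::
  "('a::real_vector \<Rightarrow> 'b::real_normed_vector) \<Rightarrow> 'a \<Rightarrow> 'a \<Rightarrow> 'b" where
  "dir_deriv f u y = vector_derivative (\<lambda>h. f (y + h *\<^sub>R u)) (at 0)"

definition monogenic_on ::
  "nat \<Rightarrow> (nat \<Rightarrow> 'a::{real_algebra_1, euclidean_space}) \<Rightarrow> 'a set \<Rightarrow> ('a \<Rightarrow> 'a) \<Rightarrow> bool" where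
  "monogenic_on m w Y f \<longleftrightarrow>
     C1_on (span (w ` {..m})) Y f \<and> (\<forall>y\<in>Y. (\<Sum>s\<le>m. w s * dir_deriv f (w s) y) = 0)"

definition T_regular ::
  "(nat \<Rightarrow> 'a::{real_algebra_1, euclidean_space}) \<Rightarrow> nat \<Rightarrow> (nat \<Rightarrow> nat) \<Rightarrow>
   'a set \<Rightarrow> ('a \<Rightarrow> 'a) \<Rightarrow> bool" where
  "T_regular v \<tau> t \<Omega> f \<longleftrightarrow>
     (\<forall>J\<in>torus v \<tau> t. monogenic_on (t 0 + \<tau>) (slice_basis v t J) (\<Omega> \<inter> slice v \<tau> t J) f)"

section \<open>Open sets with boundary of class C1 and integration over the boundary\<close>

text \<open>
  All notions are relative to a linear subspace \<open>W\<close> of dimension \<open>m + 1\<close>. A boundary patch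
  presents \<open>G\<close> inside an open set \<open>U\<close> as the part of \<open>W\<close> strictly below the graph of a function
  \<open>\<gamma>\<close> of class C1, in the Cartesian coordinates of an orthonormal basis \<open>(b 0, \<dots>, b m)\<close> of \<open>W\<close>
  whose last axis is the vertical one. The function \<open>\<gamma>\<close> lives on the hyperplane spanned by
  \<open>b 0, \<dots>, b (m - 1)\<close>. As \<open>b m\<close> may be replaced by \<open>- b m\<close>, ``below'' is no restriction.
\<close>

definition boundary_patch ::
  "nat \<Rightarrow> 'a::euclidean_space set \<Rightarrow> 'a set \<Rightarrow> (nat \<Rightarrow> 'a) \<Rightarrow> ('a \<Rightarrow> real) \<Rightarrow> 'a set \<Rightarrow> bool" where
  "boundary_patch m W G b \<gamma> U \<longleftrightarrow>
     orthonormal_family m b \<and> span (b ` {..m}) = W \<and>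
     C1_on (span (b ` {..<m})) (span (b ` {..<m})) \<gamma> \<and> open U \<and>
     G \<inter> U = {y \<in> W \<inter> U. y \<bullet> b m < \<gamma> (y - (y \<bullet> b m) *\<^sub>R b m)}"

definition C1_boundary :: "nat \<Rightarrow> 'a::euclidean_space set \<Rightarrow> 'a set \<Rightarrow> bool" where
  "C1_boundary m W G \<longleftrightarrow>
     (\<forall>p \<in> top_of_set W frontier_of G. \<exists>b \<gamma> U. p \<in> U \<and> boundary_patch m W G b \<gamma> U)"

text \<open>
  The outward unit normal at a boundary point \<open>p\<close>: the unit vector \<open>\<nu>\<close> of \<open>W\<close> such that the
  directions \<open>u\<close> with \<open>u \<bullet> \<nu> < 0\<close> enter \<open>G\<close> and those with \<open>u \<bullet> \<nu> > 0\<close> leave the closure of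
  \<open>G\<close>. At most one vector has this property. If \<open>G\<close> is locally \<open>{g < 0}\<close> with \<open>g\<close> of class C1
  and gradient different from 0 at \<open>p\<close>, it is the normalized gradient of \<open>g\<close>.
\<close>

definition outward_normal :: "'a::euclidean_space set \<Rightarrow> 'a set \<Rightarrow> 'a \<Rightarrow> 'a" where
  "outward_normal W G p = (THE \<nu>. \<nu> \<in> W \<and> norm \<nu> = 1 \<and>
     (\<forall>u\<in>W. u \<bullet> \<nu> < 0 \<longrightarrow> (\<forall>\<^sub>F h in at_right 0. p + h *\<^sub>R u \<in> G)) \<and>
     (\<forall>u\<in>W. u \<bullet> \<nu> > 0 \<longrightarrow> (\<forall>\<^sub>F h in at_right 0. p + h *\<^sub>R u \<notin> closure G)))"

definition hyperplane_point :: "nat \<Rightarrow> (nat \<Rightarrow> 'a::real_vector) \<Rightarrow> (nat \<Rightarrow> real) \<Rightarrow> 'a" where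
  "hyperplane_point m b c = (\<Sum>i<m. c i *\<^sub>R b i)"

definition graph_point ::
  "nat \<Rightarrow> (nat \<Rightarrow> 'a::real_vector) \<Rightarrow> ('a \<Rightarrow> real) \<Rightarrow> (nat \<Rightarrow> real) \<Rightarrow> 'a" where
  "graph_point m b \<gamma> c = hyperplane_point m b c + \<gamma> (hyperplane_point m b c) *\<^sub>R b m"

text \<open>The density \<open>sqrt (1 + \<bar>\<nabla>\<gamma>\<bar>\<^sup>2)\<close> of the surface measure of a graph.\<close>

definition graph_density ::
  "nat \<Rightarrow> (nat \<Rightarrow> 'a::real_vector) \<Rightarrow> ('a \<Rightarrow> real) \<Rightarrow> (nat \<Rightarrow> real) \<Rightarrow> real" where
  "graph_density m b \<gamma> c = sqrt (1 + (\<Sum>i<m. (dir_deriv \<gamma> (b i) (hyperplane_point m b c))\<^sup>2))"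

text \<open>
  The integral of \<open>h\<close> over the boundary of \<open>G\<close> with respect to surface measure, in the usual
  way: a finite cover of the boundary by patches, a subordinate partition of unity \<open>\<rho>\<close> of class
  C1, and integration of each \<open>\<rho> i * h\<close> in the parameters of the \<open>i\<close>-th graph (the parameter
  space is the \<open>m\<close>-fold product of Lebesgue measure on the line). Outside \<open>U i\<close> the graph need
  not lie in the boundary, but there \<open>\<rho> i\<close> vanishes. The value does not depend on the choices.
\<close>

definition patch_integrand ::
  "nat \<Rightarrow> (nat \<Rightarrow> 'a::real_vector) \<Rightarrow> ('a \<Rightarrow> real) \<Rightarrow> ('a \<Rightarrow> real) \<Rightarrow> ('a \<Rightarrow> 'b::real_vector) \<Rightarrow>
   (nat \<Rightarrow> real) \<Rightarrow> 'b" where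
  "patch_integrand m b \<gamma> \<rho> h c =
     (graph_density m b \<gamma> c * \<rho> (graph_point m b \<gamma> c)) *\<^sub>R h (graph_point m b \<gamma> c)"

definition has_boundary_integral ::
  "nat \<Rightarrow> 'a::euclidean_space set \<Rightarrow> 'a set \<Rightarrow> ('a \<Rightarrow> 'b::euclidean_space) \<Rightarrow> 'b \<Rightarrow> bool" where
  "has_boundary_integral m W G h I \<longleftrightarrow>
     (\<exists>(N::nat) b \<gamma> U \<rho>.
        (\<forall>i<N. boundary_patch m W G (b i) (\<gamma> i) (U i)) \<and>
        (\<forall>i<N. C1_on W W (\<rho> i) \<and> (\<forall>y\<in>W. 0 \<le> \<rho> i y) \<and>
               (\<exists>K. compact K \<and> K \<subseteq> U i \<and> (\<forall>y\<in>W - K. \<rho> i y = 0))) \<and>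
        (\<forall>y \<in> top_of_set W frontier_of G. (\<Sum>i<N. \<rho> i y) = 1) \<and>
        (\<forall>i<N. integrable (\<Pi>\<^sub>M j\<in>{..<m}. lborel) (patch_integrand m (b i) (\<gamma> i) (\<rho> i) h)) \<and>
        I = (\<Sum>i<N. integral\<^sup>L (\<Pi>\<^sub>M j\<in>{..<m}. lborel)
                      (patch_integrand m (b i) (\<gamma> i) (\<rho> i) h)))"

definition boundary_integral ::
  "nat \<Rightarrow> 'a::euclidean_space set \<Rightarrow> 'a set \<Rightarrow> ('a \<Rightarrow> 'b::euclidean_space) \<Rightarrow> 'b" where
  "boundary_integral m W G h = (THE I. has_boundary_integral m W G h I)"

text \<open>
  The integral of \<open>\<psi> dy\<^sup>* \<phi>\<close> over the boundary of \<open>G\<close>, oriented as such: there the vector-valued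
  form \<open>dy\<^sup>* = \<Sum>s. w s dy\<^sub>s\<^sup>*\<close> is the outward unit normal times the surface measure.
\<close>

definition boundary_form_integral ::
  "nat \<Rightarrow> 'a::{real_algebra_1, euclidean_space} set \<Rightarrow> 'a set \<Rightarrow> ('a \<Rightarrow> 'a) \<Rightarrow> ('a \<Rightarrow> 'a) \<Rightarrow> 'a"
  where
  "boundary_form_integral m W G \<psi> \<phi> =
     boundary_integral m W G (\<lambda>y. \<psi> y * outward_normal W G y * \<phi> y)"

text \<open>The surface volume of the unit sphere of dimension \<open>m\<close>.\<close>

definition unit_sphere_volume :: "nat \<Rightarrow> real" where
  "unit_sphere_volume m = 2 * Gamma (1/2) ^ (m + 1) / Gamma ((real m + 1) / 2)"

end

theory Submission
  imports Defs
begin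

text \<open>
  On a slice \<open>W\<close>, of dimension \<open>m + 1\<close>, conjugation satisfies \<open>cj z * z = \<bar>z\<bar>\<^sup>2\<close>. By associativity the
  fields \<open>F s = E * w s * f\<close>, where \<open>E y = cj (y - x) / \<bar>y - x\<bar> ^ (m + 1)\<close>, therefore have
  divergence 0 for monogenic \<open>f\<close>, and the boundary integral is the flux of these fields. To avoid
  the singularity, the radial factor of \<open>E\<close> is continued inside the ball of radius \<open>\<epsilon>\<close> by its
  tangent as a function of \<open>\<bar>y - x\<bar>\<^sup>2\<close>. If \<open>x\<close> lies outside \<open>closure G\<close> and \<open>\<epsilon>\<close> is small, the
  divergence still vanishes on \<open>G\<close>. If \<open>x \<in> G\<close>, the divergence becomes \<open>f\<close> times a positive
  function supported in the ball, whose integral is the area of the unit sphere; let \<open>\<epsilon>\<close> tend to 0.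

  The divergence theorem also shows that the boundary integral is well defined: a partition of unity
  reduces the integral over the boundary to volume integrals, and the fields \<open>(\<Sum>i. \<rho> i) F s\<close> and
  \<open>F s\<close>, which agree on the boundary, have the same divergence integral over \<open>G\<close>.
\<close>

section \<open>Lebesgue measure on a linear subspace\<close>

text \<open>Each boundary patch brings its own orthonormal basis, while the divergence is written in
  the basis of the slice. The volume integrals that the patches produce can only be added once
  Lebesgue measure on \<open>W\<close> is known not to depend on the basis; this comes before
  everything else.

  The divergence theorem is proved for fields of class C1 on all of \<open>W\<close>. Hence
  \<open>f\<close> is multiplied by a cut-off that is 1 near \<open>closure G\<close>, and the
  continued radial factor must match value and slope: the tangent is the simplest choice. For a
  profile \<open>q\<close> of \<open>s = (norm z)\<^sup>2\<close> in dimension \<open>k\<close>, the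
  divergence of the field \<open>q z\<close> is \<open>k q + 2 s q'\<close>. It vanishes for
  \<open>s powr - (k / 2)\<close>; for the tangent it is a multiple of
  \<open>1 - s / \<epsilon>\<^sup>2\<close>, and its integral over the ball is \<open>k\<close>
  times the volume of the unit ball, whatever \<open>\<epsilon>\<close> is. The boundary integral
  does not depend on \<open>\<epsilon>\<close> either, so the limit needs only the continuity of
  \<open>f\<close> at \<open>x\<close>.\<close>

definition subspace_measure :: "nat \<Rightarrow> (nat \<Rightarrow> 'a::euclidean_space) \<Rightarrow> 'a measure" where
  "subspace_measure k b = distr (\<Pi>\<^sub>M j\<in>{..<k}. lborel) borel (hyperplane_point k b)"

text \<open>The strict bound admits the empty family, which parametrises the graphs in a
  one-dimensional \<open>W\<close>, and lets a basis of \<open>W\<close> and its first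
  \<open>m\<close> vectors be treated by one notion.\<close>

definition orthonormal_below :: "nat \<Rightarrow> (nat \<Rightarrow> 'a::real_inner) \<Rightarrow> bool" where
  "orthonormal_below k b \<longleftrightarrow> (\<forall>i<k. \<forall>j<k. b i \<bullet> b j = (if i = j then 1 else 0))"

lemma orthonormal_family_iff: "orthonormal_family m b \<longleftrightarrow> orthonormal_below (Suc m) b"
  by (auto simp: orthonormal_family_def orthonormal_below_def less_Suc_eq_le)

lemma orthonormal_below_mono: "orthonormal_below k b \<Longrightarrow> l \<le> k \<Longrightarrow> orthonormal_below l b"
  by (auto simp: orthonormal_below_def)

lemma space_subspace_measure [simp]: "space (subspace_measure k b) = UNIV"
  and sets_subspace_measure [simp, measurable_cong]: "sets (subspace_measure k b) = sets borel"
  by (simp_all add: subspace_measure_def)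

lemma measurable_hyperplane_point [measurable]:
  fixes b :: "nat \<Rightarrow> 'a::euclidean_space"
  shows "hyperplane_point k b \<in> borel_measurable (\<Pi>\<^sub>M j\<in>{..<k}. lborel)"
  unfolding hyperplane_point_def[abs_def] by measurable

section \<open>Coordinates in an orthonormal basis\<close>

lemma hyperplane_point_in_span: "hyperplane_point k b c \<in> span (b ` {..<k})"
  unfolding hyperplane_point_def by (intro span_sum span_mul span_base) auto

lemma in_span_hyperplane_point:
  assumes "y \<in> span (b ` {..<k})"
  shows "\<exists>c. y = hyperplane_point k b c"
  using assms
proof (induction rule: span_induct_alt)
  case base
  show ?case by (rule exI[of _ "\<lambda>_. 0"]) (simp add: hyperplane_point_def)
next
  case (step r x y)
  then obtain c i where c: "y = hyperplane_point k b c" and i: "i < k" "x = b i" by auto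
  have "(\<Sum>j<k. (if i = j then r else 0) *\<^sub>R b j) = (\<Sum>j<k. if i = j then r *\<^sub>R b j else 0)"
    by (rule sum.cong) auto
  then have "r *\<^sub>R x + y = hyperplane_point k b (\<lambda>j. c j + (if i = j then r else 0))"
    using i by (simp add: c hyperplane_point_def scaleR_add_left sum.distrib)
  then show ?case by blast
qed

text \<open>The second bound \<open>l\<close> gives access to axes beyond the
  \<open>k\<close>-dimensional hyperplane, in particular to the vertical axis of a graph, on which
  the component is 0.\<close>

lemma inner_hyperplane_point:
  assumes "orthonormal_below l b" "k \<le> l" "i < l"
  shows "hyperplane_point k b c \<bullet> b i = (if i < k then c i else 0)"
proof -
  have "hyperplane_point k b c \<bullet> b i = (\<Sum>j<k. c j * (b j \<bullet> b i))"
    by (simp add: hyperplane_point_def inner_sum_left)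
  also have "\<dots> = (\<Sum>j<k. if i = j then c j else 0)"
    using assms by (intro sum.cong) (auto simp: orthonormal_below_def)
  finally show ?thesis by simp
qed

lemma norm_hyperplane_point:
  assumes "orthonormal_below k b"
  shows "norm (hyperplane_point k b c) = sqrt (\<Sum>i<k. (c i)\<^sup>2)"
proof -
  have "hyperplane_point k b c \<bullet> hyperplane_point k b c
        = (\<Sum>i<k. c i * (hyperplane_point k b c \<bullet> b i))"
    by (subst (2) hyperplane_point_def) (simp add: inner_sum_right)
  also have "\<dots> = (\<Sum>i<k. (c i)\<^sup>2)"
    by (rule sum.cong) (auto simp: inner_hyperplane_point[OF assms] power2_eq_square)
  finally show ?thesis by (simp add: norm_eq_sqrt_inner)
qed

lemma hyperplane_point_inner:
  assumes "orthonormal_below k b" "y \<in> span (b ` {..<k})"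
  shows "hyperplane_point k b (\<lambda>i. y \<bullet> b i) = y"
proof -
  obtain c where "y = hyperplane_point k b c" using in_span_hyperplane_point[OF assms(2)] by blast
  then show ?thesis
    using inner_hyperplane_point[OF assms(1) order_refl] by (simp add: hyperplane_point_def)
qed

lemma AE_subspace_measure: "AE y in subspace_measure k b. y \<in> span (b ` {..<k})"
  unfolding subspace_measure_def
  by (subst AE_distr_iff) (auto intro: closed_subspace borel_closed simp: hyperplane_point_in_span)

lemma nn_integral_subspace_measure:
  "f \<in> borel_measurable borel \<Longrightarrow>
    (\<integral>\<^sup>+y. f y \<partial>subspace_measure k b) = (\<integral>\<^sup>+c. f (hyperplane_point k b c) \<partial>(\<Pi>\<^sub>M j\<in>{..<k}. lborel))"
  unfolding subspace_measure_def by (simp add: nn_integral_distr)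

text \<open>Tonelli in the last coordinate. Inductions on the dimension use it to reduce a claim to
  the real line.\<close>

lemma nn_integral_subspace_measure_Suc:
  assumes [measurable]: "f \<in> borel_measurable borel"
  shows "(\<integral>\<^sup>+y. f y \<partial>subspace_measure (Suc k) b) =
         (\<integral>\<^sup>+y. \<integral>\<^sup>+s. f (y + s *\<^sub>R b k) \<partial>lborel \<partial>subspace_measure k b)"
proof -
  interpret product_sigma_finite "\<lambda>_::nat. lborel :: real measure" ..
  have upd: "hyperplane_point (Suc k) b (c(k := s)) = hyperplane_point k b c + s *\<^sub>R b k" for c s
    by (simp add: hyperplane_point_def)
  have [measurable]: "f \<in> borel_measurable (subspace_measure k b)" by simp
  have "(\<integral>\<^sup>+y. f y \<partial>subspace_measure (Suc k) b)
      = (\<integral>\<^sup>+c. f (hyperplane_point (Suc k) b c) \<partial>(\<Pi>\<^sub>M j\<in>insert k {..<k}. lborel))"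
    by (simp add: nn_integral_subspace_measure lessThan_Suc)
  also have "\<dots> = (\<integral>\<^sup>+c. \<integral>\<^sup>+s. f (hyperplane_point (Suc k) b (c(k := s))) \<partial>lborel \<partial>(\<Pi>\<^sub>M j\<in>{..<k}. lborel))"
    using measurable_hyperplane_point[of "Suc k" b]
    by (subst product_nn_integral_insert) (auto simp: lessThan_Suc)
  also have "\<dots> = (\<integral>\<^sup>+y. \<integral>\<^sup>+s. f (y + s *\<^sub>R b k) \<partial>lborel \<partial>subspace_measure k b)"
    unfolding upd by (subst nn_integral_subspace_measure) measurable
  finally show ?thesis .
qed

text \<open>The same splitting as an identity of measures, which also serves Bochner integrals of
  vector-valued functions.\<close>

lemma subspace_measure_Suc:
  "subspace_measure (Suc k) b =
     distr (subspace_measure k b \<Otimes>\<^sub>M lborel) borel (\<lambda>(y, s). y + s *\<^sub>R b k)" (is "_ = ?R")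
proof (rule measure_eqI)
  fix A assume "A \<in> sets (subspace_measure (Suc k) b)"
  then have [measurable]: "A \<in> sets borel" by simp
  have "emeasure (subspace_measure (Suc k) b) A = (\<integral>\<^sup>+y. indicator A y \<partial>subspace_measure (Suc k) b)"
    by simp
  also have "\<dots> = (\<integral>\<^sup>+y. \<integral>\<^sup>+s. indicator A (y + s *\<^sub>R b k) \<partial>lborel \<partial>subspace_measure k b)"
    by (rule nn_integral_subspace_measure_Suc) measurable
  also have "\<dots> = (\<integral>\<^sup>+p. indicator A (case p of (y, s) \<Rightarrow> y + s *\<^sub>R b k) \<partial>(subspace_measure k b \<Otimes>\<^sub>M lborel))"
    by (subst lborel.nn_integral_fst[symmetric]) auto
  also have "\<dots> = (\<integral>\<^sup>+y. indicator A y \<partial>?R)"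
    by (subst nn_integral_distr) auto
  finally show "emeasure (subspace_measure (Suc k) b) A = emeasure ?R A" by simp
qed simp

text \<open>Orthonormality turns the ball into the Euclidean ball of coordinates. Its volume does
  not involve \<open>b\<close>, so it can normalise the comparison of two bases.\<close>

lemma emeasure_subspace_measure_cball:
  assumes "orthonormal_below k b" "0 < r"
  shows "emeasure (subspace_measure k b) (cball 0 r) = ennreal (unit_ball_vol (real k) * r ^ k)"
proof -
  let ?P = "\<Pi>\<^sub>M j\<in>{..<k}. (lborel :: real measure)"
  have "emeasure (subspace_measure k b) (cball 0 r) =
        emeasure ?P (hyperplane_point k b -` cball 0 r \<inter> space ?P)"
    unfolding subspace_measure_def by (subst emeasure_distr) auto
  also have "hyperplane_point k b -` cball 0 r = {c. sqrt (\<Sum>i<k. (c i)\<^sup>2) \<le> r}"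
    by (auto simp: norm_hyperplane_point[OF assms(1)])
  finally show ?thesis using emeasure_cball_aux[of "{..<k}" r] assms(2) by simp
qed

lemma emeasure_subspace_measure_bounded:
  assumes "orthonormal_below k b" "bounded A"
  shows "emeasure (subspace_measure k b) A < \<infinity>"
proof -
  obtain r where r: "0 < r" "A \<subseteq> cball 0 r"
    using bounded_pos[of A] assms(2) by (auto simp: subset_iff)
  have "emeasure (subspace_measure k b) A \<le> emeasure (subspace_measure k b) (cball 0 r)"
    using r(2) by (intro emeasure_mono) auto
  then show ?thesis
    using emeasure_subspace_measure_cball[OF assms(1) r(1)] by (simp add: le_less_trans)
qed

lemma sigma_finite_subspace_measure:
  assumes "orthonormal_below k b"
  shows "sigma_finite_measure (subspace_measure k b)"
proof (rule sigma_finite_measure.intro, intro exI conjI)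
  show "countable (range (\<lambda>n. cball (0::'a) (real n)))" by simp
  show "\<Union> (range (\<lambda>n. cball (0::'a) (real n))) = space (subspace_measure k b)"
    using real_arch_simple by auto
  show "\<forall>a\<in>range (\<lambda>n. cball 0 (real n)). emeasure (subspace_measure k b) a \<noteq> \<infinity>"
    using emeasure_subspace_measure_bounded[OF assms bounded_cball] by (auto simp: less_top)
qed auto

text \<open>The translation is split along the last axis: the multiple of \<open>b k\<close> is
  absorbed by the inner integral over the line, the rest by the induction hypothesis.\<close>

lemma nn_integral_subspace_measure_translate:
  assumes "f \<in> borel_measurable borel" "w \<in> span (b ` {..<k})"
  shows "(\<integral>\<^sup>+y. f (y + w) \<partial>subspace_measure k b) = (\<integral>\<^sup>+y. f y \<partial>subspace_measure k b)"
  using assms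
proof (induction k arbitrary: f w)
  case (Suc k)
  note [measurable] = Suc.prems(1)
  obtain a where a: "w - a *\<^sub>R b k \<in> span (b ` {..<k})"
    using Suc.prems(2) by (auto simp: lessThan_Suc span_breakdown_eq)
  have "(\<integral>\<^sup>+s. f (y + s *\<^sub>R b k + w) \<partial>lborel) = (\<integral>\<^sup>+s. f (y + (w - a *\<^sub>R b k) + s *\<^sub>R b k) \<partial>lborel)" for y
    by (subst (2) nn_integral_real_affine[where c = 1 and t = a]) (auto simp: algebra_simps)
  then show ?case
    using Suc.IH[OF _ a, of "\<lambda>y. \<integral>\<^sup>+s. f (y + s *\<^sub>R b k) \<partial>lborel"]
    by (simp add: nn_integral_subspace_measure_Suc)
qed simp

lemma nn_integral_subspace_measure_reflect:
  assumes "f \<in> borel_measurable borel"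
  shows "(\<integral>\<^sup>+y. f (- y) \<partial>subspace_measure k b) = (\<integral>\<^sup>+y. f y \<partial>subspace_measure k b)"
  using assms
proof (induction k arbitrary: f)
  case 0
  \<comment> \<open>In dimension 0 the measure is concentrated at the origin, which the reflection
    fixes.\<close>
  have "AE y in subspace_measure 0 b. y = 0" using AE_subspace_measure[of b 0] by simp
  then show ?case by (intro nn_integral_cong_AE) auto
next
  case (Suc k)
  note [measurable] = Suc.prems(1)
  have "(\<integral>\<^sup>+s. f (- (y + s *\<^sub>R b k)) \<partial>lborel) = (\<integral>\<^sup>+s. f (- y + s *\<^sub>R b k) \<partial>lborel)" for y
    by (subst (2) nn_integral_real_affine[where c = "-1" and t = 0]) (auto simp: algebra_simps)
  then show ?case
    using Suc.IH[of "\<lambda>y. \<integral>\<^sup>+s. f (y + s *\<^sub>R b k) \<partial>lborel"]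
    by (simp add: nn_integral_subspace_measure_Suc)
qed

text \<open>The double integral below is computed once by translating the inner and once by
  translating the outer variable, as in the proof that Haar measure is unique up to a factor.\<close>

lemma nn_integral_subspace_measure_swap:
  assumes on: "orthonormal_below k b" "orthonormal_below k b'"
    and sp: "span (b ` {..<k}) = span (b' ` {..<k})"
    and [measurable]: "\<phi> \<in> borel_measurable borel" "\<psi> \<in> borel_measurable borel"
  shows "(\<integral>\<^sup>+y. \<phi> y \<partial>subspace_measure k b) * (\<integral>\<^sup>+y. \<psi> y \<partial>subspace_measure k b') =
         (\<integral>\<^sup>+y. \<psi> y \<partial>subspace_measure k b) * (\<integral>\<^sup>+y. \<phi> y \<partial>subspace_measure k b')"
proof -
  let ?M = "subspace_measure k b" and ?N = "subspace_measure k b'" and ?W = "span (b ` {..<k})"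
  interpret M: sigma_finite_measure ?M by (rule sigma_finite_subspace_measure[OF on(1)])
  interpret N: sigma_finite_measure ?N by (rule sigma_finite_subspace_measure[OF on(2)])
  interpret pair_sigma_finite ?M ?N ..
  have AE: "AE y in ?M. y \<in> ?W" "AE y in ?N. y \<in> ?W"
    using AE_subspace_measure[of b k] AE_subspace_measure[of b' k] sp by auto
  have "(\<integral>\<^sup>+y. \<phi> y \<partial>?M) * (\<integral>\<^sup>+y. \<psi> y \<partial>?N) = (\<integral>\<^sup>+c. \<integral>\<^sup>+d. \<phi> c * \<psi> d \<partial>?N \<partial>?M)"
    by (simp add: nn_integral_cmult nn_integral_multc)
  also have "\<dots> = (\<integral>\<^sup>+c. \<integral>\<^sup>+d. \<phi> c * \<psi> (d + c) \<partial>?N \<partial>?M)"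
  proof (rule nn_integral_cong_AE, use AE(1) in eventually_elim)
    case (elim c)
    then show ?case
      using nn_integral_subspace_measure_translate[of "\<lambda>d. \<phi> c * \<psi> d" c b' k] sp by simp
  qed
  also have "\<dots> = (\<integral>\<^sup>+d. \<integral>\<^sup>+c. \<phi> c * \<psi> (d + c) \<partial>?M \<partial>?N)"
    by (rule Fubini'[symmetric]) measurable
  also have "\<dots> = (\<integral>\<^sup>+d. \<integral>\<^sup>+c. \<phi> (c - d) * \<psi> c \<partial>?M \<partial>?N)"
  proof (rule nn_integral_cong_AE, use AE(2) in eventually_elim)
    case (elim d)
    then show ?case
      using nn_integral_subspace_measure_translate[of "\<lambda>c. \<phi> (c - d) * \<psi> c" d b k]
      by (simp add: add.commute)
  qed
  also have "\<dots> = (\<integral>\<^sup>+c. \<integral>\<^sup>+d. \<phi> (c - d) * \<psi> c \<partial>?N \<partial>?M)"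
    by (rule Fubini') measurable
  also have "\<dots> = (\<integral>\<^sup>+c. \<integral>\<^sup>+d. \<phi> d * \<psi> c \<partial>?N \<partial>?M)"
  proof (rule nn_integral_cong_AE, use AE(1) in eventually_elim)
    case (elim c)
    \<comment> \<open>Reflecting \<open>d\<close> turns \<open>c - d\<close> into
      \<open>d + c\<close>, so that a translation by \<open>c\<close> can remove the dependence on
      \<open>c\<close>.\<close>
    have "(\<integral>\<^sup>+d. \<phi> (c - d) * \<psi> c \<partial>?N) = (\<integral>\<^sup>+d. \<phi> (d + c) * \<psi> c \<partial>?N)"
      using nn_integral_subspace_measure_reflect[of "\<lambda>d. \<phi> (d + c) * \<psi> c" k b'] by simp
    then show ?case
      using nn_integral_subspace_measure_translate[of "\<lambda>d. \<phi> d * \<psi> c" c b' k] sp elim by simp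
  qed
  also have "\<dots> = (\<integral>\<^sup>+y. \<psi> y \<partial>?M) * (\<integral>\<^sup>+y. \<phi> y \<partial>?N)"
    by (simp add: nn_integral_cmult nn_integral_multc mult.commute)
  finally show ?thesis .
qed

text \<open>The exchange identity is tested on the indicators of the unit ball and of an arbitrary
  Borel set. Both measures give the ball the same finite nonzero volume, which cancels.\<close>

lemma subspace_measure_unique:
  assumes on: "orthonormal_below k b" "orthonormal_below k b'"
    and sp: "span (b ` {..<k}) = span (b' ` {..<k})"
  shows "subspace_measure k b = subspace_measure k b'"
proof (rule measure_eqI)
  fix A assume "A \<in> sets (subspace_measure k b)"
  then have [measurable]: "A \<in> sets borel" by simp
  have "emeasure (subspace_measure k b) (cball 0 1) * emeasure (subspace_measure k b') A =
        emeasure (subspace_measure k b) A * emeasure (subspace_measure k b') (cball 0 1)"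
    using nn_integral_subspace_measure_swap[OF on sp, of "indicator (cball 0 1)" "indicator A"]
    by (simp add: borel_measurable_indicator borel_closed)
  then have "ennreal (unit_ball_vol (real k)) * emeasure (subspace_measure k b') A =
        ennreal (unit_ball_vol (real k)) * emeasure (subspace_measure k b) A"
    using emeasure_subspace_measure_cball[OF on(1), of 1] emeasure_subspace_measure_cball[OF on(2), of 1]
    by (simp add: mult.commute)
  moreover have "unit_ball_vol (real k) \<noteq> 0"
    using unit_ball_vol_pos[of "real k"] by linarith
  ultimately show "emeasure (subspace_measure k b) A = emeasure (subspace_measure k b') A"
    by (simp add: ennreal_mult_cancel_left)
qed simp

section \<open>Functions of class C1 on open subsets of a linear subspace\<close>

lemma at_within_openin:
  assumes "openin (top_of_set W) Y" "y \<in> Y"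
  shows "at y within Y = at y within W"
proof -
  obtain U where "open U" "Y = W \<inter> U" using assms(1) by (auto simp: openin_open)
  then show ?thesis using assms(2) by (intro at_within_nhd[of y U]) auto
qed

section \<open>Directional derivatives of functions of class C1\<close>

lemma C1_on_has_derivative:
  assumes "C1_on W Y f"
  obtains f' where "\<And>y. y \<in> Y \<Longrightarrow> (f has_derivative f' y) (at y within Y)"
    "\<And>u. u \<in> W \<Longrightarrow> continuous_on Y (\<lambda>y. f' y u)"
proof -
  obtain f' where f': "(\<forall>y\<in>Y. (f has_derivative f' y) (at y within Y)) \<and>
      (\<forall>u\<in>W. continuous_on Y (\<lambda>y. f' y u))"
    using assms unfolding C1_on_def ..
  show ?thesis
  proof (rule that)
    show "(f has_derivative f' y) (at y within Y)" if "y \<in> Y" for y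
      using bspec[OF conjunct1[OF f'] that] .
    show "continuous_on Y (\<lambda>y. f' y u)" if "u \<in> W" for u
      using bspec[OF conjunct2[OF f'] that] .
  qed
qed

lemma C1_on_I:
  assumes "\<And>y. y \<in> Y \<Longrightarrow> (f has_derivative f' y) (at y within Y)"
    and "\<And>u. u \<in> W \<Longrightarrow> continuous_on Y (\<lambda>y. f' y u)"
  shows "C1_on W Y f"
  unfolding C1_on_def by (rule exI[of _ f']) (use assms in simp)

lemma dir_deriv_eqI:
  "((\<lambda>h. f (y + h *\<^sub>R u)) has_vector_derivative D) (at 0) \<Longrightarrow> dir_deriv f u y = D"
  unfolding dir_deriv_def by (rule vector_derivative_at)

text \<open>Relative openness keeps \<open>y + h *\<^sub>R u\<close> inside \<open>Y\<close> for
  \<open>h\<close> near 0, so a derivative within \<open>Y\<close> yields a two-sided derivative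
  along the line.\<close>

lemma has_vector_derivative_line:
  fixes f :: "'a::real_normed_vector \<Rightarrow> 'b::real_normed_vector"
  assumes "subspace W" "openin (top_of_set W) Y" "y \<in> Y" "u \<in> W"
    and "(f has_derivative D) (at y within Y)"
  shows "((\<lambda>h. f (y + h *\<^sub>R u)) has_vector_derivative D u) (at 0)"
proof -
  obtain U where U: "open U" "Y = W \<inter> U" using assms(2) by (auto simp: openin_open)
  define H where "H = {h::real. y + h *\<^sub>R u \<in> U}"
  have "continuous_on UNIV (\<lambda>h::real. y + h *\<^sub>R u)" by (intro continuous_intros)
  then have "open H" using open_vimage[OF U(1)] by (simp add: H_def vimage_def)
  moreover have "0 \<in> H" using U assms(3) by (simp add: H_def)
  ultimately have at0: "at 0 within H = at 0" by (intro at_within_open)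
  have "y \<in> W" using U assms(3) by simp
  then have "y + h *\<^sub>R u \<in> W" for h by (rule subspace_add[OF assms(1) _ subspace_mul[OF assms(1,4)]])
  then have sub: "(\<lambda>h. y + h *\<^sub>R u) ` H \<subseteq> Y" unfolding U(2) H_def by blast
  have "((\<lambda>h. y + h *\<^sub>R u) has_derivative (\<lambda>h. 0 + h *\<^sub>R u)) (at 0 within H)"
    by (intro has_derivative_add has_derivative_const has_derivative_scaleR_left has_derivative_ident)
  moreover have "(f has_derivative D) (at (y + 0 *\<^sub>R u) within (\<lambda>h. y + h *\<^sub>R u) ` H)"
    using has_derivative_subset[OF assms(5) sub] by simp
  ultimately have "((\<lambda>h. f (y + h *\<^sub>R u)) has_derivative (\<lambda>h. D (0 + h *\<^sub>R u))) (at 0 within H)"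
    by (rule has_derivative_in_compose)
  moreover have "D (0 + h *\<^sub>R u) = h *\<^sub>R D u" for h
    using linear_cmul[OF has_derivative_linear[OF assms(5)]] by simp
  ultimately show ?thesis by (simp only: has_vector_derivative_def at0)
qed

lemma dir_deriv_eq_has_derivative:
  assumes "subspace W" "openin (top_of_set W) Y" "y \<in> Y" "u \<in> W"
    and "(f has_derivative D) (at y within Y)"
  shows "dir_deriv f u y = D u"
  unfolding dir_deriv_def by (rule vector_derivative_at[OF has_vector_derivative_line[OF assms]])

text \<open>On vectors of \<open>W\<close> a derivative within \<open>Y\<close> is determined by the
  lines through the point, so every witness of \<open>C1_on\<close> agrees there with
  \<open>dir_deriv\<close>. Off \<open>W\<close> witnesses may differ.\<close>

lemma C1_onE:
  assumes "C1_on W Y f" "subspace W" "openin (top_of_set W) Y"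
  obtains f' where "\<And>y. y \<in> Y \<Longrightarrow> (f has_derivative f' y) (at y within Y)"
    "\<And>y u. y \<in> Y \<Longrightarrow> u \<in> W \<Longrightarrow> f' y u = dir_deriv f u y"
proof -
  obtain f' where f': "\<And>y. y \<in> Y \<Longrightarrow> (f has_derivative f' y) (at y within Y)"
    "\<And>u. u \<in> W \<Longrightarrow> continuous_on Y (\<lambda>y. f' y u)"
    using C1_on_has_derivative[OF assms(1)] by blast
  show ?thesis
  proof (rule that)
    show "(f has_derivative f' y) (at y within Y)" if "y \<in> Y" for y by (rule f'(1)[OF that])
    show "f' y u = dir_deriv f u y" if "y \<in> Y" "u \<in> W" for y u
      by (rule dir_deriv_eq_has_derivative[OF assms(2,3) that f'(1)[OF that(1)], symmetric])
  qed
qed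

lemma C1_on_continuous_dir_deriv:
  assumes "C1_on W Y f" "subspace W" "openin (top_of_set W) Y" "u \<in> W"
  shows "continuous_on Y (dir_deriv f u)"
proof -
  obtain f' where f': "\<And>y. y \<in> Y \<Longrightarrow> (f has_derivative f' y) (at y within Y)"
    "\<And>u. u \<in> W \<Longrightarrow> continuous_on Y (\<lambda>y. f' y u)"
    using C1_on_has_derivative[OF assms(1)] by blast
  have "dir_deriv f u y = f' y u" if "y \<in> Y" for y
    by (rule dir_deriv_eq_has_derivative[OF assms(2,3) that assms(4) f'(1)[OF that]])
  then show ?thesis using f'(2)[OF assms(4)] by (simp cong: continuous_on_cong)
qed

lemma C1_on_has_vector_derivative:
  assumes "C1_on W Y f" "subspace W" "openin (top_of_set W) Y" "y \<in> Y" "u \<in> W"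
  shows "((\<lambda>h. f (y + h *\<^sub>R u)) has_vector_derivative dir_deriv f u y) (at 0)"
proof -
  obtain f' where f': "\<And>y. y \<in> Y \<Longrightarrow> (f has_derivative f' y) (at y within Y)"
    "\<And>y u. y \<in> Y \<Longrightarrow> u \<in> W \<Longrightarrow> f' y u = dir_deriv f u y"
    using C1_onE[OF assms(1-3)] by blast
  show ?thesis
    using has_vector_derivative_line[OF assms(2-5) f'(1)[OF assms(4)]] f'(2)[OF assms(4,5)] by simp
qed

lemma C1_on_has_vector_derivative_at:
  assumes "C1_on W Y f" "subspace W" "openin (top_of_set W) Y" "y + s *\<^sub>R u \<in> Y" "u \<in> W"
  shows "((\<lambda>h. f (y + h *\<^sub>R u)) has_vector_derivative dir_deriv f u (y + s *\<^sub>R u)) (at s)"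
proof -
  have "((\<lambda>h. f (y + s *\<^sub>R u + h *\<^sub>R u)) \<circ> (\<lambda>h. h - s) has_vector_derivative
      1 *\<^sub>R dir_deriv f u (y + s *\<^sub>R u)) (at s)"
    using C1_on_has_vector_derivative[OF assms]
    by (intro vector_diff_chain_at) (auto intro!: derivative_eq_intros)
  then show ?thesis by (simp add: o_def algebra_simps)
qed

lemma C1_on_continuous: "C1_on W Y f \<Longrightarrow> continuous_on Y f"
  by (erule C1_on_has_derivative) (rule has_derivative_continuous_on)

lemma dir_deriv_linear:
  assumes "C1_on W Y f" "subspace W" "openin (top_of_set W) Y" "y \<in> Y" "finite S"
    and "\<And>i. i \<in> S \<Longrightarrow> u i \<in> W"
  shows "dir_deriv f (\<Sum>i\<in>S. r i *\<^sub>R u i) y = (\<Sum>i\<in>S. r i *\<^sub>R dir_deriv f (u i) y)"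
proof -
  obtain f' where f0: "\<And>y. y \<in> Y \<Longrightarrow> (f has_derivative f' y) (at y within Y)"
    "\<And>y u. y \<in> Y \<Longrightarrow> u \<in> W \<Longrightarrow> f' y u = dir_deriv f u y"
    using C1_onE[OF assms(1-3)] by blast
  note f' = f0(1)[OF assms(4)] f0(2)[OF assms(4)]
  have "linear (f' y)" using f'(1) by (rule has_derivative_linear)
  have "dir_deriv f (\<Sum>i\<in>S. r i *\<^sub>R u i) y = f' y (\<Sum>i\<in>S. r i *\<^sub>R u i)"
    using assms(2,6) by (intro f'(2)[symmetric] subspace_sum subspace_mul)
  also have "\<dots> = (\<Sum>i\<in>S. r i *\<^sub>R f' y (u i))"
    using \<open>linear (f' y)\<close> by (simp add: linear_sum linear_cmul)
  also have "\<dots> = (\<Sum>i\<in>S. r i *\<^sub>R dir_deriv f (u i) y)"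
    by (rule sum.cong) (auto simp: f'(2) assms(6))
  finally show ?thesis .
qed

section \<open>Closure properties of class C1\<close>

lemma C1_on_const: "C1_on W Y (\<lambda>_. c)"
  by (rule C1_on_I[where f' = "\<lambda>_ _. 0"]) auto

lemma C1_on_bounded_linear: "bounded_linear f \<Longrightarrow> C1_on W Y f"
  by (rule C1_on_I[where f' = "\<lambda>_. f"]) (auto intro: bounded_linear_imp_has_derivative)

lemma C1_on_add:
  assumes "C1_on W Y f" "C1_on W Y g"
  shows "C1_on W Y (\<lambda>y. f y + g y)"
proof -
  obtain f' where f': "\<And>y. y \<in> Y \<Longrightarrow> (f has_derivative f' y) (at y within Y)"
    "\<And>u. u \<in> W \<Longrightarrow> continuous_on Y (\<lambda>y. f' y u)"
    using C1_on_has_derivative[OF assms(1)] by blast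
  obtain g' where g': "\<And>y. y \<in> Y \<Longrightarrow> (g has_derivative g' y) (at y within Y)"
    "\<And>u. u \<in> W \<Longrightarrow> continuous_on Y (\<lambda>y. g' y u)"
    using C1_on_has_derivative[OF assms(2)] by blast
  show ?thesis
    by (rule C1_on_I[where f' = "\<lambda>y u. f' y u + g' y u"])
      (intro has_derivative_add continuous_on_add f' g'; assumption)+
qed

lemma C1_on_bilinear:
  assumes "bounded_bilinear pr" "C1_on W Y f" "C1_on W Y g"
  shows "C1_on W Y (\<lambda>y. pr (f y) (g y))"
proof -
  obtain f' where f': "\<And>y. y \<in> Y \<Longrightarrow> (f has_derivative f' y) (at y within Y)"
    "\<And>u. u \<in> W \<Longrightarrow> continuous_on Y (\<lambda>y. f' y u)"
    using C1_on_has_derivative[OF assms(2)] by blast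
  obtain g' where g': "\<And>y. y \<in> Y \<Longrightarrow> (g has_derivative g' y) (at y within Y)"
    "\<And>u. u \<in> W \<Longrightarrow> continuous_on Y (\<lambda>y. g' y u)"
    using C1_on_has_derivative[OF assms(3)] by blast
  show ?thesis
  proof (rule C1_on_I)
    show "((\<lambda>y. pr (f y) (g y)) has_derivative (\<lambda>u. pr (f y) (g' y u) + pr (f' y u) (g y)))
        (at y within Y)" if "y \<in> Y" for y
      by (rule bounded_bilinear.FDERIV[OF assms(1) f'(1)[OF that] g'(1)[OF that]])
    show "continuous_on Y (\<lambda>y. pr (f y) (g' y u) + pr (f' y u) (g y))" if "u \<in> W" for u
      by (intro continuous_on_add bounded_bilinear.continuous_on[OF assms(1)]
          C1_on_continuous[OF assms(2)] C1_on_continuous[OF assms(3)] f'(2) g'(2) that)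
  qed
qed

lemmas C1_on_scaleR = C1_on_bilinear[OF bounded_bilinear_scaleR]
lemmas C1_on_mult = C1_on_bilinear[OF bounded_bilinear_mult]
lemmas C1_on_inner = C1_on_bilinear[OF bounded_bilinear_inner]

lemma C1_on_diff:
  fixes f g :: "_ \<Rightarrow> 'b::real_normed_vector"
  assumes "C1_on W Y f" "C1_on W Y g"
  shows "C1_on W Y (\<lambda>y. f y - g y)"
  using C1_on_add[OF assms(1) C1_on_scaleR[OF C1_on_const[of W Y "-1"] assms(2)]] by simp

lemma C1_on_sum: "(\<And>i. i \<in> S \<Longrightarrow> C1_on W Y (f i)) \<Longrightarrow> C1_on W Y (\<lambda>y. \<Sum>i\<in>S. f i y)"
  by (induction S rule: infinite_finite_induct) (auto intro: C1_on_const C1_on_add)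

lemma C1_on_prod:
  fixes f :: "'i \<Rightarrow> _ \<Rightarrow> real"
  shows "(\<And>i. i \<in> S \<Longrightarrow> C1_on W Y (f i)) \<Longrightarrow> C1_on W Y (\<lambda>y. \<Prod>i\<in>S. f i y)"
  by (induction S rule: infinite_finite_induct) (auto intro: C1_on_const C1_on_mult)

lemma C1_on_compose_real:
  fixes g :: "_ \<Rightarrow> real" and \<theta> :: "real \<Rightarrow> real"
  assumes "C1_on W Y g" "\<And>t. (\<theta> has_real_derivative \<theta>' t) (at t)" "continuous_on UNIV \<theta>'"
  shows "C1_on W Y (\<lambda>y. \<theta> (g y))"
proof -
  obtain g' where g': "\<And>y. y \<in> Y \<Longrightarrow> (g has_derivative g' y) (at y within Y)"
    "\<And>u. u \<in> W \<Longrightarrow> continuous_on Y (\<lambda>y. g' y u)"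
    using C1_on_has_derivative[OF assms(1)] by blast
  have "((\<lambda>y. \<theta> (g y)) has_derivative (\<lambda>u. \<theta>' (g y) * g' y u)) (at y within Y)" if "y \<in> Y" for y
    using has_derivative_compose[OF g'(1)[OF that]] assms(2)[of "g y"]
    by (auto simp: has_field_derivative_def)
  moreover have "continuous_on Y (\<lambda>y. \<theta>' (g y) * g' y u)" if "u \<in> W" for u
    using g'(2)[OF that] C1_on_continuous[OF assms(1)]
    by (intro continuous_intros continuous_on_compose2[OF assms(3)]) auto
  ultimately show ?thesis by (rule C1_on_I)
qed

lemma C1_on_norm_power2: "C1_on W Y (\<lambda>y. (norm (y - p))\<^sup>2)"
  unfolding power2_norm_eq_inner
  by (intro C1_on_inner C1_on_diff C1_on_const C1_on_bounded_linear bounded_linear_ident)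

lemma C1_on_cong:
  assumes "C1_on W Y f" "\<And>y. y \<in> Y \<Longrightarrow> f y = g y"
  shows "C1_on W Y g"
proof -
  obtain f' where f': "\<And>y. y \<in> Y \<Longrightarrow> (f has_derivative f' y) (at y within Y)"
    "\<And>u. u \<in> W \<Longrightarrow> continuous_on Y (\<lambda>y. f' y u)"
    using C1_on_has_derivative[OF assms(1)] by blast
  show ?thesis
  proof (rule C1_on_I)
    show "(g has_derivative f' y) (at y within Y)" if "y \<in> Y" for y
      by (rule has_derivative_transform[OF that _ f'(1)[OF that]]) (rule assms(2)[symmetric])
  qed (rule f'(2))
qed

lemma C1_on_subset:
  assumes "C1_on W Y f" "Z \<subseteq> Y"
  shows "C1_on W Z f"
proof -
  obtain f' where f': "\<And>y. y \<in> Y \<Longrightarrow> (f has_derivative f' y) (at y within Y)"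
    "\<And>u. u \<in> W \<Longrightarrow> continuous_on Y (\<lambda>y. f' y u)"
    using C1_on_has_derivative[OF assms(1)] by blast
  show ?thesis
  proof (rule C1_on_I)
    show "(f has_derivative f' y) (at y within Z)" if "y \<in> Z" for y
      using f'(1) that assms(2) by (intro has_derivative_subset[of f "f' y" y Y Z]) auto
    show "continuous_on Z (\<lambda>y. f' y u)" if "u \<in> W" for u
      by (rule continuous_on_subset[OF f'(2)[OF that] assms(2)])
  qed
qed

text \<open>Derivatives within a relatively open set are derivatives within \<open>W\<close>, so the
  two witnesses can be pasted. Continuity is checked on \<open>dir_deriv f u\<close>, which does not
  depend on the set from which a point is taken.\<close>

lemma C1_on_Un:
  assumes "subspace W" "openin (top_of_set W) Y" "openin (top_of_set W) Z"
    and "C1_on W Y f" "C1_on W Z f"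
  shows "C1_on W (Y \<union> Z) f"
proof -
  obtain f1 where f1: "\<And>y. y \<in> Y \<Longrightarrow> (f has_derivative f1 y) (at y within Y)"
    "\<And>y u. y \<in> Y \<Longrightarrow> u \<in> W \<Longrightarrow> f1 y u = dir_deriv f u y"
    using C1_onE[OF assms(4,1,2)] by blast
  obtain f2 where f2: "\<And>y. y \<in> Z \<Longrightarrow> (f has_derivative f2 y) (at y within Z)"
    "\<And>y u. y \<in> Z \<Longrightarrow> u \<in> W \<Longrightarrow> f2 y u = dir_deriv f u y"
    using C1_onE[OF assms(5,1,3)] by blast
  have YZ: "openin (top_of_set W) (Y \<union> Z)" using assms(2,3) by auto
  note at = at_within_openin[OF assms(2)] at_within_openin[OF assms(3)] at_within_openin[OF YZ]
  have "continuous_on (Y \<union> Z) (dir_deriv f u)" if "u \<in> W" for u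
    using C1_on_continuous_dir_deriv[OF assms(4,1,2) that] C1_on_continuous_dir_deriv[OF assms(5,1,3) that]
    by (auto simp: continuous_on_eq_continuous_within at)
  moreover have "continuous_on (Y \<union> Z) (\<lambda>y. (if y \<in> Y then f1 y else f2 y) u) \<longleftrightarrow>
      continuous_on (Y \<union> Z) (dir_deriv f u)" if "u \<in> W" for u
    using f1(2) f2(2) that by (intro continuous_on_cong) auto
  moreover have "(f has_derivative (if y \<in> Y then f1 y else f2 y)) (at y within Y \<union> Z)"
    if "y \<in> Y \<union> Z" for y
    using that f1(1)[of y] f2(1)[of y] by (auto simp: at)
  ultimately show ?thesis
    by (intro C1_on_I[where f' = "\<lambda>y. if y \<in> Y then f1 y else f2 y"]) simp_all
qed

text \<open>\<open>W\<close> is covered by the relatively open sets \<open>Y\<close> and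
  \<open>W - K\<close>, and \<open>f\<close> is 0 on the second.\<close>

lemma C1_on_extend_zero:
  assumes "subspace W" "openin (top_of_set W) Y" "C1_on W Y f"
    and "compact K" "K \<subseteq> Y" "\<And>y. y \<in> W - K \<Longrightarrow> f y = 0"
  shows "C1_on W W f"
proof -
  have "openin (top_of_set W) (W - K)"
    using compact_imp_closed[OF assms(4)] by (auto simp: openin_open Diff_eq)
  moreover have "C1_on W (W - K) f"
    using C1_on_const[of W "W - K" 0] by (rule C1_on_cong) (simp add: assms(6))
  ultimately have "C1_on W (Y \<union> (W - K)) f" by (intro C1_on_Un assms)
  moreover have "Y \<union> (W - K) = W" using assms(2,5) openin_imp_subset by blast
  ultimately show ?thesis by simp
qed

lemma dir_deriv_zero_off_support:
  fixes f :: "'a::euclidean_space \<Rightarrow> 'b::real_normed_vector"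
  assumes "subspace W" "closed K" "y \<in> W - K" "u \<in> W" "\<And>y. y \<in> W - K \<Longrightarrow> f y = 0"
  shows "dir_deriv f u y = 0"
proof -
  have op: "openin (top_of_set W) (W - K)" using assms(2) by (auto simp: openin_open Diff_eq)
  have "(f has_derivative (\<lambda>_. 0)) (at y within W - K)"
    using assms(3,5) by (intro has_derivative_transform[OF _ _ has_derivative_const[of 0]]) auto
  from dir_deriv_eq_has_derivative[OF assms(1) op assms(3,4) this] show ?thesis by simp
qed

lemma dir_deriv_cong_openin:
  assumes "subspace W" "openin (top_of_set W) Y" "y \<in> Y" "u \<in> W" "C1_on W Y f"
    and "\<And>y. y \<in> Y \<Longrightarrow> f y = g y"
  shows "dir_deriv g u y = dir_deriv f u y"
proof -
  obtain f' where f0: "\<And>y. y \<in> Y \<Longrightarrow> (f has_derivative f' y) (at y within Y)"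
    "\<And>y u. y \<in> Y \<Longrightarrow> u \<in> W \<Longrightarrow> f' y u = dir_deriv f u y"
    using C1_onE[OF assms(5,1,2)] by blast
  note f' = f0(1)[OF assms(3)] f0(2)[OF assms(3,4)]
  have "(g has_derivative f' y) (at y within Y)"
    using assms(3,6) by (intro has_derivative_transform[OF _ _ f'(1)]) auto
  from dir_deriv_eq_has_derivative[OF assms(1-4) this] f'(2) show ?thesis by simp
qed

lemma dir_deriv_bilinear:
  assumes "bounded_bilinear pr" "subspace W" "openin (top_of_set W) Y" "y \<in> Y" "u \<in> W"
    and "C1_on W Y f" "C1_on W Y g"
  shows "dir_deriv (\<lambda>y. pr (f y) (g y)) u y =
    pr (f y) (dir_deriv g u y) + pr (dir_deriv f u y) (g y)"
  using bounded_bilinear.has_vector_derivative[OF assms(1)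
      C1_on_has_vector_derivative[OF assms(6,2-5)] C1_on_has_vector_derivative[OF assms(7,2-5)]]
  by (intro dir_deriv_eqI) simp

section \<open>Partitions of unity of class C1\<close>

text \<open>The squared positive part is a simple function of class C1 that vanishes on a half-line;
  the cut-offs are built from it. At 0 the difference quotient is bounded by
  \<open>norm h\<close>.\<close>

lemma has_real_derivative_max_0_power2:
  "((\<lambda>t::real. (max 0 t)\<^sup>2) has_real_derivative 2 * max 0 t) (at t)"
proof -
  consider "t < 0" | "t = 0" | "t > 0" by linarith
  then show ?thesis
  proof cases
    case 1
    then have "((\<lambda>t::real. (max 0 t)\<^sup>2) has_real_derivative 0) (at t)"
      by (intro has_field_derivative_transform_within_open[OF DERIV_const[of 0], of "{..<0}"]) auto
    with 1 show ?thesis by simp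
  next
    case 2
    have "((\<lambda>h. (max 0 h)\<^sup>2 / h) \<longlongrightarrow> 0) (at (0::real))"
    proof (rule Lim_null_comparison)
      show "\<forall>\<^sub>F h in at (0::real). norm ((max 0 h)\<^sup>2 / h) \<le> norm h"
        by (auto simp: power2_eq_square max_def)
    qed (auto intro!: tendsto_eq_intros)
    with 2 show ?thesis by (simp add: DERIV_def)
  next
    case 3
    have "((\<lambda>t. t\<^sup>2) has_real_derivative 2 * t) (at t)" using DERIV_pow[of 2 t UNIV] by simp
    then have "((\<lambda>t::real. (max 0 t)\<^sup>2) has_real_derivative 2 * t) (at t)"
      by (rule has_field_derivative_transform_within_open[where S = "{0<..}"]) (use 3 in auto)
    with 3 show ?thesis by simp
  qed
qed

text \<open>Put \<open>s = (norm (y - p))\<^sup>2 / r\<^sup>2\<close>. The inner square is at least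
  1 for \<open>s \<le> 1\<close> and 0 for \<open>s \<ge> 2\<close>. The outer expression truncates
  it at the value 1 and stays of class C1, which is all that the partitions of unity
  require.\<close>

definition bump :: "'a::real_inner \<Rightarrow> real \<Rightarrow> 'a \<Rightarrow> real" where
  "bump p r y = 1 - (max 0 (1 - (max 0 (2 - (norm (y - p))\<^sup>2 / r\<^sup>2))\<^sup>2))\<^sup>2"

lemma C1_on_bump: "C1_on W Y (bump p r)"
proof -
  have *: "C1_on W Y (\<lambda>y. (max 0 (g y))\<^sup>2)" if "C1_on W Y g" for g :: "'a \<Rightarrow> real"
    by (rule C1_on_compose_real[OF that has_real_derivative_max_0_power2])
      (auto intro!: continuous_intros)
  show ?thesis unfolding bump_def[abs_def] divide_inverse
    by (intro C1_on_diff C1_on_const C1_on_mult C1_on_norm_power2 *)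
qed

lemma bump_eq_1: "norm (y - p) \<le> r \<Longrightarrow> 0 < r \<Longrightarrow> bump p r y = 1"
proof -
  assume "norm (y - p) \<le> r" "0 < r"
  then have "(norm (y - p))\<^sup>2 / r\<^sup>2 \<le> 1" by (simp add: power_mono)
  then have "1 \<le> max 0 (2 - (norm (y - p))\<^sup>2 / r\<^sup>2)" by linarith
  then have "1 \<le> (max 0 (2 - (norm (y - p))\<^sup>2 / r\<^sup>2))\<^sup>2" by (rule one_le_power)
  then show ?thesis by (simp add: bump_def)
qed

lemma bump_eq_0: "2 * r < norm (y - p) \<Longrightarrow> 0 < r \<Longrightarrow> bump p r y = 0"
proof -
  assume "2 * r < norm (y - p)" "0 < r"
  then have "(2 * r)\<^sup>2 \<le> (norm (y - p))\<^sup>2" by (intro power_mono) auto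
  \<comment> \<open>The function vanishes already from the radius \<open>sqrt 2 * r\<close> on; the
    factor 2 avoids the root.\<close>
  moreover have "2 * r\<^sup>2 \<le> (2 * r)\<^sup>2" by (simp add: power_mult_distrib)
  ultimately have "2 * r\<^sup>2 \<le> (norm (y - p))\<^sup>2" by linarith
  then have "2 \<le> (norm (y - p))\<^sup>2 / r\<^sup>2" using \<open>0 < r\<close> by (simp add: field_simps)
  then show ?thesis by (simp add: bump_def)
qed

lemma bump_nonneg: "0 \<le> bump p r y" and bump_le_1: "bump p r y \<le> 1"
  by (auto simp: bump_def intro!: power_le_one)

text \<open>The products \<open>\<rho> i\<close> of a bump with the complements of the earlier bumps
  have partial sums that telescope to 1 minus the product of all complements. This is 1 as soon as
  one bump equals 1, hence on a whole neighbourhood of \<open>K\<close>, and no division is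
  involved.\<close>

lemma C1_partition_of_unity:
  fixes K :: "'a::euclidean_space set"
  assumes "compact K" "\<And>p. p \<in> K \<Longrightarrow> open (U p)" "\<And>p. p \<in> K \<Longrightarrow> p \<in> U p"
  obtains N :: nat and q \<rho> Q where "open Q" "K \<subseteq> Q" "\<And>y. y \<in> Q \<Longrightarrow> (\<Sum>i<N. \<rho> i y) = (1::real)"
    and "\<And>i. i < N \<Longrightarrow> q i \<in> K" "\<And>i W. i < N \<Longrightarrow> C1_on W W (\<rho> i)"
    and "\<And>i y. i < N \<Longrightarrow> 0 \<le> \<rho> i y"
    and "\<And>i. i < N \<Longrightarrow> \<exists>K'. compact K' \<and> K' \<subseteq> U (q i) \<and> (\<forall>y. y \<notin> K' \<longrightarrow> \<rho> i y = 0)"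
proof -
  \<comment> \<open>\<open>bump p r\<close> is supported in the ball of radius \<open>2 * r\<close>,
    so this is the ball that must fit into \<open>U p\<close>.\<close>
  have "\<exists>r>0. cball p (2 * r) \<subseteq> U p" if p: "p \<in> K" for p
  proof -
    obtain e where "e > 0" "cball p e \<subseteq> U p"
      using assms(2,3)[OF p] open_contains_cball by blast
    then show ?thesis by (intro exI[of _ "e / 2"]) auto
  qed
  then obtain r where r: "\<And>p. p \<in> K \<Longrightarrow> 0 < r p" "\<And>p. p \<in> K \<Longrightarrow> cball p (2 * r p) \<subseteq> U p" by metis
  have "K \<subseteq> (\<Union>p\<in>K. ball p (r p))" using r(1) by force
  then obtain T where T: "T \<subseteq> K" "finite T" "K \<subseteq> (\<Union>p\<in>T. ball p (r p))"
    using compactE_image[OF assms(1), of K "\<lambda>p. ball p (r p)"] by auto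
  obtain q N where q: "T = q ` {..<N::nat}"
    using finite_imp_nat_seg_image_inj_on[OF T(2)] by (auto simp: lessThan_def)
  have qK: "q i \<in> K" if "i < N" for i using that T(1) q by auto
  define b where "b = (\<lambda>i. bump (q i) (r (q i)))"
  define \<rho> where "\<rho> = (\<lambda>i y. b i y * (\<Prod>j<i. 1 - b j y))"
  have tele: "(\<Sum>i<n. \<rho> i y) = 1 - (\<Prod>j<n. 1 - b j y)" for n y
    by (induction n) (auto simp: \<rho>_def algebra_simps)
  show ?thesis
  proof
    show "open (\<Union>p\<in>T. ball p (r p))" by auto
    show "K \<subseteq> (\<Union>p\<in>T. ball p (r p))" by fact
    show "(\<Sum>i<N. \<rho> i y) = 1" if y: "y \<in> (\<Union>p\<in>T. ball p (r p))" for y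
    proof -
      obtain i where i: "i < N" "y \<in> ball (q i) (r (q i))" using y unfolding q by auto
      then have "1 - b i y = 0"
        using r(1)[OF qK] by (simp add: b_def bump_eq_1 dist_norm norm_minus_commute)
      then have "(\<Prod>j<N. 1 - b j y) = 0" using i(1) by (intro prod_zero) auto
      then show ?thesis by (simp add: tele)
    qed
    show "q i \<in> K" if "i < N" for i by (rule qK[OF that])
    show "C1_on W W (\<rho> i)" for i W
      unfolding \<rho>_def b_def by (intro C1_on_mult C1_on_prod C1_on_diff C1_on_const C1_on_bump)
    show "0 \<le> \<rho> i y" for i y
      unfolding \<rho>_def b_def by (auto intro!: mult_nonneg_nonneg prod_nonneg simp: bump_nonneg bump_le_1)
    show "\<exists>K'. compact K' \<and> K' \<subseteq> U (q i) \<and> (\<forall>y. y \<notin> K' \<longrightarrow> \<rho> i y = 0)" if "i < N" for i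
      using r[OF qK[OF that]]
      by (intro exI[of _ "cball (q i) (2 * r (q i))"])
        (auto simp: \<rho>_def b_def bump_eq_0 dist_norm norm_minus_commute)
  qed
qed

text \<open>The sum of a partition of unity in which every point of \<open>K\<close> is assigned the
  same open set \<open>U\<close>.\<close>

lemma C1_cutoff:
  fixes K :: "'a::euclidean_space set"
  assumes "compact K" "open U" "K \<subseteq> U"
  obtains \<zeta> :: "'a \<Rightarrow> real" and Q K' where "open Q" "K \<subseteq> Q" "\<And>y. y \<in> Q \<Longrightarrow> \<zeta> y = 1"
    and "\<And>W. C1_on W W \<zeta>" "compact K'" "K' \<subseteq> U" "\<And>y. y \<notin> K' \<Longrightarrow> \<zeta> y = 0"
proof -
  show thesis
  proof (rule C1_partition_of_unity[OF assms(1), of "\<lambda>_. U"])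
    fix N :: nat and q \<rho> Q
    assume P: "open Q" "K \<subseteq> Q" "\<And>y. y \<in> Q \<Longrightarrow> (\<Sum>i<N. \<rho> i y) = (1::real)"
      "\<And>i W. i < N \<Longrightarrow> C1_on W W (\<rho> i)"
      "\<And>i. i < N \<Longrightarrow> \<exists>K'. compact K' \<and> K' \<subseteq> U \<and> (\<forall>y. y \<notin> K' \<longrightarrow> \<rho> i y = 0)"
    obtain K' where K': "\<And>i. i < N \<Longrightarrow> compact (K' i) \<and> K' i \<subseteq> U \<and> (\<forall>y. y \<notin> K' i \<longrightarrow> \<rho> i y = 0)"
      using P(5) by metis
    show thesis
    proof (rule that[of Q "\<lambda>y. \<Sum>i<N. \<rho> i y" "\<Union>i<N. K' i"])
      show "(\<Union>i<N. K' i) \<subseteq> U" using K' by blast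
    qed (use P(1-4) K' in \<open>auto intro!: C1_on_sum\<close>)
  qed (use assms in auto)
qed

section \<open>Integration on a linear subspace\<close>

lemma distr_subspace_measure_translate:
  assumes "w \<in> span (b ` {..<k})"
  shows "distr (subspace_measure k b) borel (\<lambda>y. y + w) = subspace_measure k b"
proof (rule measure_eqI)
  fix A assume "A \<in> sets (distr (subspace_measure k b) borel (\<lambda>y. y + w))"
  then have [measurable]: "A \<in> sets borel" by simp
  have "emeasure (distr (subspace_measure k b) borel (\<lambda>y. y + w)) A
      = (\<integral>\<^sup>+y. indicator A y \<partial>distr (subspace_measure k b) borel (\<lambda>y. y + w))"
    by simp
  also have "\<dots> = (\<integral>\<^sup>+y. indicator A (y + w) \<partial>subspace_measure k b)"
    by (rule nn_integral_distr) auto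
  also have "\<dots> = emeasure (subspace_measure k b) A"
    using nn_integral_subspace_measure_translate[of "indicator A" w b k] assms by simp
  finally show "emeasure (distr (subspace_measure k b) borel (\<lambda>y. y + w)) A
      = emeasure (subspace_measure k b) A" .
qed simp

lemma integral_subspace_measure_translate:
  fixes f :: "'a::euclidean_space \<Rightarrow> 'b::euclidean_space"
  assumes "w \<in> span (b ` {..<k})" "f \<in> borel_measurable borel"
  shows "(\<integral>y. f (y + w) \<partial>subspace_measure k b) = (\<integral>y. f y \<partial>subspace_measure k b)"
proof -
  have "(\<integral>y. f y \<partial>distr (subspace_measure k b) borel (\<lambda>y. y + w)) = (\<integral>y. f (y + w) \<partial>subspace_measure k b)"
    using assms(2) by (intro integral_distr) auto
  then show ?thesis by (simp add: distr_subspace_measure_translate[OF assms(1)])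
qed

lemma integrable_subspace_measure_bounded:
  fixes f :: "'a::euclidean_space \<Rightarrow> 'b::euclidean_space"
  assumes "orthonormal_below k b" "f \<in> borel_measurable borel" "bounded A"
    and "\<And>y. y \<in> span (b ` {..<k}) \<Longrightarrow> norm (f y) \<le> B"
    and "\<And>y. y \<in> span (b ` {..<k}) \<Longrightarrow> y \<notin> A \<Longrightarrow> f y = 0"
  shows "integrable (subspace_measure k b) f"
\<comment> \<open>\<open>A\<close> may fail to be a Borel set; its closure is one and is still
  bounded.\<close>
proof (rule integrableI_bounded_set[where A = "closure A" and B = B])
  show "emeasure (subspace_measure k b) (closure A) < \<infinity>"
    using emeasure_subspace_measure_bounded[OF assms(1)] assms(3) by (simp add: bounded_closure)
  have sub: "A \<subseteq> closure A" by (rule closure_subset)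
  show "AE y in subspace_measure k b. y \<in> closure A \<longrightarrow> norm (f y) \<le> B"
    using AE_subspace_measure[of b k] by eventually_elim (use assms(4) in auto)
  show "AE y in subspace_measure k b. y \<notin> closure A \<longrightarrow> f y = 0"
    using AE_subspace_measure[of b k] by eventually_elim (use assms(5) sub in auto)
qed (use assms(2) in \<open>auto simp: borel_closed\<close>)

lemma borel_measurable_openin_indicator:
  fixes f :: "'a::euclidean_space \<Rightarrow> 'b::euclidean_space"
  assumes "subspace W" "openin (top_of_set W) G" "continuous_on G f"
  shows "(\<lambda>y. indicator G y *\<^sub>R f y) \<in> borel_measurable borel"
    and "G \<in> sets borel"
proof -
  obtain U where "open U" "G = W \<inter> U" using assms(2) by (auto simp: openin_open)
  then show "G \<in> sets borel" using closed_subspace[OF assms(1)] by (auto intro: borel_open borel_closed)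
  then show "(\<lambda>y. indicator G y *\<^sub>R f y) \<in> borel_measurable borel"
    using assms(3) by (rule borel_measurable_continuous_on_indicator)
qed

lemma has_vector_derivative_quotient:
  assumes "(f has_vector_derivative D) (at 0)"
  shows "((\<lambda>r. (1 / r) *\<^sub>R (f r - f 0)) \<longlongrightarrow> D) (at 0)"
proof -
  have "((\<lambda>r. norm (f r - f 0 - r *\<^sub>R D) / norm r) \<longlongrightarrow> 0) (at 0)"
    using assms by (simp add: has_vector_derivative_def has_derivative_iff_norm)
  moreover have "\<forall>\<^sub>F r in at 0. norm (f r - f 0 - r *\<^sub>R D) / norm r = norm ((1 / r) *\<^sub>R (f r - f 0) - D)"
    unfolding eventually_at_filter
  proof (intro always_eventually allI impI)
    fix r :: real assume "r \<noteq> 0"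
    then have "(1 / r) *\<^sub>R (f r - f 0) - D = (1 / r) *\<^sub>R (f r - f 0 - r *\<^sub>R D)"
      by (simp add: scaleR_diff_right)
    then show "norm (f r - f 0 - r *\<^sub>R D) / norm r = norm ((1 / r) *\<^sub>R (f r - f 0) - D)" by simp
  qed
  ultimately have "((\<lambda>r. norm ((1 / r) *\<^sub>R (f r - f 0) - D)) \<longlongrightarrow> 0) (at 0)"
    by (rule Lim_transform_eventually)
  then show ?thesis by (simp add: tendsto_norm_zero_iff Lim_null[of _ D])
qed

lemma compact_continuous_norm_bound:
  fixes f :: "'a::topological_space \<Rightarrow> 'b::real_normed_vector"
  assumes "compact S" "continuous_on S f"
  obtains B where "0 < B" "\<And>y. y \<in> S \<Longrightarrow> norm (f y) \<le> B"
proof -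
  have "bounded (f ` S)" by (intro compact_imp_bounded compact_continuous_image assms)
  then show ?thesis using that by (auto simp: bounded_pos)
qed

lemma C1_on_increment_bound:
  fixes g :: "'a::euclidean_space \<Rightarrow> 'b::euclidean_space"
  assumes "subspace W" "C1_on W W g" "y \<in> W" "u \<in> W" "0 \<le> h"
    and "\<And>s. 0 \<le> s \<Longrightarrow> s \<le> h \<Longrightarrow> norm (dir_deriv g u (y + s *\<^sub>R u)) \<le> C"
  shows "norm (g (y + h *\<^sub>R u) - g y) \<le> C * h"
proof -
  have W: "y + s *\<^sub>R u \<in> W" for s using assms(1,3,4) by (intro subspace_add subspace_mul)
  have "((\<lambda>h. g (y + h *\<^sub>R u)) has_vector_derivative dir_deriv g u (y + s *\<^sub>R u)) (at s within {0..h})" for s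
    using C1_on_has_vector_derivative_at[OF assms(2,1) _ W assms(4)]
    by (rule has_vector_derivative_at_within) simp
  then have "norm (g (y + h *\<^sub>R u) - g (y + 0 *\<^sub>R u)) \<le> C * norm (h - 0)"
    using assms(5,6)
    by (intro differentiable_bound[of "{0..h}" "\<lambda>h. g (y + h *\<^sub>R u)" "\<lambda>s r. r *\<^sub>R dir_deriv g u (y + s *\<^sub>R u)"])
      (auto simp: has_vector_derivative_def onorm_scaleR_left[OF bounded_linear_ident] onorm_id)
  then show ?thesis using assms(5) by simp
qed

text \<open>Otherwise an open set cutting out \<open>G\<close> and the complement of
  \<open>closure G\<close> would disconnect the segment.\<close>

lemma segment_meets_boundary:
  fixes G :: "'a::euclidean_space set"
  assumes "subspace W" "openin (top_of_set W) G" "z \<in> G" "u \<in> W" "z + h *\<^sub>R u \<notin> G" "0 \<le> h"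
  shows "\<exists>s\<in>{0..h}. z + s *\<^sub>R u \<in> closure G - G"
proof (rule ccontr)
  assume *: "\<not> ?thesis"
  obtain U where U: "open U" "G = W \<inter> U" using assms(2) by (auto simp: openin_open)
  define L where "L = (\<lambda>s. z + s *\<^sub>R u) ` {0..h}"
  have "connected L" unfolding L_def
    by (intro connected_continuous_image continuous_intros) auto
  moreover have "open (- closure G)" by (rule open_Compl[OF closed_closure])
  moreover have "U \<inter> - closure G \<inter> L = {}" "L \<subseteq> U \<union> - closure G"
  proof -
    have LW: "L \<subseteq> W" unfolding L_def
      using assms(1,3,4) U(2) by (auto intro!: subspace_add subspace_mul)
    show "U \<inter> - closure G \<inter> L = {}" using LW U(2) closure_subset[of G] by blast
    show "L \<subseteq> U \<union> - closure G" using * U(2) unfolding L_def by blast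
  qed
  ultimately have "U \<inter> L = {} \<or> - closure G \<inter> L = {}" using U(1) by (intro connectedD)
  moreover have "z \<in> L" unfolding L_def using assms(6) by (intro image_eqI[of _ _ 0]) auto
  moreover have "z + h *\<^sub>R u \<in> L" unfolding L_def using assms(6) by (intro image_eqI[of _ _ h]) auto
  moreover have "z + h *\<^sub>R u \<notin> closure G"
    using * assms(5,6) by (metis DiffI atLeastAtMost_iff order_refl)
  ultimately show False using assms(3) U(2) by blast
qed

text \<open>No regularity of the boundary is needed here. With \<open>g0\<close> the extension of \<open>g\<close> by zero, the
  integral over \<open>W\<close> of \<open>(g0 (y + h u) - g0 y) / h\<close> vanishes by translation invariance; its part
  outside \<open>G\<close> is bounded by a multiple of the measure of \<open>{z \<in> G. z - h u \<notin> G}\<close>.\<close>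

lemma integral_dir_deriv_zero_boundary:
  fixes g :: "'a::euclidean_space \<Rightarrow> 'b::euclidean_space"
  assumes on: "orthonormal_below k b" and W: "W = span (b ` {..<k})"
    and G: "openin (top_of_set W) G" "bounded G"
    and g: "C1_on W W g" "\<And>y. y \<in> closure G - G \<Longrightarrow> g y = 0" and u: "u \<in> W"
  shows "(\<integral>y. indicator G y *\<^sub>R dir_deriv g u y \<partial>subspace_measure k b) = 0"
proof -
  let ?M = "subspace_measure k b"
  have sW: "subspace W" by (simp add: W)
  have GW: "G \<subseteq> W" using G(1) openin_imp_subset by blast
  have opW: "openin (top_of_set W) W" by simp
  have shift: "y + s *\<^sub>R v \<in> W" if "y \<in> W" "v \<in> W" for y s v
    using that sW by (intro subspace_add subspace_mul)
  obtain R where R: "\<And>y. y \<in> G \<Longrightarrow> norm y \<le> R" using G(2) by (auto simp: bounded_iff)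
  have cD: "continuous_on W (dir_deriv g v)" if "v \<in> W" for v
    by (rule C1_on_continuous_dir_deriv[OF g(1) sW opW that])
  \<comment> \<open>\<open>S\<close> contains every point reached from \<open>G\<close> by a step of
    length at most 1 along \<open>u\<close> or \<open>- u\<close>, so \<open>C\<close> bounds all
    difference quotients below uniformly.\<close>
  define S where "S = W \<inter> cball 0 (R + norm u)"
  have "compact S" unfolding S_def by (intro closed_Int_compact closed_subspace sW) auto
  moreover have "continuous_on S (dir_deriv g u)" by (rule continuous_on_subset[OF cD[OF u]]) (simp add: S_def)
  ultimately obtain C where C: "C > 0" "\<And>y. y \<in> S \<Longrightarrow> norm (dir_deriv g u y) \<le> C"
    by (rule compact_continuous_norm_bound) blast
  have neg: "dir_deriv g (- u) y = - dir_deriv g u y" if "y \<in> W" for y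
    using dir_deriv_linear[OF g(1) sW opW that, of "{()}" "\<lambda>_. u" "\<lambda>_. -1"] u by simp
  have incr: "norm (g (y + h *\<^sub>R v) - g y) \<le> C * h"
    if "y \<in> G" "0 \<le> h" "h \<le> 1" "v = u \<or> v = - u" for y h v
  proof (rule C1_on_increment_bound[OF sW g(1)])
    show "y \<in> W" using that(1) GW by blast
    show vW: "v \<in> W" using that(4) u sW by (auto simp: subspace_neg)
    fix s assume "0 \<le> s" "s \<le> h"
    then have "norm (s *\<^sub>R v) \<le> 1 * norm u" 
      using that(3,4) mult_right_mono[of s 1 "norm u"] by auto
    then have "norm (y + s *\<^sub>R v) \<le> R + norm u"
      using R[OF that(1)] norm_triangle_ineq[of y "s *\<^sub>R v"] by linarith
    then have "y + s *\<^sub>R v \<in> S" using shift[OF \<open>y \<in> W\<close> vW] by (simp add: S_def)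
    then show "norm (dir_deriv g v (y + s *\<^sub>R v)) \<le> C"
      using C(2) that(4) neg by (auto simp: S_def)
  qed (rule that)
  \<comment> \<open>On its way out of \<open>G\<close> the segment meets a zero of \<open>g\<close>,
    at distance at most \<open>h\<close> in the parameter; the mean value bound does the
    rest.\<close>
  have leave: "norm (g z) \<le> C * h"
    if z: "z \<in> G" "0 \<le> h" "h \<le> 1" "v = u \<or> v = - u" "z + h *\<^sub>R v \<notin> G" for z h v
  proof -
    have "v \<in> W" using z(4) u sW by (auto simp: subspace_neg)
    then obtain s where s: "s \<in> {0..h}" "z + s *\<^sub>R v \<in> closure G - G"
      using segment_meets_boundary[OF sW G(1) z(1) _ z(5,2)] by blast
    have "norm (g (z + s *\<^sub>R v) - g z) \<le> C * s"
      using s(1) z by (intro incr) auto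
    also have "\<dots> \<le> C * h" using s(1) C(1) by simp
    finally show ?thesis using g(2)[OF s(2)] by simp
  qed
  define g0 where "g0 = (\<lambda>y. indicator G y *\<^sub>R g y)"
  have Gb [measurable]: "G \<in> sets borel" and g0m [measurable]: "g0 \<in> borel_measurable borel"
    using borel_measurable_openin_indicator[OF sW G(1), of g]
      continuous_on_subset[OF C1_on_continuous[OF g(1)] GW] by (auto simp: g0_def)
  have Dm [measurable]: "(\<lambda>y. indicator G y *\<^sub>R dir_deriv g u y) \<in> borel_measurable borel"
    by (rule borel_measurable_openin_indicator[OF sW G(1) continuous_on_subset[OF cD[OF u] GW]])
  have "compact (W \<inter> cball 0 R)" by (intro closed_Int_compact closed_subspace sW) auto
  then obtain B where B: "B > 0" "\<And>y. y \<in> W \<inter> cball 0 R \<Longrightarrow> norm (g y) \<le> B"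
    by (rule compact_continuous_norm_bound[OF _ continuous_on_subset[OF C1_on_continuous[OF g(1)] Int_lower1]]) blast
  have g0B: "norm (g0 y) \<le> B" for y
    using B(2)[of y] B(1) GW R[of y] by (auto simp: g0_def indicator_def)
  define h where "h = (\<lambda>n. inverse (real (Suc n)))"
  have h: "0 < h n" "h n \<le> 1" for n by (auto simp: h_def field_simps)
  have hlim: "h \<longlonglongrightarrow> 0" unfolding h_def by (rule LIMSEQ_inverse_real_of_nat)
  \<comment> \<open>\<open>a n\<close> is the difference quotient of \<open>g0\<close> on
    \<open>G\<close>. \<open>c n\<close> is its part outside \<open>G\<close>, where
    \<open>g0 y = 0\<close>, rewritten in the variable
    \<open>z = y + h n *\<^sub>R u\<close>.\<close>
  define a where "a = (\<lambda>n y. indicator G y *\<^sub>R ((1 / h n) *\<^sub>R (g0 (y + h n *\<^sub>R u) - g0 y)))"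
  define c where "c = (\<lambda>n z. (1 - indicator G (z - h n *\<^sub>R u)) *\<^sub>R ((1 / h n) *\<^sub>R g0 z))"
  have int0: "integrable ?M (\<lambda>y. g0 (y + r *\<^sub>R u))" for r
  proof (rule integrable_subspace_measure_bounded[OF on])
    show "bounded ((\<lambda>z. - (r *\<^sub>R u) + z) ` G)" by (rule bounded_translation[OF G(2)])
    show "g0 (y + r *\<^sub>R u) = 0" if "y \<notin> (\<lambda>z. - (r *\<^sub>R u) + z) ` G" for y
    proof -
      have "y + r *\<^sub>R u \<notin> G"
      proof
        assume "y + r *\<^sub>R u \<in> G"
        then show False using that by (auto intro!: image_eqI[of _ _ "y + r *\<^sub>R u"])
      qed
      then show ?thesis by (simp add: g0_def)
    qed
  qed (use g0B in auto)
  have int1: "integrable ?M (\<lambda>y. indicator G y *\<^sub>R g0 (y + r *\<^sub>R u))" for r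
    using integrable_mult_indicator[OF _ int0[of r], of G] by simp
  have g0_0: "integrable ?M g0" using int0[of 0] by simp
  have sum0: "(\<integral>y. a n y \<partial>?M) + (\<integral>z. c n z \<partial>?M) = 0" for n
  proof -
    have "(\<integral>z. c n z \<partial>?M) = (\<integral>y. c n (y + h n *\<^sub>R u) \<partial>?M)"
      using shift[of 0 u "h n"] u sW
      by (intro integral_subspace_measure_translate[symmetric])
        (auto simp: c_def subspace_0 W[symmetric])
    also have "\<dots> = (\<integral>y. (1 / h n) *\<^sub>R (g0 (y + h n *\<^sub>R u) - indicator G y *\<^sub>R g0 (y + h n *\<^sub>R u)) \<partial>?M)"
      by (simp add: c_def scaleR_diff_left scaleR_diff_right diff_divide_distrib)
    also have "\<dots> = (1 / h n) *\<^sub>R ((\<integral>y. g0 (y + h n *\<^sub>R u) \<partial>?M) - (\<integral>y. indicator G y *\<^sub>R g0 (y + h n *\<^sub>R u) \<partial>?M))"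
      using int0 int1 by simp
    also have "(\<integral>y. g0 (y + h n *\<^sub>R u) \<partial>?M) = (\<integral>y. g0 y \<partial>?M)"
      using shift[of 0 u "h n"] u sW
      by (intro integral_subspace_measure_translate) (auto simp: subspace_0 W[symmetric])
    finally have c: "(\<integral>z. c n z \<partial>?M) = (1 / h n) *\<^sub>R ((\<integral>y. g0 y \<partial>?M) - (\<integral>y. indicator G y *\<^sub>R g0 (y + h n *\<^sub>R u) \<partial>?M))" .
    have "a n = (\<lambda>y. (1 / h n) *\<^sub>R (indicator G y *\<^sub>R g0 (y + h n *\<^sub>R u) - g0 y))"
      by (auto simp: a_def g0_def indicator_def fun_eq_iff)
    then have "(\<integral>y. a n y \<partial>?M) = (1 / h n) *\<^sub>R ((\<integral>y. indicator G y *\<^sub>R g0 (y + h n *\<^sub>R u) \<partial>?M) - (\<integral>y. g0 y \<partial>?M))"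
      using int1 g0_0 by simp
    then show ?thesis by (simp add: c scaleR_diff_right)
  qed
  have intG: "integrable ?M (\<lambda>y. C * indicator G y)"
    by (rule integrable_subspace_measure_bounded[OF on _ G(2), of _ C]) (use C(1) in \<open>auto simp: indicator_def\<close>)
  have near: "\<forall>\<^sub>F n in sequentially. y + h n *\<^sub>R v \<in> G" if y: "y \<in> G" "v \<in> W" for y v
  proof -
    obtain U where U: "open U" "G = W \<inter> U" using G(1) by (auto simp: openin_open)
    have "(\<lambda>n. y + h n *\<^sub>R v) \<longlonglongrightarrow> y + 0 *\<^sub>R v" by (intro tendsto_intros hlim)
    then have "\<forall>\<^sub>F n in sequentially. y + h n *\<^sub>R v \<in> U"
      using topological_tendstoD[OF _ U(1)] y(1) U(2) by auto
    then show ?thesis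
      using shift[of y v] y U(2) by (auto elim!: eventually_mono)
  qed
  have lim_a: "(\<lambda>n. \<integral>y. a n y \<partial>?M) \<longlonglongrightarrow> (\<integral>y. indicator G y *\<^sub>R dir_deriv g u y \<partial>?M)"
  proof (rule integral_dominated_convergence[OF _ _ intG])
    show "AE y in ?M. (\<lambda>n. a n y) \<longlonglongrightarrow> indicator G y *\<^sub>R dir_deriv g u y"
    proof (rule AE_I2)
      fix y
      show "(\<lambda>n. a n y) \<longlonglongrightarrow> indicator G y *\<^sub>R dir_deriv g u y"
      proof (cases "y \<in> G")
        case True
        have "((\<lambda>r. g (y + r *\<^sub>R u)) has_vector_derivative dir_deriv g u y) (at 0)"
          using True GW by (intro C1_on_has_vector_derivative[OF g(1) sW opW _ u]) auto
        then have "((\<lambda>r. (1 / r) *\<^sub>R (g (y + r *\<^sub>R u) - g y)) \<longlongrightarrow> dir_deriv g u y) (at 0)"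
          using has_vector_derivative_quotient[of "\<lambda>r. g (y + r *\<^sub>R u)"] by simp
        moreover have "filterlim h (at 0) sequentially"
          using hlim h(1) by (simp add: filterlim_at less_imp_neq[symmetric] eventually_sequentially)
        ultimately have "(\<lambda>n. (1 / h n) *\<^sub>R (g (y + h n *\<^sub>R u) - g y)) \<longlonglongrightarrow> dir_deriv g u y"
          by (rule filterlim_compose)
        moreover have "\<forall>\<^sub>F n in sequentially. (1 / h n) *\<^sub>R (g (y + h n *\<^sub>R u) - g y) = a n y"
          using near[OF True u] by eventually_elim (simp add: a_def g0_def True)
        ultimately show ?thesis using True by (simp add: tendsto_cong)
      qed (simp add: a_def)
    qed
    show "AE y in ?M. norm (a n y) \<le> C * indicator G y" for n
    proof (rule AE_I2)
      fix y
      show "norm (a n y) \<le> C * indicator G y"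
      proof (cases "y \<in> G")
        case True
        have "norm (g0 (y + h n *\<^sub>R u) - g0 y) \<le> C * h n"
          using incr[OF True, of "h n" u] leave[OF True, of "h n" u] h[of n] True
          by (cases "y + h n *\<^sub>R u \<in> G") (auto simp: g0_def)
        then show ?thesis using True h[of n] by (simp add: a_def divide_le_eq)
      qed (simp add: a_def)
    qed
  qed (use a_def in simp_all)
  \<comment> \<open>As \<open>G\<close> is relatively open, \<open>z - h n *\<^sub>R u\<close> lies
    in \<open>G\<close> for large \<open>n\<close>, and then \<open>c n z = 0\<close>. By
    \<open>leave\<close> the functions \<open>c n\<close> are dominated by a multiple of the
    indicator of \<open>G\<close>.\<close>
  have lim_c: "(\<lambda>n. \<integral>y. c n y \<partial>?M) \<longlonglongrightarrow> (\<integral>y. 0 \<partial>?M)"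
  proof (rule integral_dominated_convergence[OF _ _ intG])
    show "AE z in ?M. (\<lambda>n. c n z) \<longlonglongrightarrow> 0"
    proof (rule AE_I2)
      fix z
      show "(\<lambda>n. c n z) \<longlonglongrightarrow> 0"
      proof (cases "z \<in> G")
        case True
        have "\<forall>\<^sub>F n in sequentially. c n z = 0"
          using near[OF True, of "- u"] u sW by (auto simp: c_def subspace_neg elim!: eventually_mono)
        then show ?thesis by (rule tendsto_eventually)
      qed (simp add: c_def g0_def)
    qed
    show "AE z in ?M. norm (c n z) \<le> C * indicator G z" for n
    proof (rule AE_I2)
      fix z
      show "norm (c n z) \<le> C * indicator G z"
        using leave[of z "h n" "- u"] h[of n] C(1)
        by (cases "z \<in> G") (auto simp: c_def g0_def indicator_def divide_le_eq)
    qed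
  qed (use c_def in simp_all)
  have "(\<lambda>n. (\<integral>y. a n y \<partial>?M) + (\<integral>z. c n z \<partial>?M)) \<longlonglongrightarrow>
      (\<integral>y. indicator G y *\<^sub>R dir_deriv g u y \<partial>?M) + (\<integral>y. 0 \<partial>?M)"
    by (intro tendsto_add lim_a lim_c)
  then show ?thesis by (simp add: sum0 LIMSEQ_const_iff)
qed

section \<open>The divergence theorem below a graph\<close>

text \<open>Functions such as \<open>\<gamma>\<close> are continuous only on the hyperplane.
  Composition with the orthogonal projection makes them continuous on the whole space, hence Borel,
  and changes them only on a null set of the subspace measure.\<close>

definition subspace_proj :: "nat \<Rightarrow> (nat \<Rightarrow> 'a::euclidean_space) \<Rightarrow> 'a \<Rightarrow> 'a" where
  "subspace_proj k b y = hyperplane_point k b (\<lambda>i. y \<bullet> b i)"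

lemma subspace_proj_in_span: "subspace_proj k b y \<in> span (b ` {..<k})"
  by (simp add: subspace_proj_def hyperplane_point_in_span)

lemma subspace_proj_eq:
  "orthonormal_below k b \<Longrightarrow> y \<in> span (b ` {..<k}) \<Longrightarrow> subspace_proj k b y = y"
  by (simp add: subspace_proj_def hyperplane_point_inner)

lemma continuous_on_subspace_proj: "continuous_on S (subspace_proj k b)"
  unfolding subspace_proj_def[abs_def] hyperplane_point_def by (intro continuous_intros)

lemma continuous_on_compose_subspace_proj:
  "continuous_on (span (b ` {..<k})) f \<Longrightarrow> continuous_on S (\<lambda>y. f (subspace_proj k b y))"
  using continuous_on_compose2[OF _ continuous_on_subspace_proj] subspace_proj_in_span by blast

lemma borel_measurable_compose_subspace_proj:
  fixes f :: "'a::euclidean_space \<Rightarrow> 'b::euclidean_space"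
  shows "continuous_on (span (b ` {..<k})) f \<Longrightarrow> (\<lambda>y. f (subspace_proj k b y)) \<in> borel_measurable borel"
  by (intro borel_measurable_continuous_onI continuous_on_compose_subspace_proj)

text \<open>Boundary integrals are defined in the parameters \<open>c\<close>, volume integrals by
  the subspace measure; this passes from one to the other.\<close>

lemma integral_hyperplane_point:
  fixes f :: "'a::euclidean_space \<Rightarrow> 'b::euclidean_space"
  assumes "orthonormal_below k b" "continuous_on (span (b ` {..<k})) f"
  shows "(\<integral>c. f (hyperplane_point k b c) \<partial>(\<Pi>\<^sub>M j\<in>{..<k}. lborel)) =
      (\<integral>y. f (subspace_proj k b y) \<partial>subspace_measure k b)"
    and "integrable (\<Pi>\<^sub>M j\<in>{..<k}. lborel) (\<lambda>c. f (hyperplane_point k b c)) \<longleftrightarrow>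
      integrable (subspace_measure k b) (\<lambda>y. f (subspace_proj k b y))"
proof -
  note [measurable] = borel_measurable_compose_subspace_proj[OF assms(2)]
  have *: "subspace_proj k b (hyperplane_point k b c) = hyperplane_point k b c" for c
    by (rule subspace_proj_eq[OF assms(1) hyperplane_point_in_span])
  show "(\<integral>c. f (hyperplane_point k b c) \<partial>(\<Pi>\<^sub>M j\<in>{..<k}. lborel)) =
      (\<integral>y. f (subspace_proj k b y) \<partial>subspace_measure k b)"
    unfolding subspace_measure_def by (subst integral_distr) (auto simp: *)
  show "integrable (\<Pi>\<^sub>M j\<in>{..<k}. lborel) (\<lambda>c. f (hyperplane_point k b c)) \<longleftrightarrow>
      integrable (subspace_measure k b) (\<lambda>y. f (subspace_proj k b y))"
    unfolding subspace_measure_def by (subst integrable_distr_eq) (auto simp: *)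
qed

lemma has_derivative_imp_dir_deriv:
  assumes "C1_on W W g" "subspace W" "y \<in> W"
  obtains D where "(g has_derivative D) (at y within W)" "\<And>u. u \<in> W \<Longrightarrow> D u = dir_deriv g u y"
proof -
  obtain g' where "\<And>y. y \<in> W \<Longrightarrow> (g has_derivative g' y) (at y within W)"
    "\<And>y u. y \<in> W \<Longrightarrow> u \<in> W \<Longrightarrow> g' y u = dir_deriv g u y"
    using C1_onE[OF assms(1,2)] by (metis openin_subtopology_self)
  then show ?thesis using that assms(3) by blast
qed

text \<open>Chain rule for the shear that lifts a hyperplane point to the graph shifted by the
  height \<open>s\<close>. The extra vertical term is what produces the tilt of the normal in the
  divergence theorem.\<close>

lemma C1_on_compose_graph:
  fixes g :: "'a::euclidean_space \<Rightarrow> 'b::euclidean_space" and \<gamma> :: "'a \<Rightarrow> real"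
  assumes W: "subspace W" "subspace X" "X \<subseteq> W" "e \<in> W"
    and g: "C1_on W W g" and \<gamma>: "C1_on X X \<gamma>"
  shows "C1_on X X (\<lambda>y. g (y + (\<gamma> y + s) *\<^sub>R e))" (is ?C)
    and "\<And>y v. y \<in> X \<Longrightarrow> v \<in> X \<Longrightarrow> dir_deriv (\<lambda>y. g (y + (\<gamma> y + s) *\<^sub>R e)) v y =
      dir_deriv g v (y + (\<gamma> y + s) *\<^sub>R e) + dir_deriv \<gamma> v y *\<^sub>R dir_deriv g e (y + (\<gamma> y + s) *\<^sub>R e)"
      (is "\<And>y v. _ \<Longrightarrow> _ \<Longrightarrow> dir_deriv ?\<Phi> v y = ?D y v")
proof -
  let ?Y = "\<lambda>y. y + (\<gamma> y + s) *\<^sub>R e"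
  have YW: "?Y y \<in> W" if "y \<in> X" for y using that W by (intro subspace_add subspace_mul) auto
  have opX: "openin (top_of_set X) X" and opW: "openin (top_of_set W) W" by auto
  have "\<exists>D. (?\<Phi> has_derivative D) (at y within X) \<and> (\<forall>v\<in>X. D v = ?D y v)" if y: "y \<in> X" for y
  proof -
    obtain A where A: "(g has_derivative A) (at (?Y y) within W)" "\<And>u. u \<in> W \<Longrightarrow> A u = dir_deriv g u (?Y y)"
      by (rule has_derivative_imp_dir_deriv[OF g W(1) YW[OF y]]) blast
    obtain B where B: "(\<gamma> has_derivative B) (at y within X)" "\<And>u. u \<in> X \<Longrightarrow> B u = dir_deriv \<gamma> u y"
      by (rule has_derivative_imp_dir_deriv[OF \<gamma> W(2) y]) blast
    have "(?Y has_derivative (\<lambda>v. v + (B v + 0) *\<^sub>R e)) (at y within X)"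
      by (intro has_derivative_add has_derivative_ident has_derivative_scaleR_left has_derivative_const B(1))
    moreover have "(g has_derivative A) (at (?Y y) within ?Y ` X)"
      using YW by (intro has_derivative_subset[OF A(1)]) auto
    ultimately have "(?\<Phi> has_derivative (\<lambda>v. A (v + (B v + 0) *\<^sub>R e))) (at y within X)"
      by (rule has_derivative_in_compose)
    moreover have "A (v + (B v + 0) *\<^sub>R e) = ?D y v" if "v \<in> X" for v
      using has_derivative_linear[OF A(1)] A(2)[of v] A(2)[OF W(4)] B(2)[OF that] that W(3)
      by (auto simp: linear_add linear_cmul)
    ultimately show ?thesis by blast
  qed
  then have "\<exists>D. \<forall>y\<in>X. (?\<Phi> has_derivative D y) (at y within X) \<and> (\<forall>v\<in>X. D y v = ?D y v)"
    by (intro bchoice ballI)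
  then obtain D where D0: "\<forall>y\<in>X. (?\<Phi> has_derivative D y) (at y within X) \<and> (\<forall>v\<in>X. D y v = ?D y v)" ..
  have D: "(?\<Phi> has_derivative D y) (at y within X)" "v \<in> X \<Longrightarrow> D y v = ?D y v" if "y \<in> X" for y v
    using bspec[OF D0 that] by auto
  have cY: "continuous_on X ?Y" by (intro continuous_intros C1_on_continuous[OF \<gamma>])
  have cD: "continuous_on X (\<lambda>y. ?D y v)" if "v \<in> X" for v
    using YW W(3) that
    by (intro continuous_on_add continuous_on_scaleR C1_on_continuous_dir_deriv[OF \<gamma> W(2) opX]
        continuous_on_compose2[OF C1_on_continuous_dir_deriv[OF g W(1) opW] cY] W(4)) auto
  show ?C
  proof (rule C1_on_I[OF D(1)])
    show "continuous_on X (\<lambda>y. D y v)" if "v \<in> X" for v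
      using cD[OF that] D(2)[OF _ that] by (simp cong: continuous_on_cong)
  qed
  show "dir_deriv ?\<Phi> v y = ?D y v" if "y \<in> X" "v \<in> X" for y v
    using dir_deriv_eq_has_derivative[OF W(2) opX that D(1)[OF that(1)]] D(2)[OF that] by simp
qed

lemma integral_dir_deriv_half_line:
  fixes g :: "'a::euclidean_space \<Rightarrow> 'b::euclidean_space"
  assumes W: "subspace W" "y \<in> W" "e \<in> W" "norm e = 1"
    and g: "C1_on W W g" and K: "compact K" "\<And>y. y \<in> W - K \<Longrightarrow> g y = 0"
  shows "(\<integral>t. indicator {..<a} t *\<^sub>R dir_deriv g e (y + t *\<^sub>R e) \<partial>lborel) = g (y + a *\<^sub>R e)"
proof -
  have opW: "openin (top_of_set W) W" by simp
  have line: "y + t *\<^sub>R e \<in> W" for t using W by (intro subspace_add subspace_mul)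
  obtain R where R: "\<And>z. z \<in> K \<Longrightarrow> norm z \<le> R" using compact_imp_bounded[OF K(1)] by (auto simp: bounded_iff)
  \<comment> \<open>\<open>T\<close> exceeds \<open>R + norm y\<close>, so the line below height
    \<open>- T\<close> misses \<open>K\<close>; the summand \<open>\<bar>a\<bar>\<close> ensures
    \<open>- T \<le> a\<close>.\<close>
  define T where "T = \<bar>R\<bar> + norm y + \<bar>a\<bar> + 1"
  have far: "y + t *\<^sub>R e \<notin> K" if "t \<le> - T" for t
  proof
    assume "y + t *\<^sub>R e \<in> K"
    then have "norm (y + t *\<^sub>R e) \<le> R" by (rule R)
    moreover have "norm (t *\<^sub>R e) \<le> norm (y + t *\<^sub>R e) + norm y"
      using norm_triangle_ineq4[of "y + t *\<^sub>R e" y] by simp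
    ultimately show False using that W(4) by (simp add: T_def)
  qed
  have "(\<integral>t. indicator {..<a} t *\<^sub>R dir_deriv g e (y + t *\<^sub>R e) \<partial>lborel)
      = (\<integral>t. indicator {-T..a} t *\<^sub>R dir_deriv g e (y + t *\<^sub>R e) \<partial>lborel)"
  proof (rule integral_cong_AE)
    have cont: "continuous_on UNIV (\<lambda>t. dir_deriv g e (y + t *\<^sub>R e))"
      using line by (intro continuous_on_compose2[OF C1_on_continuous_dir_deriv[OF g W(1) opW W(3)]]
          continuous_intros) auto
    note [measurable] = borel_measurable_continuous_onI[OF cont]
    show "(\<lambda>t. indicator {..<a} t *\<^sub>R dir_deriv g e (y + t *\<^sub>R e)) \<in> borel_measurable lborel"
      "(\<lambda>t. indicator {-T..a} t *\<^sub>R dir_deriv g e (y + t *\<^sub>R e)) \<in> borel_measurable lborel"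
      by auto
    \<comment> \<open>The region below the graph is strict, the interval in the fundamental theorem
      closed; they differ in the null set \<open>{a}\<close>.\<close>
    have "AE t in lborel. t \<noteq> a" by (rule AE_lborel_singleton)
    then show "AE t in lborel. indicator {..<a} t *\<^sub>R dir_deriv g e (y + t *\<^sub>R e) =
        indicator {-T..a} t *\<^sub>R dir_deriv g e (y + t *\<^sub>R e)"
    proof eventually_elim
      case (elim t)
      have "dir_deriv g e (y + t *\<^sub>R e) = 0" if "t \<le> - T"
        using dir_deriv_zero_off_support[OF W(1) compact_imp_closed[OF K(1)] _ W(3) K(2), of "y + t *\<^sub>R e"]
          line[of t] far[OF that] by simp
      then show ?case using elim by (auto simp: indicator_def)
    qed
  qed
  also have "\<dots> = g (y + a *\<^sub>R e) - g (y + (- T) *\<^sub>R e)"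
  proof (rule integral_FTC_atLeastAtMost)
    show "- T \<le> a" using norm_ge_zero[of y] unfolding T_def by linarith
    show "((\<lambda>t. g (y + t *\<^sub>R e)) has_vector_derivative dir_deriv g e (y + t *\<^sub>R e)) (at t within {-T..a})" for t
      using C1_on_has_vector_derivative_at[OF g W(1) opW line W(3)] by (rule has_vector_derivative_at_within)
    show "continuous_on {-T..a} (\<lambda>t. dir_deriv g e (y + t *\<^sub>R e))"
      using line by (intro continuous_on_compose2[OF C1_on_continuous_dir_deriv[OF g W(1) opW W(3)]]
          continuous_intros) auto
  qed
  also have "g (y + (- T) *\<^sub>R e) = 0" using far[of "- T"] line[of "- T"] by (intro K(2)) auto
  finally show ?thesis by simp
qed

lemma integrable_pair_bounded:
  fixes f :: "'a::euclidean_space \<times> real \<Rightarrow> 'b::euclidean_space"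
  assumes on: "orthonormal_below k b" and f: "f \<in> borel_measurable (subspace_measure k b \<Otimes>\<^sub>M lborel)"
    and B: "\<And>y s. y \<in> span (b ` {..<k}) \<Longrightarrow> norm (f (y, s)) \<le> B"
    and z: "\<And>y s. y \<in> span (b ` {..<k}) \<Longrightarrow> \<not> (norm y \<le> R \<and> \<bar>s\<bar> \<le> T) \<Longrightarrow> f (y, s) = 0"
  shows "integrable (subspace_measure k b \<Otimes>\<^sub>M lborel) f"
proof -
  let ?M = "subspace_measure k b"
  interpret M: sigma_finite_measure ?M by (rule sigma_finite_subspace_measure[OF on])
  interpret pair_sigma_finite ?M "lborel :: real measure" ..
  have "{x \<in> space (?M \<Otimes>\<^sub>M (lborel :: real measure)). fst x \<in> span (b ` {..<k})} \<in> sets (?M \<Otimes>\<^sub>M lborel)"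
    using measurable_sets[OF measurable_fst[of ?M "lborel :: real measure"], of "span (b ` {..<k})"]
    by (simp add: borel_closed closed_subspace vimage_def Int_def conj_commute)
  then have AE: "AE x in ?M \<Otimes>\<^sub>M (lborel :: real measure). fst x \<in> span (b ` {..<k})"
    using AE_subspace_measure[of b k] by (intro AE_pair_measure) auto
  show ?thesis
  proof (rule integrableI_bounded_set[where A = "cball 0 R \<times> {-T..T}" and B = B])
    show "cball 0 R \<times> {-T..T} \<in> sets (?M \<Otimes>\<^sub>M lborel)" by (intro pair_measureI) auto
    have "emeasure (?M \<Otimes>\<^sub>M lborel) (cball 0 R \<times> {-T..T}) = emeasure ?M (cball 0 R) * emeasure lborel {-T..T}"
      by (intro M.emeasure_pair_measure_Times lborel.emeasure_pair_measure_Times) auto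
    then show "emeasure (?M \<Otimes>\<^sub>M lborel) (cball 0 R \<times> {-T..T}) < \<infinity>"
      using emeasure_subspace_measure_bounded[OF on bounded_cball]
      by (simp add: ennreal_mult_less_top emeasure_lborel_Icc_eq)
    show "AE x in ?M \<Otimes>\<^sub>M lborel. x \<in> cball 0 R \<times> {-T..T} \<longrightarrow> norm (f x) \<le> B"
      using AE by eventually_elim (use B in \<open>auto split: prod.splits\<close>)
    show "AE x in ?M \<Otimes>\<^sub>M lborel. x \<notin> cball 0 R \<times> {-T..T} \<longrightarrow> f x = 0"
      using AE by eventually_elim (use z in \<open>force split: prod.splits\<close>)
  qed (rule f)
qed

text \<open>The gradient of height minus \<open>\<gamma>\<close>, pointing upwards and left
  unnormalised. Its length is \<open>graph_density\<close>, so it equals the unit normal times the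
  surface density and flux integrals contain no root.\<close>

definition graph_normal :: "nat \<Rightarrow> (nat \<Rightarrow> 'a::euclidean_space) \<Rightarrow> ('a \<Rightarrow> real) \<Rightarrow> 'a \<Rightarrow> 'a" where
  "graph_normal m b \<gamma> y = b m - (\<Sum>i<m. dir_deriv \<gamma> (b i) y *\<^sub>R b i)"

lemma inner_graph_normal:
  assumes "orthonormal_below (Suc m) b" "i \<le> m"
  shows "graph_normal m b \<gamma> y \<bullet> b i = (if i = m then 1 else - dir_deriv \<gamma> (b i) y)"
proof -
  have "(\<Sum>j<m. dir_deriv \<gamma> (b j) y *\<^sub>R b j) \<bullet> b i = (if i < m then dir_deriv \<gamma> (b i) y else 0)"
    using inner_hyperplane_point[OF assms(1), of m i "\<lambda>j. dir_deriv \<gamma> (b j) y"] assms(2)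
    by (simp add: hyperplane_point_def)
  then show ?thesis
    using assms by (auto simp: graph_normal_def inner_diff_left orthonormal_below_def)
qed

lemma inner_axis_hyperplane:
  assumes "orthonormal_below (Suc m) b" "y \<in> span (b ` {..<m})"
  shows "y \<bullet> b m = 0"
proof -
  obtain c where "y = hyperplane_point m b c" using in_span_hyperplane_point assms(2) by blast
  then show ?thesis using inner_hyperplane_point[OF assms(1), of m m c] by simp
qed

lemma minus_axis_in_hyperplane:
  assumes "orthonormal_below (Suc m) b" "y \<in> span (b ` {..<Suc m})"
  shows "y - (y \<bullet> b m) *\<^sub>R b m \<in> span (b ` {..<m})"
proof -
  obtain r where r: "y - r *\<^sub>R b m \<in> span (b ` {..<m})"
    using assms(2) by (auto simp: lessThan_Suc span_breakdown_eq)
  moreover have "b m \<bullet> b m = 1" using assms(1) by (simp add: orthonormal_below_def)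
  ultimately have "y \<bullet> b m = r"
    using inner_axis_hyperplane[OF assms(1) r] by (simp add: inner_diff_left)
  then show ?thesis using r by simp
qed

text \<open>This function is positive exactly below the graph, so its continuity makes that region
  relatively open.\<close>

lemma continuous_on_graph_height:
  assumes "orthonormal_below (Suc m) b" "continuous_on (span (b ` {..<m})) \<gamma>"
  shows "continuous_on (span (b ` {..<Suc m})) (\<lambda>y. \<gamma> (y - (y \<bullet> b m) *\<^sub>R b m) - y \<bullet> b m)"
  by (intro continuous_on_diff continuous_on_compose2[OF assms(2)] continuous_intros)
    (use minus_axis_in_hyperplane[OF assms(1)] in auto)

text \<open>In the direction of the axis \<open>b m\<close> this is the fundamental theorem of calculus on vertical
  lines. For the other axes, shearing the graph to the hyperplane turns the derivative of \<open>g\<close> into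
  a horizontal derivative of the sheared function, whose integral vanishes on each horizontal
  hyperplane, minus a multiple of the vertical derivative.\<close>

lemma integral_dir_deriv_below_graph:
  fixes g :: "'a::euclidean_space \<Rightarrow> 'b::euclidean_space"
  assumes on: "orthonormal_below (Suc m) b" and W: "W = span (b ` {..<Suc m})"
    and X: "X = span (b ` {..<m})" and \<gamma>: "C1_on X X \<gamma>"
    and g: "C1_on W W g" and K: "compact K" "\<And>y. y \<in> W - K \<Longrightarrow> g y = 0" and i: "i \<le> m"
  defines "L \<equiv> {y \<in> W. y \<bullet> b m < \<gamma> (y - (y \<bullet> b m) *\<^sub>R b m)}"
  defines "h \<equiv> (\<lambda>y. (graph_normal m b \<gamma> y \<bullet> b i) *\<^sub>R g (y + \<gamma> y *\<^sub>R b m))"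
  shows "(\<integral>y. indicator L y *\<^sub>R dir_deriv g (b i) y \<partial>subspace_measure (Suc m) b) =
      (\<integral>y. h (subspace_proj m b y) \<partial>subspace_measure m b)" (is ?eq)
    and "integrable (subspace_measure m b) (\<lambda>y. h (subspace_proj m b y))" (is ?int)
proof -
  let ?M = "subspace_measure m b" and ?p = "subspace_proj m b"
  have on': "orthonormal_below m b" using orthonormal_below_mono[OF on] by simp
  have sW: "subspace W" and sX: "subspace X" by (simp_all add: W X)
  have XW: "X \<subseteq> W" unfolding W X by (intro span_mono) auto
  have bW: "b j \<in> W" if "j \<le> m" for j using that by (auto simp: W intro!: span_base)
  have bX: "b j \<in> X" if "j < m" for j using that by (auto simp: X intro!: span_base)
  have opW: "openin (top_of_set W) W" and opX: "openin (top_of_set X) X" by auto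
  have norm_b: "norm (b m) = 1" using on by (simp add: orthonormal_below_def norm_eq_sqrt_inner)
  have pX: "?p y \<in> X" for y by (simp add: X subspace_proj_in_span)
  have p_eq: "?p y = y" if "y \<in> X" for y using that subspace_proj_eq[OF on'] by (simp add: X)
  have perp: "y \<bullet> b m = 0" if "y \<in> X" for y
    using that inner_axis_hyperplane[OF on] unfolding X by blast
  have line: "y + s *\<^sub>R b m \<in> W" if "y \<in> X" for y s
    using that XW sW bW by (intro subspace_add subspace_mul) auto
  interpret M: sigma_finite_measure ?M by (rule sigma_finite_subspace_measure[OF on'])
  interpret pair_sigma_finite ?M "lborel :: real measure" ..
  have AE: "AE y in ?M. y \<in> X" using AE_subspace_measure[of b m] by (simp add: X)

  obtain R where R: "\<And>z. z \<in> K \<Longrightarrow> norm z \<le> R" "0 < R"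
    using compact_imp_bounded[OF K(1)] unfolding bounded_pos by blast
  \<comment> \<open>Pythagoras: a bound for a point bounds its foot in the hyperplane and its
    height.\<close>
  have norms: "norm y \<le> norm (y + s *\<^sub>R b m)" "\<bar>s\<bar> \<le> norm (y + s *\<^sub>R b m)" if y: "y \<in> X" for y s
  proof -
    have "(norm (y + s *\<^sub>R b m))\<^sup>2 = (norm y)\<^sup>2 + s\<^sup>2"
      using perp[OF y] norm_b unfolding power2_norm_eq_inner
      by (simp add: inner_add_left inner_add_right inner_commute power2_eq_square norm_eq_sqrt_inner)
    then have "(norm y)\<^sup>2 \<le> (norm (y + s *\<^sub>R b m))\<^sup>2" "\<bar>s\<bar>\<^sup>2 \<le> (norm (y + s *\<^sub>R b m))\<^sup>2" by auto
    then show "norm y \<le> norm (y + s *\<^sub>R b m)" "\<bar>s\<bar> \<le> norm (y + s *\<^sub>R b m)"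
      by (auto intro: power2_le_imp_le)
  qed
  have c\<gamma>: "continuous_on X \<gamma>" by (rule C1_on_continuous[OF \<gamma>])
  have compX: "compact (X \<inter> cball 0 R)" using sX by (intro closed_Int_compact closed_subspace) auto
  obtain C where "0 < C" "\<And>y. y \<in> X \<inter> cball 0 R \<Longrightarrow> norm (\<gamma> y) \<le> C"
    by (rule compact_continuous_norm_bound[OF compX continuous_on_subset[OF c\<gamma> Int_lower1]]) blast
  then have C: "\<bar>\<gamma> y\<bar> \<le> C" if "y \<in> X \<inter> cball 0 R" for y using that by auto
  have supp0: "norm y \<le> R \<and> \<bar>s\<bar> \<le> R" if "y \<in> X" "y + s *\<^sub>R b m \<in> K" for y s
    using norms[OF that(1), of s] R(1)[OF that(2)] by linarith
  \<comment> \<open>In sheared coordinates the support is still bounded: \<open>\<gamma>\<close> is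
    bounded by \<open>C\<close> over the feet of points of \<open>K\<close>, so the height changes
    by at most \<open>C\<close>.\<close>
  have supp: "norm y \<le> R \<and> \<bar>s\<bar> \<le> R + C" if "y \<in> X" "y + (\<gamma> y + s) *\<^sub>R b m \<in> K" for y s
    using supp0[OF that] C[of y] that(1) by auto
  have D0: "dir_deriv g (b j) y = 0" if "y \<in> W" "y \<notin> K" "j \<le> m" for y j
    by (rule dir_deriv_zero_off_support[OF sW compact_imp_closed[OF K(1)] _ bW[OF that(3)] K(2)])
      (use that in auto)
  have cD: "continuous_on W (dir_deriv g (b j))" if "j \<le> m" for j
    by (rule C1_on_continuous_dir_deriv[OF g sW opW bW[OF that]])
  have "\<exists>B. \<forall>y\<in>W. norm (dir_deriv g (b j) y) \<le> B" if j: "j \<le> m" for j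
  proof -
    have "compact (W \<inter> K)" using sW K(1) by (intro closed_Int_compact closed_subspace)
    then obtain B where B: "0 < B" "\<And>y. y \<in> W \<inter> K \<Longrightarrow> norm (dir_deriv g (b j) y) \<le> B"
      by (rule compact_continuous_norm_bound[OF _ continuous_on_subset[OF cD[OF j] Int_lower1]]) blast
    have "norm (dir_deriv g (b j) y) \<le> B" if "y \<in> W" for y
      using B D0[OF that _ j] that by (cases "y \<in> K") auto
    then show ?thesis by blast
  qed
  then have "\<exists>B. \<forall>j\<in>{..m}. \<forall>y\<in>W. norm (dir_deriv g (b j) y) \<le> B j" by (intro bchoice) auto
  then obtain B where B0: "\<forall>j\<in>{..m}. \<forall>y\<in>W. norm (dir_deriv g (b j) y) \<le> B j" ..
  have B: "norm (dir_deriv g (b j) y) \<le> B j" if "j \<le> m" "y \<in> W" for y j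
    using B0 that by auto

  have cN: "continuous_on X (\<lambda>y. graph_normal m b \<gamma> y \<bullet> b i)"
  proof (cases "i = m")
    case False
    then have "b i \<in> X" using i by (intro bX) auto
    then show ?thesis
      using False by (simp add: inner_graph_normal[OF on i])
        (intro continuous_on_minus C1_on_continuous_dir_deriv[OF \<gamma> sX opX])
  qed (simp add: inner_graph_normal[OF on])
  have "continuous_on X (\<lambda>y. g (y + \<gamma> y *\<^sub>R b m))"
    by (rule continuous_on_compose2[OF C1_on_continuous[OF g]])
      (auto simp: line intro!: continuous_intros c\<gamma>)
  then have ch: "continuous_on X h" unfolding h_def by (rule continuous_on_scaleR[OF cN])
  obtain Bh where Bh: "0 < Bh" "\<And>y. y \<in> X \<inter> cball 0 R \<Longrightarrow> norm (h y) \<le> Bh"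
    by (rule compact_continuous_norm_bound[OF compX continuous_on_subset[OF ch Int_lower1]]) blast
  have h0: "h y = 0" if "y \<in> X" "\<not> norm y \<le> R" for y
    using supp0[OF that(1), of "\<gamma> y"] that K(2)[of "y + \<gamma> y *\<^sub>R b m"] line[OF that(1)] by (auto simp: h_def)
  show ?int
  proof (rule integrable_subspace_measure_bounded[OF on' _ bounded_cball[of 0 R], of _ Bh])
    show "(\<lambda>y. h (?p y)) \<in> borel_measurable borel"
      using borel_measurable_compose_subspace_proj ch unfolding X by blast
    show "norm (h (?p y)) \<le> Bh" if "y \<in> span (b ` {..<m})" for y
      using that Bh h0[of y] p_eq[of y] by (cases "norm y \<le> R") (auto simp: X)
    show "h (?p y) = 0" if "y \<in> span (b ` {..<m})" "y \<notin> cball 0 R" for y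
      using that h0[of y] p_eq[of y] by (auto simp: X)
  qed

  \<comment> \<open>\<open>Q j\<close> is the derivative restricted to the region below the graph,
    in coordinates foot and height. \<open>P j\<close> uses the height above the graph, which turns
    the region into the half-space \<open>s < 0\<close>.\<close>
  define Q where "Q = (\<lambda>j (y, t). indicator {..<\<gamma> (?p y)} t *\<^sub>R dir_deriv g (b j) (?p y + t *\<^sub>R b m))"
  define P where "P = (\<lambda>j (y, s). indicator {..<0::real} s *\<^sub>R dir_deriv g (b j) (?p y + (\<gamma> (?p y) + s) *\<^sub>R b m))"
  have cp: "continuous_on UNIV ?p" by (rule continuous_on_subspace_proj)
  have c\<gamma>p: "continuous_on UNIV (\<lambda>y. \<gamma> (?p y))"
    using continuous_on_compose_subspace_proj c\<gamma> unfolding X by blast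
  have c1: "continuous_on UNIV (\<lambda>z. dir_deriv g (b j) (?p (fst z) + snd z *\<^sub>R b m))" if "j \<le> m" for j
    by (intro continuous_on_compose2[OF cD[OF that], of _ "\<lambda>z. ?p (fst z) + snd z *\<^sub>R b m"] continuous_intros
        continuous_on_compose2[OF cp, of _ fst]) (auto simp: line pX)
  have c2: "continuous_on UNIV (\<lambda>z. dir_deriv g (b j) (?p (fst z) + (\<gamma> (?p (fst z)) + snd z) *\<^sub>R b m))" if "j \<le> m" for j
    by (intro continuous_on_compose2[OF cD[OF that], of _ "\<lambda>z. ?p (fst z) + (\<gamma> (?p (fst z)) + snd z) *\<^sub>R b m"]
        continuous_intros continuous_on_compose2[OF cp, of _ fst] continuous_on_compose2[OF c\<gamma>p, of _ fst])
      (auto simp: line pX)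
  have sets_pair: "sets (?M \<Otimes>\<^sub>M (lborel :: real measure)) = sets (borel :: ('a \<times> real) measure)"
    by (metis borel_prod sets_lborel sets_pair_measure_cong sets_subspace_measure)
  have meas: "f \<in> borel_measurable (?M \<Otimes>\<^sub>M lborel) \<longleftrightarrow> f \<in> borel_measurable borel" for f :: "'a \<times> real \<Rightarrow> 'b"
    using measurable_cong_sets[OF sets_pair refl] by blast
  have "open {z. snd z < \<gamma> (?p (fst z))}"
    by (intro open_Collect_less continuous_intros continuous_on_compose2[OF c\<gamma>p, of _ fst]) auto
  then have m1: "{z :: 'a \<times> real. snd z < \<gamma> (?p (fst z))} \<in> sets borel" by (rule borel_open)
  have "open {z :: 'a \<times> real. snd z < 0}"
    by (intro open_Collect_less continuous_intros)
  then have m2: "{z :: 'a \<times> real. snd z < 0} \<in> sets borel" by (rule borel_open)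
  have intQ: "integrable (?M \<Otimes>\<^sub>M lborel) (Q j)" if j: "j \<le> m" for j
  proof (rule integrable_pair_bounded[OF on', of _ "B j" R R])
    have "Q j = (\<lambda>z. indicator {z. snd z < \<gamma> (?p (fst z))} z *\<^sub>R dir_deriv g (b j) (?p (fst z) + snd z *\<^sub>R b m))"
      by (auto simp: Q_def indicator_def fun_eq_iff)
    then show "Q j \<in> borel_measurable (?M \<Otimes>\<^sub>M lborel)"
      unfolding meas using borel_measurable_continuous_on_indicator[OF m1 continuous_on_subset[OF c1[OF j]]] by simp
    show "norm (Q j (y, s)) \<le> B j" for y s
      using B[OF j, of "?p y + s *\<^sub>R b m"] line[OF pX] norm_ge_zero[of "dir_deriv g (b j) (?p y + s *\<^sub>R b m)"]
      by (auto simp: Q_def indicator_def simp del: norm_ge_zero intro: order_trans)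
    show "Q j (y, s) = 0" if "y \<in> span (b ` {..<m})" "\<not> (norm y \<le> R \<and> \<bar>s\<bar> \<le> R)" for y s
      using supp0[of y s] that D0[OF line _ j, of y s] p_eq[of y] by (auto simp: Q_def X)
  qed
  have intP: "integrable (?M \<Otimes>\<^sub>M lborel) (P j)" if j: "j \<le> m" for j
  proof (rule integrable_pair_bounded[OF on', of _ "B j" R "R + C"])
    have "P j = (\<lambda>z. indicator {z. snd z < 0} z *\<^sub>R dir_deriv g (b j) (?p (fst z) + (\<gamma> (?p (fst z)) + snd z) *\<^sub>R b m))"
      by (auto simp: P_def indicator_def fun_eq_iff)
    then show "P j \<in> borel_measurable (?M \<Otimes>\<^sub>M lborel)"
      unfolding meas using borel_measurable_continuous_on_indicator[OF m2 continuous_on_subset[OF c2[OF j]]] by simp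
    show "norm (P j (y, s)) \<le> B j" for y s
      using B[OF j, of "?p y + (\<gamma> (?p y) + s) *\<^sub>R b m"] line[OF pX]
        norm_ge_zero[of "dir_deriv g (b j) (?p y + (\<gamma> (?p y) + s) *\<^sub>R b m)"]
      by (auto simp: P_def indicator_def simp del: norm_ge_zero intro: order_trans)
    show "P j (y, s) = 0" if "y \<in> span (b ` {..<m})" "\<not> (norm y \<le> R \<and> \<bar>s\<bar> \<le> R + C)" for y s
      using supp[of y s] that D0[OF line _ j, of y "\<gamma> y + s"] p_eq[of y] by (auto simp: P_def X)
  qed

  have opL: "openin (top_of_set W) L"
  proof -
    have "continuous_on W (\<lambda>y. \<gamma> (y - (y \<bullet> b m) *\<^sub>R b m) - y \<bullet> b m)"
      using continuous_on_graph_height[OF on] c\<gamma> unfolding W X by blast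
    from continuous_openin_preimage_gen[OF this open_greaterThan[of 0]]
    show ?thesis unfolding L_def by (simp add: Int_def vimage_def conj_commute)
  qed
  define F where "F = (\<lambda>y. indicator L y *\<^sub>R dir_deriv g (b i) y)"
  have LW: "L \<subseteq> W" by (auto simp: L_def)
  have Fm: "F \<in> borel_measurable borel" unfolding F_def
    by (rule borel_measurable_openin_indicator[OF sW opL continuous_on_subset[OF cD[OF i] LW]])
  have F_eq: "F (y + t *\<^sub>R b m) = Q i (y, t)" if y: "y \<in> X" for y t
  proof -
    have "(y + t *\<^sub>R b m) \<bullet> b m = t" using perp[OF y] norm_b by (simp add: inner_add_left norm_eq_sqrt_inner)
    then have "y + t *\<^sub>R b m \<in> L \<longleftrightarrow> t < \<gamma> y" using line[OF y, of t] by (simp add: L_def)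
    then show ?thesis by (simp add: F_def Q_def p_eq[OF y] indicator_def)
  qed
  have step1: "(\<integral>y. F y \<partial>subspace_measure (Suc m) b) = (\<integral>z. Q i z \<partial>(?M \<Otimes>\<^sub>M lborel))"
  proof -
    have [measurable]: "(\<lambda>(y, s). y + s *\<^sub>R b m) \<in> borel_measurable (?M \<Otimes>\<^sub>M lborel)"
      by measurable
    have "(\<integral>y. F y \<partial>subspace_measure (Suc m) b) = (\<integral>z. F (case z of (y, s) \<Rightarrow> y + s *\<^sub>R b m) \<partial>(?M \<Otimes>\<^sub>M lborel))"
      unfolding subspace_measure_Suc using Fm by (intro integral_distr) auto
    also have "\<dots> = (\<integral>z. Q i z \<partial>(?M \<Otimes>\<^sub>M lborel))"
    proof (rule integral_cong_AE)
      show "AE z in ?M \<Otimes>\<^sub>M lborel. F (case z of (y, s) \<Rightarrow> y + s *\<^sub>R b m) = Q i z"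
      proof -
        have "{x \<in> space (?M \<Otimes>\<^sub>M (lborel :: real measure)). fst x \<in> X} \<in> sets (?M \<Otimes>\<^sub>M lborel)"
          using measurable_sets[OF measurable_fst[of ?M "lborel :: real measure"], of X]
          by (simp add: borel_closed closed_subspace[OF sX] vimage_def Int_def conj_commute)
        then have "AE x in ?M \<Otimes>\<^sub>M (lborel :: real measure). fst x \<in> X"
          using AE by (intro AE_pair_measure) auto
        then show ?thesis by eventually_elim (auto simp: F_eq)
      qed
      show "Q i \<in> borel_measurable (?M \<Otimes>\<^sub>M lborel)" using intQ[OF i] by simp
      show "(\<lambda>z. F (case z of (y, s) \<Rightarrow> y + s *\<^sub>R b m)) \<in> borel_measurable (?M \<Otimes>\<^sub>M lborel)"
        by (rule measurable_compose[OF _ Fm]) measurable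
    qed
    finally show ?thesis .
  qed
  have vertical: "(\<integral>t. Q m (y, t) \<partial>lborel) = g (?p y + \<gamma> (?p y) *\<^sub>R b m)" for y
    using integral_dir_deriv_half_line[OF sW _ bW[OF order_refl] norm_b g K, of "?p y" "\<gamma> (?p y)"] pX XW
    by (auto simp: Q_def)
  \<comment> \<open>The substitution \<open>t = \<gamma> (?p y) + s\<close> on each vertical
    line.\<close>
  have shear: "(\<integral>t. Q j (y, t) \<partial>lborel) = (\<integral>s. P j (y, s) \<partial>lborel)" for y j
    by (subst lborel_integral_real_affine[where c = 1 and t = "\<gamma> (?p y)"])
      (auto simp: Q_def P_def indicator_def intro!: Bochner_Integration.integral_cong)
  show ?eq
  proof (cases "i = m")
    case True
    have "(\<integral>z. Q i z \<partial>(?M \<Otimes>\<^sub>M lborel)) = (\<integral>y. \<integral>t. Q i (y, t) \<partial>lborel \<partial>?M)"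
      by (rule integral_fst'[OF intQ[OF i], symmetric])
    also have "\<dots> = (\<integral>y. h (?p y) \<partial>?M)"
      by (simp add: True vertical h_def inner_graph_normal[OF on])
    finally show ?thesis using step1 by (simp add: F_def)
  next
    case False
    then have im: "i < m" using i by simp
    \<comment> \<open>The vertical term of the chain rule: \<open>P i + P2\<close> is, on each level
      \<open>s < 0\<close>, the derivative of the sheared function along \<open>b i\<close>.\<close>
    define P2 where "P2 = (\<lambda>(y, s). dir_deriv \<gamma> (b i) (?p y) *\<^sub>R P m (y, s))"
    have cD\<gamma>: "continuous_on X (dir_deriv \<gamma> (b i))"
      by (rule C1_on_continuous_dir_deriv[OF \<gamma> sX opX bX[OF im]])
    obtain A where A: "0 < A" "\<And>y. y \<in> X \<inter> cball 0 R \<Longrightarrow> norm (dir_deriv \<gamma> (b i) y) \<le> A"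
      by (rule compact_continuous_norm_bound[OF compX continuous_on_subset[OF cD\<gamma> Int_lower1]]) blast
    have P0: "P j (y, s) = 0" if "y \<in> X" "\<not> (norm y \<le> R \<and> \<bar>s\<bar> \<le> R + C)" "j \<le> m" for y s j
      using supp[of y s] that D0[OF line _ that(3), of y "\<gamma> y + s"] p_eq[of y] by (auto simp: P_def)
    have intP2: "integrable (?M \<Otimes>\<^sub>M lborel) P2"
    proof (rule integrable_pair_bounded[OF on', of _ "A * B m" R "R + C"])
      have "(\<lambda>y. dir_deriv \<gamma> (b i) (?p y)) \<in> borel_measurable borel"
        using borel_measurable_compose_subspace_proj cD\<gamma> unfolding X by blast
      then have [measurable]: "(\<lambda>z. dir_deriv \<gamma> (b i) (?p (fst z))) \<in> borel_measurable (?M \<Otimes>\<^sub>M lborel)"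
        by (rule measurable_compose[rotated]) simp
      have [measurable]: "P m \<in> borel_measurable (?M \<Otimes>\<^sub>M lborel)" using intP[of m] by simp
      have "P2 = (\<lambda>z. dir_deriv \<gamma> (b i) (?p (fst z)) *\<^sub>R P m z)" by (auto simp: P2_def fun_eq_iff)
      then show "P2 \<in> borel_measurable (?M \<Otimes>\<^sub>M lborel)" by simp
      show "norm (P2 (y, s)) \<le> A * B m" if "y \<in> span (b ` {..<m})" for y s
      proof (cases "norm y \<le> R")
        case True
        have "norm (P m (y, s)) \<le> B m"
          using B[OF order_refl, of "?p y + (\<gamma> (?p y) + s) *\<^sub>R b m"] line[OF pX]
            norm_ge_zero[of "dir_deriv g (b m) (?p y + (\<gamma> (?p y) + s) *\<^sub>R b m)"]
          by (auto simp: P_def indicator_def simp del: norm_ge_zero intro: order_trans)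
        then show ?thesis
          using A(2)[of y] True that p_eq[of y] unfolding P2_def
          by (auto simp: X intro!: mult_mono)
      next
        case False
        have "0 \<le> B m" using B[OF order_refl bW[OF order_refl]] norm_ge_zero order_trans by blast
        then show ?thesis using False P0[of y s m] that A(1) by (simp add: P2_def X)
      qed
      show "P2 (y, s) = 0" if "y \<in> span (b ` {..<m})" "\<not> (norm y \<le> R \<and> \<bar>s\<bar> \<le> R + C)" for y s
        using that P0[of y s m] by (auto simp: P2_def X)
    qed
    have horizontal: "(\<integral>y. P i (y, s) + P2 (y, s) \<partial>?M) = 0" for s
    proof -
      define \<Phi> where "\<Phi> = (\<lambda>y. g (y + (\<gamma> y + s) *\<^sub>R b m))"
      have \<Phi>: "C1_on X X \<Phi>"
        "\<And>y v. y \<in> X \<Longrightarrow> v \<in> X \<Longrightarrow> dir_deriv \<Phi> v y = dir_deriv g v (y + (\<gamma> y + s) *\<^sub>R b m)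
            + dir_deriv \<gamma> v y *\<^sub>R dir_deriv g (b m) (y + (\<gamma> y + s) *\<^sub>R b m)"
        unfolding \<Phi>_def
        by (rule C1_on_compose_graph[OF sW sX XW bW[OF order_refl] g \<gamma>]; assumption?)+
      \<comment> \<open>The ball is larger than the support of \<open>\<Phi>\<close>, so
        \<open>\<Phi>\<close> is 0 on its boundary and restricting the integral to it loses
        nothing.\<close>
      define G where "G = X \<inter> ball 0 (R + 1)"
      have opG: "openin (top_of_set X) G" by (auto simp: G_def openin_open)
      have "(\<integral>y. indicator G y *\<^sub>R dir_deriv \<Phi> (b i) y \<partial>?M) = 0"
      proof (rule integral_dir_deriv_zero_boundary[OF on' X opG _ \<Phi>(1) _ bX[OF im]])
        show "bounded G" by (auto simp: G_def intro: bounded_subset[OF bounded_ball])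
        fix y assume y: "y \<in> closure G - G"
        have "closure G \<subseteq> X" by (rule closure_minimal) (auto simp: G_def closed_subspace[OF sX])
        then have "y \<in> X" "\<not> norm y \<le> R" using y by (auto simp: G_def)
        then show "\<Phi> y = 0"
          using supp[of y s] K(2)[of "y + (\<gamma> y + s) *\<^sub>R b m"] line[of y] by (auto simp: \<Phi>_def)
      qed
      moreover have "(\<integral>y. indicator {..<0::real} s *\<^sub>R (indicator G y *\<^sub>R dir_deriv \<Phi> (b i) y) \<partial>?M) =
          (\<integral>y. P i (y, s) + P2 (y, s) \<partial>?M)"
      proof (rule integral_cong_AE)
        show "AE y in ?M. indicator {..<0::real} s *\<^sub>R (indicator G y *\<^sub>R dir_deriv \<Phi> (b i) y) = P i (y, s) + P2 (y, s)"
          using AE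
        proof eventually_elim
          case (elim y)
          have "y + (\<gamma> y + s) *\<^sub>R b m \<notin> K" if "\<not> norm y \<le> R" using supp[OF elim, of s] that by blast
          then have "dir_deriv \<Phi> (b i) y = 0" if "\<not> norm y \<le> R"
            using \<Phi>(2)[OF elim bX[OF im]] D0[OF line[OF elim], of "\<gamma> y + s" i]
              D0[OF line[OF elim], of "\<gamma> y + s" m] i that by auto
          moreover have "y \<in> G" if "norm y \<le> R" using that elim by (simp add: G_def)
          ultimately have "indicator G y *\<^sub>R dir_deriv \<Phi> (b i) y = dir_deriv \<Phi> (b i) y"
            by (cases "norm y \<le> R") auto
          then show ?case
            using \<Phi>(2)[OF elim bX[OF im]] p_eq[OF elim] by (simp add: P_def P2_def scaleR_add_right)
        qed
        have "continuous_on G (dir_deriv \<Phi> (b i))"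
          using continuous_on_subset[OF C1_on_continuous_dir_deriv[OF \<Phi>(1) sX opX bX[OF im]]]
          by (auto simp: G_def)
        from borel_measurable_openin_indicator(1)[OF sX opG this]
        have "(\<lambda>y. indicator G y *\<^sub>R dir_deriv \<Phi> (b i) y) \<in> borel_measurable ?M" by simp
        then show "(\<lambda>y. indicator {..<0::real} s *\<^sub>R (indicator G y *\<^sub>R dir_deriv \<Phi> (b i) y)) \<in> borel_measurable ?M"
          by (rule borel_measurable_scaleR[OF borel_measurable_const])
        have "(\<lambda>z. P i z + P2 z) \<in> borel_measurable (?M \<Otimes>\<^sub>M lborel)"
          using intP[OF i] intP2 by (intro borel_measurable_add) auto
        from measurable_compose[OF measurable_Pair2'[of s lborel ?M] this]
        show "(\<lambda>y. P i (y, s) + P2 (y, s)) \<in> borel_measurable ?M" by simp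
      qed
      ultimately show ?thesis by (simp del: scaleR_scaleR)
    qed
    have "(\<integral>z. Q i z \<partial>(?M \<Otimes>\<^sub>M lborel)) = (\<integral>y. \<integral>t. Q i (y, t) \<partial>lborel \<partial>?M)"
      by (rule integral_fst'[OF intQ[OF i], symmetric])
    also have "\<dots> = (\<integral>z. P i z \<partial>(?M \<Otimes>\<^sub>M lborel))"
      unfolding shear by (rule integral_fst'[OF intP[OF i]])
    also have "\<dots> = (\<integral>z. P i z + P2 z \<partial>(?M \<Otimes>\<^sub>M lborel)) - (\<integral>z. P2 z \<partial>(?M \<Otimes>\<^sub>M lborel))"
      using intP[OF i] intP2 by simp
    also have "(\<integral>z. P i z + P2 z \<partial>(?M \<Otimes>\<^sub>M lborel)) = (\<integral>s. \<integral>y. P i (y, s) + P2 (y, s) \<partial>?M \<partial>lborel)"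
      using integral_snd[of "\<lambda>y s. P i (y, s) + P2 (y, s)"] intP[OF i] intP2
      by (simp add: case_prod_beta')
    also have "\<dots> = 0" by (simp add: horizontal)
    also have "(\<integral>z. P2 z \<partial>(?M \<Otimes>\<^sub>M lborel)) = (\<integral>y. \<integral>s. P2 (y, s) \<partial>lborel \<partial>?M)"
      by (rule integral_fst'[OF intP2, symmetric])
    also have "\<dots> = (\<integral>y. dir_deriv \<gamma> (b i) (?p y) *\<^sub>R g (?p y + \<gamma> (?p y) *\<^sub>R b m) \<partial>?M)"
      by (simp add: P2_def shear[symmetric] vertical)
    \<comment> \<open>The factor \<open>- dir_deriv \<gamma> (b i)\<close> is the component of
      \<open>graph_normal\<close> along \<open>b i\<close>.\<close>
    also have "0 - \<dots> = (\<integral>y. h (?p y) \<partial>?M)"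
      using False i by (simp add: h_def inner_graph_normal[OF on])
    finally show ?thesis using step1 by (simp add: F_def)
  qed
qed

lemma boundary_patchD:
  assumes "boundary_patch m W G b \<gamma> U"
  shows "orthonormal_below (Suc m) b" "W = span (b ` {..<Suc m})"
    "C1_on (span (b ` {..<m})) (span (b ` {..<m})) \<gamma>" "open U"
    "G \<inter> U = {y \<in> W \<inter> U. y \<bullet> b m < \<gamma> (y - (y \<bullet> b m) *\<^sub>R b m)}"
  using assms unfolding boundary_patch_def orthonormal_family_iff lessThan_Suc_atMost by auto

text \<open>Used with \<open>K\<close> a compact set off which \<open>g\<close> vanishes, and for
  bounded \<open>G\<close> with \<open>K = G\<close>.\<close>

lemma integrable_indicator_dir_deriv:
  fixes g :: "'a::euclidean_space \<Rightarrow> 'b::euclidean_space"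
  assumes on: "orthonormal_below k b" and W: "W = span (b ` {..<k})"
    and G: "openin (top_of_set W) G" and g: "C1_on W W g" and u: "u \<in> W"
    and K: "bounded K" "\<And>y. y \<in> G - K \<Longrightarrow> dir_deriv g u y = 0"
  shows "integrable (subspace_measure k b) (\<lambda>y. indicator G y *\<^sub>R dir_deriv g u y)"
proof -
  have sW: "subspace W" by (simp add: W)
  have GW: "G \<subseteq> W" using G openin_imp_subset by blast
  have cD: "continuous_on W (dir_deriv g u)"
    by (rule C1_on_continuous_dir_deriv[OF g sW _ u]) simp
  have "compact (W \<inter> closure K)" using sW K(1) by (intro closed_Int_compact closed_subspace) auto
  then obtain B where B: "0 < B" "\<And>y. y \<in> W \<inter> closure K \<Longrightarrow> norm (dir_deriv g u y) \<le> B"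
    by (rule compact_continuous_norm_bound[OF _ continuous_on_subset[OF cD Int_lower1]]) blast
  show ?thesis
  proof (rule integrable_subspace_measure_bounded[OF on _ K(1), of _ B])
    show "(\<lambda>y. indicator G y *\<^sub>R dir_deriv g u y) \<in> borel_measurable borel"
      by (rule borel_measurable_openin_indicator[OF sW G continuous_on_subset[OF cD GW]])
    show "norm (indicator G y *\<^sub>R dir_deriv g u y) \<le> B" for y
      using B K(2)[of y] GW closure_subset[of K] by (cases "y \<in> G"; cases "y \<in> K") auto
    show "indicator G y *\<^sub>R dir_deriv g u y = 0" if "y \<notin> K" for y
      using that K(2)[of y] by (cases "y \<in> G") auto
  qed
qed

lemma inner_expand_orthonormal:
  assumes "orthonormal_below k b" "u \<in> span (b ` {..<k})"
  shows "(\<Sum>i<k. (u \<bullet> b i) *\<^sub>R b i) = u"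
  using hyperplane_point_inner[OF assms] by (simp add: hyperplane_point_def)

text \<open>Linearity in the direction passes from the axes of the patch to an arbitrary
  \<open>u\<close> in \<open>W\<close>; the fields in question are given in a basis that has nothing
  to do with the patch.\<close>

lemma patch_divergence:
  fixes g :: "'a::euclidean_space \<Rightarrow> 'b::euclidean_space"
  assumes bp: "boundary_patch m W G b \<gamma> U" and G: "openin (top_of_set W) G"
    and g: "C1_on W W g" and K: "compact K" "K \<subseteq> U" "\<And>y. y \<in> W - K \<Longrightarrow> g y = 0" and u: "u \<in> W"
  defines "h \<equiv> (\<lambda>y. (graph_normal m b \<gamma> y \<bullet> u) *\<^sub>R g (y + \<gamma> y *\<^sub>R b m))"
  shows "integrable (\<Pi>\<^sub>M j\<in>{..<m}. lborel) (\<lambda>c. h (hyperplane_point m b c))" (is ?int)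
    and "(\<integral>c. h (hyperplane_point m b c) \<partial>(\<Pi>\<^sub>M j\<in>{..<m}. lborel)) =
      (\<integral>y. indicator G y *\<^sub>R dir_deriv g u y \<partial>subspace_measure (Suc m) b)" (is ?eq)
proof -
  note on = boundary_patchD(1)[OF bp] and W = boundary_patchD(2)[OF bp] and \<gamma> = boundary_patchD(3)[OF bp]
    and GU = boundary_patchD(5)[OF bp]
  let ?X = "span (b ` {..<m})" and ?p = "subspace_proj m b" and ?M = "subspace_measure m b"
  have on': "orthonormal_below m b" using orthonormal_below_mono[OF on] by simp
  have sW: "subspace W" by (simp add: W)
  have opW: "openin (top_of_set W) W" by simp
  have opX: "openin (top_of_set ?X) ?X" by simp
  have bW: "b i \<in> W" if "i \<le> m" for i using that by (auto simp: W intro!: span_base)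
  have XW: "?X \<subseteq> W" unfolding W by (intro span_mono) auto
  have GW: "G \<subseteq> W" using G openin_imp_subset by blast
  have D0: "dir_deriv g v y = 0" if "y \<in> W - K" "v \<in> W" for y v
    using dir_deriv_zero_off_support[OF sW compact_imp_closed[OF K(1)] that K(3)] .
  define L where "L = {y \<in> W. y \<bullet> b m < \<gamma> (y - (y \<bullet> b m) *\<^sub>R b m)}"
  define hi where "hi = (\<lambda>i y. (graph_normal m b \<gamma> y \<bullet> b i) *\<^sub>R g (y + \<gamma> y *\<^sub>R b m))"
  \<comment> \<open>On \<open>K\<close>, which lies in \<open>U\<close>, the sets \<open>G\<close>
    and \<open>L\<close> agree; off \<open>K\<close> the derivative is 0.\<close>
  have LG: "indicator L y *\<^sub>R dir_deriv g v y = indicator G y *\<^sub>R dir_deriv g v y" if "v \<in> W" for y v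
  proof (cases "y \<in> W \<inter> K")
    case True
    then have "y \<in> G \<longleftrightarrow> y \<in> L" using GU K(2) by (auto simp: L_def)
    then show ?thesis by (simp add: indicator_def)
  next
    case False
    then show ?thesis
      using D0[of y v] that GW by (cases "y \<in> W") (auto simp: L_def indicator_def)
  qed
  have hi: "(\<integral>y. hi i (?p y) \<partial>?M) = (\<integral>y. indicator G y *\<^sub>R dir_deriv g (b i) y \<partial>subspace_measure (Suc m) b)"
    "integrable ?M (\<lambda>y. hi i (?p y))" if "i \<le> m" for i
  proof -
    note * = integral_dir_deriv_below_graph[OF on W refl \<gamma> g K(1,3) that]
    show "(\<integral>y. hi i (?p y) \<partial>?M) = (\<integral>y. indicator G y *\<^sub>R dir_deriv g (b i) y \<partial>subspace_measure (Suc m) b)"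
      unfolding hi_def by (rule *(1)[folded L_def, unfolded LG[OF bW[OF that]], symmetric])
    show "integrable ?M (\<lambda>y. hi i (?p y))" unfolding hi_def by (rule *(2))
  qed
  have u_eq: "(\<Sum>i\<le>m. (u \<bullet> b i) *\<^sub>R b i) = u"
    using inner_expand_orthonormal[OF on] u by (simp add: W lessThan_Suc_atMost)
  have h_eq: "h y = (\<Sum>i\<le>m. (u \<bullet> b i) *\<^sub>R hi i y)" for y
  proof -
    have "graph_normal m b \<gamma> y \<bullet> u = (\<Sum>i\<le>m. (u \<bullet> b i) * (graph_normal m b \<gamma> y \<bullet> b i))"
      by (subst u_eq[symmetric]) (simp add: inner_sum_right)
    then show ?thesis by (simp add: h_def hi_def scaleR_sum_left)
  qed
  have cN: "continuous_on ?X (\<lambda>y. graph_normal m b \<gamma> y)"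
    unfolding graph_normal_def
    by (intro continuous_intros C1_on_continuous_dir_deriv[OF \<gamma> subspace_span opX]) (auto intro!: span_base)
  have "y + \<gamma> y *\<^sub>R b m \<in> W" if "y \<in> ?X" for y
    using that XW by (intro subspace_add[OF sW] subspace_mul[OF sW] bW) auto
  then have "continuous_on ?X (\<lambda>y. g (y + \<gamma> y *\<^sub>R b m))"
    by (intro continuous_on_compose2[OF C1_on_continuous[OF g]] continuous_intros C1_on_continuous[OF \<gamma>]) auto
  then have ch: "continuous_on ?X h" unfolding h_def by (intro continuous_intros cN)
  have inth: "integrable ?M (\<lambda>y. h (?p y))"
    unfolding h_eq by (intro Bochner_Integration.integrable_sum integrable_scaleR_right hi) auto
  then show ?int using integral_hyperplane_point(2)[OF on' ch] by simp
  have intD: "integrable (subspace_measure (Suc m) b) (\<lambda>y. indicator G y *\<^sub>R dir_deriv g (b i) y)" if "i \<le> m" for i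
    using GW D0 bW[OF that]
    by (intro integrable_indicator_dir_deriv[OF on W G g bW[OF that] compact_imp_bounded[OF K(1)]]) auto
  have "(\<integral>c. h (hyperplane_point m b c) \<partial>(\<Pi>\<^sub>M j\<in>{..<m}. lborel)) = (\<integral>y. h (?p y) \<partial>?M)"
    by (rule integral_hyperplane_point(1)[OF on' ch])
  also have "\<dots> = (\<Sum>i\<le>m. (u \<bullet> b i) *\<^sub>R (\<integral>y. hi i (?p y) \<partial>?M))"
    unfolding h_eq using hi(2) by (subst Bochner_Integration.integral_sum) auto
  also have "\<dots> = (\<Sum>i\<le>m. (u \<bullet> b i) *\<^sub>R (\<integral>y. indicator G y *\<^sub>R dir_deriv g (b i) y \<partial>subspace_measure (Suc m) b))"
    using hi(1) by simp
  also have "\<dots> = (\<integral>y. (\<Sum>i\<le>m. (u \<bullet> b i) *\<^sub>R (indicator G y *\<^sub>R dir_deriv g (b i) y)) \<partial>subspace_measure (Suc m) b)"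
    using intD by (subst Bochner_Integration.integral_sum) (auto simp del: scaleR_scaleR)
  also have "\<dots> = (\<integral>y. indicator G y *\<^sub>R dir_deriv g u y \<partial>subspace_measure (Suc m) b)"
  proof (intro Bochner_Integration.integral_cong refl)
    fix y
    show "(\<Sum>i\<le>m. (u \<bullet> b i) *\<^sub>R (indicator G y *\<^sub>R dir_deriv g (b i) y)) = indicator G y *\<^sub>R dir_deriv g u y"
    proof (cases "y \<in> G")
      case True
      then have "dir_deriv g (\<Sum>i\<le>m. (u \<bullet> b i) *\<^sub>R b i) y = (\<Sum>i\<le>m. (u \<bullet> b i) *\<^sub>R dir_deriv g (b i) y)"
        using GW bW by (intro dir_deriv_linear[OF g sW opW]) auto
      then show ?thesis using True by (simp add: u_eq)
    qed simp
  qed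
  finally show ?eq .
qed

section \<open>The outward normal of a graph\<close>

lemma norm_graph_normal:
  assumes "orthonormal_below (Suc m) b"
  shows "norm (graph_normal m b \<gamma> (hyperplane_point m b c)) = graph_density m b \<gamma> c"
proof -
  let ?y = "hyperplane_point m b c"
  have "graph_normal m b \<gamma> ?y =
      hyperplane_point (Suc m) b (\<lambda>i. if i = m then 1 else - dir_deriv \<gamma> (b i) ?y)"
    by (simp add: graph_normal_def hyperplane_point_def sum_negf)
  then show ?thesis
    by (simp add: norm_hyperplane_point[OF assms] graph_density_def add.commute)
qed

lemma graph_density_pos: "0 < graph_density m b \<gamma> c"
  unfolding graph_density_def by (intro real_sqrt_gt_zero add_pos_nonneg sum_nonneg) auto

text \<open>\<open>W\<close> is closed, so closures relative to \<open>W\<close> are closures in the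
  whole space.\<close>

lemma frontier_of_openin_subspace:
  fixes W :: "'a::euclidean_space set"
  assumes "subspace W" "openin (top_of_set W) G"
  shows "top_of_set W frontier_of G = closure G - G"
proof -
  have GW: "G \<subseteq> W" using assms(2) openin_imp_subset by blast
  then have "closure G \<subseteq> W" using closed_subspace[OF assms(1)] by (rule closure_minimal)
  moreover have "top_of_set W closure_of G = W \<inter> closure G"
    using GW by (simp add: closure_of_subtopology Int_absorb1)
  ultimately show ?thesis
    using assms(2) by (auto simp: frontier_of_def interior_of_openin)
qed

text \<open>For a second candidate \<open>\<mu>\<close>, the direction \<open>\<mu> - \<nu>\<close>
  would have a negative product with \<open>\<nu>\<close> and a positive one with
  \<open>\<mu>\<close>, so it would both enter \<open>G\<close> and leave its closure.\<close>

lemma outward_normal_eqI: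
  assumes W: "subspace W" and \<nu>: "\<nu> \<in> W" "norm \<nu> = 1"
    and "\<And>u. u \<in> W \<Longrightarrow> u \<bullet> \<nu> < 0 \<Longrightarrow> \<forall>\<^sub>F h in at_right 0. p + h *\<^sub>R u \<in> G"
    and "\<And>u. u \<in> W \<Longrightarrow> u \<bullet> \<nu> > 0 \<Longrightarrow> \<forall>\<^sub>F h in at_right 0. p + h *\<^sub>R u \<notin> closure G"
  shows "outward_normal W G p = \<nu>"
  unfolding outward_normal_def
proof (rule the_equality)
  fix \<mu> assume \<mu>: "\<mu> \<in> W \<and> norm \<mu> = 1 \<and>
     (\<forall>u\<in>W. u \<bullet> \<mu> < 0 \<longrightarrow> (\<forall>\<^sub>F h in at_right 0. p + h *\<^sub>R u \<in> G)) \<and>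
     (\<forall>u\<in>W. u \<bullet> \<mu> > 0 \<longrightarrow> (\<forall>\<^sub>F h in at_right 0. p + h *\<^sub>R u \<notin> closure G))"
  show "\<mu> = \<nu>"
  proof (rule ccontr)
    assume ne: "\<mu> \<noteq> \<nu>"
    define u where "u = \<mu> - \<nu>"
    have uW: "u \<in> W" using W \<mu> \<nu>(1) by (auto simp: u_def intro: subspace_diff)
    have unit: "\<mu> \<bullet> \<mu> = 1" "\<nu> \<bullet> \<nu> = 1" using \<mu> \<nu>(2) by (auto simp: norm_eq_1)
    have "0 < u \<bullet> u" using ne by (simp add: u_def)
    then have lt: "\<mu> \<bullet> \<nu> < 1"
      using unit by (simp add: u_def inner_diff_left inner_diff_right inner_commute)
    have "u \<bullet> \<nu> = \<mu> \<bullet> \<nu> - 1" "u \<bullet> \<mu> = 1 - \<mu> \<bullet> \<nu>"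
      using unit by (simp_all only: u_def inner_diff_left inner_commute[of \<nu> \<mu>])
    then have "u \<bullet> \<nu> < 0" "u \<bullet> \<mu> > 0" using lt by simp_all
    then have "\<forall>\<^sub>F h in at_right 0. p + h *\<^sub>R u \<in> G" "\<forall>\<^sub>F h in at_right 0. p + h *\<^sub>R u \<notin> closure G"
      using assms(4)[OF uW] \<mu> uW by auto
    then have "\<forall>\<^sub>F h in at_right (0::real). False"
      by eventually_elim (use closure_subset in blast)
    then show False by (simp add: trivial_limit_at_right_real)
  qed
qed (use assms in auto)

text \<open>Inside the patch, \<open>G\<close> is the set where \<open>\<phi>\<close>, which is
  \<open>\<gamma>\<close> minus the height, is positive. Along \<open>u\<close> the derivative of
  \<open>\<phi>\<close> at the graph point is \<open>- (u \<bullet> N)\<close>, so the sign of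
  \<open>u \<bullet> N\<close> decides between entering and leaving.\<close>

lemma graph_point_in_patch:
  assumes bp: "boundary_patch m W G b \<gamma> U" and G: "openin (top_of_set W) G"
    and p: "graph_point m b \<gamma> c \<in> U"
  shows "graph_point m b \<gamma> c \<in> closure G - G"
    and "outward_normal W G (graph_point m b \<gamma> c) =
      (1 / graph_density m b \<gamma> c) *\<^sub>R graph_normal m b \<gamma> (hyperplane_point m b c)"
    and "outward_normal W G (graph_point m b \<gamma> c) \<in> W"
proof -
  note on = boundary_patchD(1)[OF bp] and W = boundary_patchD(2)[OF bp] and \<gamma> = boundary_patchD(3)[OF bp]
    and U = boundary_patchD(4)[OF bp] and GU = boundary_patchD(5)[OF bp]
  define X where "X = span (b ` {..<m})"
  define x where "x = hyperplane_point m b c"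
  define N where "N = graph_normal m b \<gamma> x"
  define q where "q = x + \<gamma> x *\<^sub>R b m"
  have q: "graph_point m b \<gamma> c = q" by (simp add: graph_point_def q_def x_def)
  have sW: "subspace W" and sX: "subspace X" by (simp_all add: W X_def)
  have opX: "openin (top_of_set X) X" by simp
  have XW: "X \<subseteq> W" unfolding W X_def by (intro span_mono) auto
  have bW: "b i \<in> W" if "i \<le> m" for i using that by (auto simp: W intro!: span_base)
  have bX: "b i \<in> X" if "i < m" for i using that by (auto simp: X_def intro!: span_base)
  have xX: "x \<in> X" by (simp add: x_def X_def hyperplane_point_in_span)
  have qW: "q \<in> W" unfolding q_def using xX XW by (intro subspace_add[OF sW] subspace_mul[OF sW] bW) auto
  have bb: "b m \<bullet> b m = 1" using on by (simp add: orthonormal_below_def)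
  have perp: "y \<bullet> b m = 0" if "y \<in> X" for y
    using that inner_axis_hyperplane[OF on] unfolding X_def by blast
  have minus: "y - (y \<bullet> b m) *\<^sub>R b m \<in> X" if "y \<in> W" for y
    using that minus_axis_in_hyperplane[OF on] unfolding W X_def by blast
  have qm: "q \<bullet> b m = \<gamma> x" using perp[OF xX] bb by (simp add: q_def inner_add_left)
  define \<phi> where "\<phi> = (\<lambda>y. \<gamma> (y - (y \<bullet> b m) *\<^sub>R b m) - y \<bullet> b m)"
  have c\<phi>: "continuous_on W \<phi>"
    using continuous_on_graph_height[OF on C1_on_continuous[OF \<gamma>]] unfolding W \<phi>_def .
  have GU': "y \<in> G \<longleftrightarrow> 0 < \<phi> y" if "y \<in> W" "y \<in> U" for y
    using GU that by (auto simp: \<phi>_def)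
  have \<phi>q: "\<phi> q = 0" by (simp add: \<phi>_def qm) (simp add: q_def)
  have "openin (top_of_set W) {y \<in> W. \<phi> y < 0}"
    using continuous_openin_preimage_gen[OF c\<phi> open_lessThan[of 0]] by (simp add: Int_def vimage_def)
  then obtain O' where O': "open O'" "{y \<in> W. \<phi> y < 0} = W \<inter> O'" by (auto simp: openin_open)
  \<comment> \<open>By continuity \<open>\<phi>\<close> is negative on the points of
    \<open>W\<close> near \<open>y\<close>, so points of \<open>G\<close> cannot accumulate at
    \<open>y\<close>.\<close>
  have outside: "y \<notin> closure G" if y: "y \<in> W" "y \<in> U" "\<phi> y < 0" for y
  proof
    assume "y \<in> closure G"
    moreover have "open (O' \<inter> U)" "y \<in> O' \<inter> U" using O' U y by auto
    ultimately obtain z where z: "z \<in> G" "z \<in> O'" "z \<in> U"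
      using closure_iff_nhds_not_empty[of y G] by (metis Int_iff disjoint_iff subset_refl)
    have zW: "z \<in> W" using G z(1) openin_imp_subset by blast
    have "\<phi> z < 0" using O'(2) zW z(2) by blast
    then show False using GU'[OF zW z(3)] z(1) by simp
  qed
  have line: "((\<lambda>h. \<phi> (q + h *\<^sub>R u)) has_real_derivative - (u \<bullet> N)) (at 0)" if u: "u \<in> W" for u
  proof -
    \<comment> \<open>Only the horizontal part \<open>v\<close> of \<open>u\<close> moves the
      argument of \<open>\<gamma>\<close>; the vertical part changes the height linearly.\<close>
    define v where "v = u - (u \<bullet> b m) *\<^sub>R b m"
    have vX: "v \<in> X" using minus[OF u] by (simp add: v_def)
    have "\<phi> (q + h *\<^sub>R u) = \<gamma> (x + h *\<^sub>R v) - (\<gamma> x + h * (u \<bullet> b m))" for h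
    proof -
      have "(q + h *\<^sub>R u) \<bullet> b m = \<gamma> x + h * (u \<bullet> b m)" by (simp add: inner_add_left qm)
      moreover have "q + h *\<^sub>R u - (\<gamma> x + h * (u \<bullet> b m)) *\<^sub>R b m = x + h *\<^sub>R v"
        by (simp add: q_def v_def algebra_simps)
      ultimately show ?thesis by (simp add: \<phi>_def)
    qed
    moreover have "((\<lambda>h. \<gamma> (x + h *\<^sub>R v)) has_real_derivative dir_deriv \<gamma> v x) (at 0)"
      using C1_on_has_vector_derivative[OF \<gamma>[folded X_def] sX opX xX vX]
      by (simp add: has_real_derivative_iff_has_vector_derivative)
    then have "((\<lambda>h. \<gamma> (x + h *\<^sub>R v) - (\<gamma> x + h * (u \<bullet> b m))) has_real_derivative dir_deriv \<gamma> v x - u \<bullet> b m) (at 0)"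
      by (auto intro!: derivative_eq_intros)
    moreover have "dir_deriv \<gamma> v x - u \<bullet> b m = - (u \<bullet> N)"
    proof -
      have "(\<Sum>i<m. (v \<bullet> b i) *\<^sub>R b i) = v"
        using vX orthonormal_below_mono[OF on] unfolding X_def by (intro inner_expand_orthonormal) auto
      moreover have "v \<bullet> b i = u \<bullet> b i" if "i < m" for i
        using that on by (simp add: v_def inner_diff_left orthonormal_below_def)
      ultimately have "v = (\<Sum>i<m. (u \<bullet> b i) *\<^sub>R b i)" by simp
      then have "dir_deriv \<gamma> v x = (\<Sum>i<m. (u \<bullet> b i) *\<^sub>R dir_deriv \<gamma> (b i) x)"
        using dir_deriv_linear[OF \<gamma>[folded X_def] sX opX xX, of "{..<m}" b "\<lambda>i. u \<bullet> b i"] bX by simp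
      then show ?thesis
        by (simp add: N_def graph_normal_def inner_diff_right inner_sum_right mult.commute)
    qed
    ultimately show ?thesis by simp
  qed
  have inU: "\<forall>\<^sub>F h in at_right 0. q + h *\<^sub>R u \<in> U" for u
  proof -
    have "((\<lambda>h. q + h *\<^sub>R u) \<longlongrightarrow> q + 0 *\<^sub>R u) (at_right 0)" by (intro tendsto_intros)
    then show ?thesis using topological_tendstoD[OF _ U] p q by simp
  qed
  have inW: "q + h *\<^sub>R u \<in> W" if "u \<in> W" for h u
    using that qW by (intro subspace_add[OF sW] subspace_mul[OF sW])
  have enter: "\<forall>\<^sub>F h in at_right 0. q + h *\<^sub>R u \<in> G" if u: "u \<in> W" "u \<bullet> N < 0" for u
  proof -
    obtain d where d: "d > 0" "\<And>h. 0 < h \<Longrightarrow> h < d \<Longrightarrow> \<phi> (q + (0 + h) *\<^sub>R u) > \<phi> (q + 0 *\<^sub>R u)"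
      using DERIV_pos_inc_right[OF line[OF u(1)]] u(2) by auto
    have "\<forall>\<^sub>F h in at_right 0. h < d" using d(1) by (auto simp: eventually_at_right_field)
    moreover have "\<forall>\<^sub>F h in at_right (0::real). 0 < h" by (rule eventually_at_right_less)
    ultimately show ?thesis using inU[of u]
      by eventually_elim (use d(2) \<phi>q GU'[OF inW[OF u(1)]] in auto)
  qed
  have exit: "\<forall>\<^sub>F h in at_right 0. q + h *\<^sub>R u \<notin> closure G" if u: "u \<in> W" "u \<bullet> N > 0" for u
  proof -
    obtain d where d: "d > 0" "\<And>h. 0 < h \<Longrightarrow> h < d \<Longrightarrow> \<phi> (q + (0 + h) *\<^sub>R u) < \<phi> (q + 0 *\<^sub>R u)"
      using DERIV_neg_dec_right[OF line[OF u(1)]] u(2) by auto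
    have "\<forall>\<^sub>F h in at_right 0. h < d" using d(1) by (auto simp: eventually_at_right_field)
    moreover have "\<forall>\<^sub>F h in at_right (0::real). 0 < h" by (rule eventually_at_right_less)
    ultimately show ?thesis using inU[of u]
      by eventually_elim (use d(2) \<phi>q outside[OF inW[OF u(1)]] in auto)
  qed
  have nN: "norm N = graph_density m b \<gamma> c" unfolding N_def x_def by (rule norm_graph_normal[OF on])
  have NW: "N \<in> W" unfolding N_def graph_normal_def
    by (intro subspace_diff[OF sW] subspace_sum[OF sW] subspace_mul[OF sW] bW) auto
  show "graph_point m b \<gamma> c \<in> closure G - G"
  proof -
    \<comment> \<open>The direction \<open>- N\<close> enters \<open>G\<close>, which exhibits
      \<open>q\<close> as a limit of points of \<open>G\<close>.\<close>
    have "(- N) \<bullet> N < 0" using nN graph_density_pos[of m b \<gamma> c] by auto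
    then have ev: "\<forall>\<^sub>F h in at_right 0. q + h *\<^sub>R (- N) \<in> G"
      using NW by (intro enter subspace_neg[OF sW])
    have "((\<lambda>h. q + h *\<^sub>R (- N)) \<longlongrightarrow> q + 0 *\<^sub>R (- N)) (at_right 0)" by (intro tendsto_intros)
    moreover have "\<forall>\<^sub>F h in at_right 0. q + h *\<^sub>R (- N) \<in> closure G"
      using ev by eventually_elim (use closure_subset in blast)
    ultimately have "q \<in> closure G"
      using Lim_in_closed_set[OF closed_closure _ trivial_limit_at_right_real] by fastforce
    moreover have "q \<notin> G" using GU'[OF qW] p q \<phi>q by simp
    ultimately show ?thesis by (simp add: q)
  qed
  have pos: "0 < graph_density m b \<gamma> c" by (rule graph_density_pos)
  have "outward_normal W G q = (1 / graph_density m b \<gamma> c) *\<^sub>R N"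
  proof (rule outward_normal_eqI[OF sW])
    show "(1 / graph_density m b \<gamma> c) *\<^sub>R N \<in> W" by (rule subspace_mul[OF sW NW])
    show "norm ((1 / graph_density m b \<gamma> c) *\<^sub>R N) = 1" using pos by (simp add: nN)
  qed (use enter exit pos in \<open>auto simp: divide_less_0_iff zero_less_divide_iff\<close>)
  then show normal: "outward_normal W G (graph_point m b \<gamma> c) =
      (1 / graph_density m b \<gamma> c) *\<^sub>R graph_normal m b \<gamma> (hyperplane_point m b c)"
    by (simp add: q N_def x_def)
  show "outward_normal W G (graph_point m b \<gamma> c) \<in> W"
    using subspace_mul[OF sW NW] unfolding normal N_def x_def .
qed

section \<open>The boundary integral as a volume integral\<close>

lemma dir_deriv_sum:
  assumes "subspace W" "openin (top_of_set W) Y" "y \<in> Y" "u \<in> W" "\<And>i. i \<in> S \<Longrightarrow> C1_on W Y (f i)"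
  shows "dir_deriv (\<lambda>y. \<Sum>i\<in>S. f i y) u y = (\<Sum>i\<in>S. dir_deriv (f i) u y)"
  by (rule dir_deriv_eqI, rule has_vector_derivative_sum)
    (rule C1_on_has_vector_derivative[OF assms(5) assms(1-4)])

lemma dir_deriv_diff:
  assumes "subspace W" "openin (top_of_set W) Y" "y \<in> Y" "u \<in> W" "C1_on W Y f" "C1_on W Y g"
  shows "dir_deriv (\<lambda>y. f y - g y) u y = dir_deriv f u y - dir_deriv g u y"
  by (rule dir_deriv_eqI, rule has_vector_derivative_diff)
    (rule C1_on_has_vector_derivative[OF assms(5,1-4)] C1_on_has_vector_derivative[OF assms(6,1-4)])+

text \<open>The surface density cancels the normalisation of the outward normal and leaves
  \<open>graph_normal\<close>, as in \<open>patch_divergence\<close>. The identity for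
  \<open>h\<close> is demanded only where the normal lies in \<open>W\<close>, since it comes from
  expanding the normal in the basis \<open>w\<close>; on patches \<open>graph_point_in_patch\<close>
  supplies this.\<close>

lemma patch_integrand_integral:
  fixes F :: "nat \<Rightarrow> 'a::euclidean_space \<Rightarrow> 'b::euclidean_space"
  assumes on: "orthonormal_below (Suc m) w" and W: "W = span (w ` {..<Suc m})"
    and bp: "boundary_patch m W G b \<gamma> U" and G: "openin (top_of_set W) G" "bounded G"
    and \<rho>: "C1_on W W \<rho>" and K: "compact K" "K \<subseteq> U" "\<And>y. y \<in> W - K \<Longrightarrow> \<rho> y = 0"
    and F: "\<And>s. s \<le> m \<Longrightarrow> C1_on W W (F s)"
    and h: "\<And>p. p \<in> closure G - G \<Longrightarrow> outward_normal W G p \<in> W \<Longrightarrow>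
      h p = (\<Sum>s\<le>m. (outward_normal W G p \<bullet> w s) *\<^sub>R F s p)"
  shows "integrable (\<Pi>\<^sub>M j\<in>{..<m}. lborel) (patch_integrand m b \<gamma> \<rho> h)"
    and "(\<integral>c. patch_integrand m b \<gamma> \<rho> h c \<partial>(\<Pi>\<^sub>M j\<in>{..<m}. lborel)) =
      (\<Sum>s\<le>m. \<integral>y. indicator G y *\<^sub>R dir_deriv (\<lambda>y. \<rho> y *\<^sub>R F s y) (w s) y \<partial>subspace_measure (Suc m) w)"
proof -
  have sW: "subspace W" by (simp add: W)
  have wW: "w s \<in> W" if "s \<le> m" for s using that by (auto simp: W intro!: span_base)
  have bW: "b i \<in> W" if "i \<le> m" for i
    using that unfolding boundary_patchD(2)[OF bp] by (auto intro!: span_base)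
  have M_eq: "subspace_measure (Suc m) b = subspace_measure (Suc m) w"
    using boundary_patchD(2)[OF bp] W by (intro subspace_measure_unique[OF boundary_patchD(1)[OF bp] on]) simp
  have C: "C1_on W W (\<lambda>y. \<rho> y *\<^sub>R F s y)" if "s \<le> m" for s by (rule C1_on_scaleR[OF \<rho> F[OF that]])
  define k where "k = (\<lambda>s y. (graph_normal m b \<gamma> y \<bullet> w s) *\<^sub>R (\<rho> (y + \<gamma> y *\<^sub>R b m) *\<^sub>R F s (y + \<gamma> y *\<^sub>R b m)))"
  have k: "integrable (\<Pi>\<^sub>M j\<in>{..<m}. lborel) (\<lambda>c. k s (hyperplane_point m b c))"
    "(\<integral>c. k s (hyperplane_point m b c) \<partial>(\<Pi>\<^sub>M j\<in>{..<m}. lborel)) =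
      (\<integral>y. indicator G y *\<^sub>R dir_deriv (\<lambda>y. \<rho> y *\<^sub>R F s y) (w s) y \<partial>subspace_measure (Suc m) w)"
    if "s \<le> m" for s
    unfolding k_def M_eq[symmetric]
    by (rule patch_divergence[OF bp G(1) C[OF that] K(1,2) _ wW[OF that]]; simp add: K(3))+
  have eq: "patch_integrand m b \<gamma> \<rho> h = (\<lambda>c. \<Sum>s\<le>m. k s (hyperplane_point m b c))"
  proof
    fix c
    let ?p = "graph_point m b \<gamma> c" and ?x = "hyperplane_point m b c"
    have p: "?x + \<gamma> ?x *\<^sub>R b m = ?p" by (simp add: graph_point_def)
    have "?p \<in> W"
    proof -
      have "?x \<in> W" unfolding hyperplane_point_def
        by (intro subspace_sum[OF sW] subspace_mul[OF sW] bW) auto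
      then show ?thesis unfolding graph_point_def by (intro subspace_add[OF sW] subspace_mul[OF sW] bW) auto
    qed
    show "patch_integrand m b \<gamma> \<rho> h c = (\<Sum>s\<le>m. k s ?x)"
    \<comment> \<open>Outside \<open>U\<close> the graph may leave the boundary and nothing is known
      about \<open>outward_normal\<close>; there \<open>\<rho>\<close> is 0.\<close>
    proof (cases "?p \<in> U")
      case False
      then have "\<rho> ?p = 0" using K(2,3) \<open>?p \<in> W\<close> by blast
      then show ?thesis by (simp add: patch_integrand_def k_def p)
    next
      case True
      have pos: "graph_density m b \<gamma> c \<noteq> 0" using graph_density_pos[of m b \<gamma> c] by simp
      have "graph_density m b \<gamma> c * (outward_normal W G ?p \<bullet> w s) = graph_normal m b \<gamma> ?x \<bullet> w s" for s
        using pos by (simp add: graph_point_in_patch(2)[OF bp G(1) True])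
      then have e: "graph_density m b \<gamma> c * \<rho> ?p * (outward_normal W G ?p \<bullet> w s)
          = (graph_normal m b \<gamma> ?x \<bullet> w s) * \<rho> ?p" for s
        by (metis mult.assoc mult.commute)
      have "patch_integrand m b \<gamma> \<rho> h c =
          (\<Sum>s\<le>m. (graph_density m b \<gamma> c * \<rho> ?p * (outward_normal W G ?p \<bullet> w s)) *\<^sub>R F s ?p)"
        by (simp add: patch_integrand_def h[OF graph_point_in_patch(1,3)[OF bp G(1) True]] scaleR_sum_right)
      then show ?thesis unfolding e by (simp add: k_def p)
    qed
  qed
  show "integrable (\<Pi>\<^sub>M j\<in>{..<m}. lborel) (patch_integrand m b \<gamma> \<rho> h)"
    unfolding eq using k(1) by (intro Bochner_Integration.integrable_sum) auto
  show "(\<integral>c. patch_integrand m b \<gamma> \<rho> h c \<partial>(\<Pi>\<^sub>M j\<in>{..<m}. lborel)) =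
      (\<Sum>s\<le>m. \<integral>y. indicator G y *\<^sub>R dir_deriv (\<lambda>y. \<rho> y *\<^sub>R F s y) (w s) y \<partial>subspace_measure (Suc m) w)"
    unfolding eq using k by (subst Bochner_Integration.integral_sum) auto
qed

text \<open>The boundary integral is a definite description: every admissible value equals the
  volume integral, and an admissible value exists by compactness of the boundary.\<close>

theorem boundary_integral_divergence:
  fixes F :: "nat \<Rightarrow> 'a::euclidean_space \<Rightarrow> 'b::euclidean_space"
  assumes on: "orthonormal_below (Suc m) w" and W: "W = span (w ` {..<Suc m})"
    and G: "openin (top_of_set W) G" "bounded G" "C1_boundary m W G"
    and F: "\<And>s. s \<le> m \<Longrightarrow> C1_on W W (F s)"
    and h: "\<And>p. p \<in> closure G - G \<Longrightarrow> outward_normal W G p \<in> W \<Longrightarrow>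
      h p = (\<Sum>s\<le>m. (outward_normal W G p \<bullet> w s) *\<^sub>R F s p)"
  shows "boundary_integral m W G h =
    (\<integral>y. indicator G y *\<^sub>R (\<Sum>s\<le>m. dir_deriv (F s) (w s) y) \<partial>subspace_measure (Suc m) w)" (is "_ = ?V")
proof -
  let ?M = "subspace_measure (Suc m) w" and ?P = "\<Pi>\<^sub>M j\<in>{..<m}. (lborel :: real measure)"
  have sW: "subspace W" by (simp add: W)
  have opW: "openin (top_of_set W) W" by simp
  have GW: "G \<subseteq> W" using G(1) openin_imp_subset by blast
  have wW: "w s \<in> W" if "s \<le> m" for s using that by (auto simp: W intro!: span_base)
  have fr: "top_of_set W frontier_of G = closure G - G"
    by (rule frontier_of_openin_subspace[OF sW G(1)])
  have int: "integrable (?M) (\<lambda>y. indicator G y *\<^sub>R dir_deriv f (w s) y)"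
    if "C1_on W W f" "s \<le> m" for f :: "'a \<Rightarrow> 'b" and s
    by (rule integrable_indicator_dir_deriv[OF on W G(1) that(1) wW[OF that(2)] G(2)]) auto
  have unique: "I = ?V" if I: "has_boundary_integral m W G h I" for I
  proof -
    from I obtain N :: nat and b \<gamma> U \<rho> where D:
      "\<forall>i<N. boundary_patch m W G (b i) (\<gamma> i) (U i)"
      "\<forall>i<N. C1_on W W (\<rho> i) \<and> (\<forall>y\<in>W. 0 \<le> \<rho> i y) \<and>
               (\<exists>K. compact K \<and> K \<subseteq> U i \<and> (\<forall>y\<in>W - K. \<rho> i y = 0))"
      "\<forall>y \<in> top_of_set W frontier_of G. (\<Sum>i<N. \<rho> i y) = 1"
      "I = (\<Sum>i<N. integral\<^sup>L ?P (patch_integrand m (b i) (\<gamma> i) (\<rho> i) h))"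
      unfolding has_boundary_integral_def by (elim exE conjE) (rule that)
    let ?D = "\<lambda>i s y. indicator G y *\<^sub>R dir_deriv (\<lambda>y. \<rho> i y *\<^sub>R F s y) (w s) y"
    have C: "C1_on W W (\<lambda>y. \<rho> i y *\<^sub>R F s y)" if "i < N" "s \<le> m" for i s
      using D(2) that by (intro C1_on_scaleR F) auto
    have "I = (\<Sum>i<N. \<Sum>s\<le>m. \<integral>y. ?D i s y \<partial>?M)"
      unfolding D(4)
    proof (rule sum.cong[OF refl])
      fix i assume "i \<in> {..<N}"
      then have i: "i < N" by simp
      have "\<exists>K. compact K \<and> K \<subseteq> U i \<and> (\<forall>y\<in>W - K. \<rho> i y = 0)" using D(2) i by simp
      then obtain K where "compact K \<and> K \<subseteq> U i \<and> (\<forall>y\<in>W - K. \<rho> i y = 0)" ..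
      then have K: "compact K" "K \<subseteq> U i" "\<And>y. y \<in> W - K \<Longrightarrow> \<rho> i y = 0" by auto
      show "integral\<^sup>L ?P (patch_integrand m (b i) (\<gamma> i) (\<rho> i) h) =
        (\<Sum>s\<le>m. \<integral>y. ?D i s y \<partial>?M)"
        using D(1,2) i
        by (intro patch_integrand_integral(2)[where U = "U i" and K = K, OF on W _ G(1,2) _ K F h]) auto
    qed
    also have "\<dots> = (\<Sum>s\<le>m. \<Sum>i<N. \<integral>y. ?D i s y \<partial>?M)"
      by (rule sum.swap)
    also have "\<dots> = (\<Sum>s\<le>m. \<integral>y. indicator G y *\<^sub>R dir_deriv (F s) (w s) y \<partial>?M)"
    proof (rule sum.cong[OF refl])
      fix s assume "s \<in> {..m}"
      then have s: "s \<le> m" by simp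
      \<comment> \<open>The functions \<open>\<rho> i\<close> add up to 1 on the boundary, but in
        general not inside \<open>G\<close>.\<close>
      define H where "H = (\<lambda>y. (\<Sum>i<N. \<rho> i y *\<^sub>R F s y) - F s y)"
      have CS: "C1_on W W (\<lambda>y. \<Sum>i<N. \<rho> i y *\<^sub>R F s y)" using C s by (intro C1_on_sum) auto
      have CH: "C1_on W W H" unfolding H_def by (rule C1_on_diff[OF CS F[OF s]])
      have "H y = 0" if "y \<in> closure G - G" for y
        using D(3) that unfolding fr by (simp add: H_def scaleR_sum_left[symmetric])
      then have "0 = (\<integral>y. indicator G y *\<^sub>R dir_deriv H (w s) y \<partial>?M)"
        using integral_dir_deriv_zero_boundary[OF on W G(1,2) CH _ wW[OF s]] by simp
      also have "\<dots> = (\<integral>y. (\<Sum>i<N. ?D i s y)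
          - indicator G y *\<^sub>R dir_deriv (F s) (w s) y \<partial>?M)"
      proof (intro Bochner_Integration.integral_cong refl)
        fix y
        show "indicator G y *\<^sub>R dir_deriv H (w s) y = (\<Sum>i<N. ?D i s y)
          - indicator G y *\<^sub>R dir_deriv (F s) (w s) y"
        proof (cases "y \<in> G")
          case True
          then have y: "y \<in> W" using GW by blast
          show ?thesis
            using True dir_deriv_diff[OF sW opW y wW[OF s] CS F[OF s]]
              dir_deriv_sum[OF sW opW y wW[OF s] C[OF _ s], of "{..<N}"] by (simp add: H_def)
        qed simp
      qed
      also have "\<dots> = (\<Sum>i<N. \<integral>y. ?D i s y \<partial>?M)
          - (\<integral>y. indicator G y *\<^sub>R dir_deriv (F s) (w s) y \<partial>?M)"
      proof -
        have I: "integrable (?M) (\<lambda>y. ?D i s y)"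
          if "i \<in> {..<N}" for i using int[OF C s] that s by simp
        have "(\<integral>y. (\<Sum>i<N. ?D i s y)
          - indicator G y *\<^sub>R dir_deriv (F s) (w s) y \<partial>?M) =
          (\<integral>y. (\<Sum>i<N. ?D i s y) \<partial>?M)
          - (\<integral>y. indicator G y *\<^sub>R dir_deriv (F s) (w s) y \<partial>?M)"
          by (intro Bochner_Integration.integral_diff Bochner_Integration.integrable_sum I int F s)
        also have "(\<integral>y. (\<Sum>i<N. ?D i s y) \<partial>?M)
          = (\<Sum>i<N. \<integral>y. ?D i s y \<partial>?M)"
          by (intro Bochner_Integration.integral_sum I)
        finally show ?thesis .
      qed
      finally show "(\<Sum>i<N. \<integral>y. ?D i s y \<partial>?M)
          = (\<integral>y. indicator G y *\<^sub>R dir_deriv (F s) (w s) y \<partial>?M)" by simp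
    qed
    also have "\<dots> = (\<integral>y. (\<Sum>s\<le>m. indicator G y *\<^sub>R dir_deriv (F s) (w s) y) \<partial>?M)"
      using int F by (intro Bochner_Integration.integral_sum[symmetric]) auto
    finally show "I = ?V" by (simp add: scaleR_sum_right)
  qed
  have ex: "\<exists>I. has_boundary_integral m W G h I"
  proof -
    let ?K = "closure G - G"
    have "closed ?K"
    proof -
      obtain O' where O': "open O'" "G = W \<inter> O'" using G(1) by (auto simp: openin_open)
      have "closure G \<subseteq> W" using GW closed_subspace[OF sW] by (rule closure_minimal)
      then have "?K = closure G - O'" using O'(2) by blast
      then show ?thesis using O'(1) by (simp add: closed_Diff)
    qed
    moreover have "bounded ?K" using bounded_closure[OF G(2)] by (rule bounded_subset) auto
    ultimately have "compact ?K" by (simp add: compact_eq_bounded_closed)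
    \<comment> \<open>Basis, height function and neighbourhood are packed into one triple, so that a
      single choice yields all three for each boundary point.\<close>
    have "\<forall>p\<in>?K. \<exists>b\<gamma>U. p \<in> snd (snd b\<gamma>U) \<and> boundary_patch m W G (fst b\<gamma>U) (fst (snd b\<gamma>U)) (snd (snd b\<gamma>U))"
    proof
      fix p assume "p \<in> ?K"
      then obtain b \<gamma> U where "p \<in> U" "boundary_patch m W G b \<gamma> U"
        using G(3) unfolding C1_boundary_def fr by blast
      then show "\<exists>b\<gamma>U. p \<in> snd (snd b\<gamma>U) \<and> boundary_patch m W G (fst b\<gamma>U) (fst (snd b\<gamma>U)) (snd (snd b\<gamma>U))"
        by (intro exI[of _ "(b, \<gamma>, U)"]) simp
    qed
    from bchoice[OF this] obtain T where T: "\<forall>p\<in>?K. p \<in> snd (snd (T p)) \<and>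
        boundary_patch m W G (fst (T p)) (fst (snd (T p))) (snd (snd (T p)))"
      by (rule exE)
    define b \<gamma> U where "b = (\<lambda>p. fst (T p))" and "\<gamma> = (\<lambda>p. fst (snd (T p)))" and "U = (\<lambda>p. snd (snd (T p)))"
    have bp: "p \<in> U p" "boundary_patch m W G (b p) (\<gamma> p) (U p)" if "p \<in> ?K" for p
      using T that by (auto simp: b_def \<gamma>_def U_def)
    show ?thesis
    proof (rule C1_partition_of_unity[OF \<open>compact ?K\<close>, of U])
      show "open (U p)" "p \<in> U p" if "p \<in> ?K" for p using bp[OF that] boundary_patchD(4) by auto
      fix N :: nat and q \<rho> Q
      assume P: "?K \<subseteq> Q" "\<And>y. y \<in> Q \<Longrightarrow> (\<Sum>i<N. \<rho> i y) = (1::real)"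
        "\<And>i. i < N \<Longrightarrow> q i \<in> ?K" "\<And>i W. i < N \<Longrightarrow> C1_on W W (\<rho> i)" "\<And>i y. i < N \<Longrightarrow> 0 \<le> \<rho> i y"
        "\<And>i. i < N \<Longrightarrow> \<exists>K'. compact K' \<and> K' \<subseteq> U (q i) \<and> (\<forall>y. y \<notin> K' \<longrightarrow> \<rho> i y = 0)"
      have *: "integrable ?P (patch_integrand m (b (q i)) (\<gamma> (q i)) (\<rho> i) h)" if i: "i < N" for i
      proof -
        obtain K' where K': "compact K'" "K' \<subseteq> U (q i)" "\<And>y. y \<notin> K' \<Longrightarrow> \<rho> i y = 0"
          using P(6)[OF i] by blast
        show ?thesis
          by (rule patch_integrand_integral(1)[OF on W bp(2)[OF P(3)[OF i]] G(1,2) P(4)[OF i] K'(1,2) _ F h])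
            (use K'(3) in auto)
      qed
      show ?thesis unfolding has_boundary_integral_def fr
      proof (rule exI, rule exI[of _ N], rule exI[of _ "\<lambda>i. b (q i)"], rule exI[of _ "\<lambda>i. \<gamma> (q i)"],
          rule exI[of _ "\<lambda>i. U (q i)"], rule exI[of _ \<rho>], intro conjI allI impI ballI)
        fix i assume i: "i < N"
        show "boundary_patch m W G (b (q i)) (\<gamma> (q i)) (U (q i))" by (rule bp(2)[OF P(3)[OF i]])
        show "C1_on W W (\<rho> i)" by (rule P(4)[OF i])
        show "0 \<le> \<rho> i y" for y by (rule P(5)[OF i])
        show "\<exists>K. compact K \<and> K \<subseteq> U (q i) \<and> (\<forall>y\<in>W - K. \<rho> i y = 0)" using P(6)[OF i] by blast
        show "integrable ?P (patch_integrand m (b (q i)) (\<gamma> (q i)) (\<rho> i) h)"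
          by (rule *[OF i])
      next
        show "(\<Sum>i<N. \<rho> i y) = 1" if "y \<in> ?K" for y using P(1,2) that by blast
      qed (rule refl)
    qed
  qed
  show ?thesis unfolding boundary_integral_def
    using ex unique by (auto intro!: the_equality)
qed

section \<open>The Cauchy formula on a linear subspace\<close>

text \<open>At the joint \<open>a\<close> the two one-sided difference quotients have the common
  limit \<open>f' a\<close>.\<close>

lemma has_real_derivative_If_ge:
  fixes f g :: "real \<Rightarrow> real"
  assumes f: "\<And>s. a \<le> s \<Longrightarrow> (f has_real_derivative f' s) (at s)"
    and g: "\<And>s. s \<le> a \<Longrightarrow> (g has_real_derivative g' s) (at s)"
    and eq: "f a = g a" "f' a = g' a"
  shows "((\<lambda>s. if a \<le> s then f s else g s) has_real_derivative (if a \<le> s then f' s else g' s)) (at s)"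
proof -
  let ?q = "\<lambda>s. if a \<le> s then f s else g s"
  consider "s < a" | "s = a" | "a < s" by linarith
  then show ?thesis
  proof cases
    case 1
    then have "(?q has_real_derivative g' s) (at s)"
      by (intro has_field_derivative_transform_within_open[OF g, of s "{..<a}"]) auto
    with 1 show ?thesis by simp
  next
    case 2
    have "((\<lambda>y. (?q y - ?q a) / (y - a)) \<longlongrightarrow> f' a) (at_right a)"
    proof (rule Lim_transform_eventually)
      show "((\<lambda>y. (f y - f a) / (y - a)) \<longlongrightarrow> f' a) (at_right a)"
        using f[of a] unfolding has_field_derivative_iff
        by (rule tendsto_mono[rotated]) (auto intro: at_le)
      show "\<forall>\<^sub>F y in at_right a. (f y - f a) / (y - a) = (?q y - ?q a) / (y - a)"
        unfolding eventually_at_filter by (intro always_eventually) auto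
    qed
    moreover have "((\<lambda>y. (?q y - ?q a) / (y - a)) \<longlongrightarrow> f' a) (at_left a)"
    proof (rule Lim_transform_eventually)
      show "((\<lambda>y. (g y - g a) / (y - a)) \<longlongrightarrow> f' a) (at_left a)"
        using g[of a] unfolding has_field_derivative_iff eq
        by (rule tendsto_mono[rotated]) (auto intro: at_le)
      show "\<forall>\<^sub>F y in at_left a. (g y - g a) / (y - a) = (?q y - ?q a) / (y - a)"
        unfolding eventually_at_filter by (intro always_eventually) (auto simp: eq)
    qed
    ultimately have "(?q has_real_derivative f' a) (at a)"
      unfolding has_field_derivative_iff by (intro filterlim_split_at)
    with 2 show ?thesis by simp
  next
    case 3
    then have "(?q has_real_derivative f' s) (at s)"
      by (intro has_field_derivative_transform_within_open[OF f, of s "{a<..}"]) auto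
    with 3 show ?thesis by simp
  qed
qed

text \<open>The radial factor \<open>s powr - (k / 2)\<close> of the Cauchy kernel, as a function of the squared
  distance \<open>s\<close>, continued to \<open>s < \<epsilon>\<^sup>2\<close> by its tangent: the singularity is removed without
  changing the kernel outside a ball.\<close>

definition kernel_profile :: "nat \<Rightarrow> real \<Rightarrow> real \<Rightarrow> real" where
  "kernel_profile k \<epsilon> s = (if \<epsilon>\<^sup>2 \<le> s then s powr - (k / 2)
     else (1 / \<epsilon> ^ k) * (1 + k / 2 - k / 2 * (s / \<epsilon>\<^sup>2)))"

definition kernel_profile_deriv :: "nat \<Rightarrow> real \<Rightarrow> real \<Rightarrow> real" where
  "kernel_profile_deriv k \<epsilon> s = (if \<epsilon>\<^sup>2 \<le> s then - (k / 2) * s powr (- (k / 2) - 1)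
     else - ((1 / \<epsilon> ^ k) * (k / 2) / \<epsilon>\<^sup>2))"

lemma power2_powr_minus_half: "0 < r \<Longrightarrow> (r\<^sup>2) powr - (real k / 2) = 1 / r ^ k"
proof -
  assume r: "0 < r"
  have "(r\<^sup>2) powr - (real k / 2) = (r powr 2) powr - (real k / 2)" using r by simp
  also have "\<dots> = r powr - real k" by (simp add: powr_powr)
  also have "\<dots> = 1 / r ^ k" using r by (simp add: powr_minus powr_realpow divide_inverse)
  finally show ?thesis .
qed

lemma kernel_profile_has_derivative:
  assumes "0 < \<epsilon>"
  shows "(kernel_profile k \<epsilon> has_real_derivative kernel_profile_deriv k \<epsilon> s) (at s)"
    and "continuous_on UNIV (kernel_profile_deriv k \<epsilon>)"
proof -
  have pos: "0 < \<epsilon>\<^sup>2" using assms by simp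
  \<comment> \<open>Value and slope at the joint: up to the factor \<open>- (k / 2)\<close>,
    \<open>at2\<close> is the slope of the power, and it agrees with the slope of the
    tangent.\<close>
  have at1: "(\<epsilon>\<^sup>2) powr - (real k / 2) = 1 / \<epsilon> ^ k" by (rule power2_powr_minus_half[OF assms])
  have at2: "(\<epsilon>\<^sup>2) powr (- (real k / 2) - 1) = 1 / \<epsilon> ^ k / \<epsilon>\<^sup>2"
    using pos by (simp add: powr_diff at1)
  have tangent: "((\<lambda>s. c * (1 + a - a * (s / e))) has_real_derivative - (c * a / e)) (at s)" for a c e s :: real
    unfolding divide_inverse by (auto intro!: derivative_eq_intros)
  show "(kernel_profile k \<epsilon> has_real_derivative kernel_profile_deriv k \<epsilon> s) (at s)"
    unfolding kernel_profile_def[abs_def] kernel_profile_deriv_def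
  proof (rule has_real_derivative_If_ge)
    show "((\<lambda>s. s powr - (real k / 2)) has_real_derivative - (real k / 2) * s powr (- (real k / 2) - 1)) (at s)"
      if "\<epsilon>\<^sup>2 \<le> s" for s
      using that pos by (intro has_real_derivative_powr) linarith
    show "((\<lambda>s. (1 / \<epsilon> ^ k) * (1 + k / 2 - k / 2 * (s / \<epsilon>\<^sup>2))) has_real_derivative
        - ((1 / \<epsilon> ^ k) * (k / 2) / \<epsilon>\<^sup>2)) (at s)" for s
      by (rule tangent)
  qed (use assms in \<open>simp_all add: at1 at2\<close>)
  have "continuous_on ({\<epsilon>\<^sup>2..} \<union> {..\<epsilon>\<^sup>2}) (kernel_profile_deriv k \<epsilon>)"
    unfolding kernel_profile_deriv_def[abs_def]
  proof (rule continuous_on_If)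
    show "continuous_on {\<epsilon>\<^sup>2..} (\<lambda>s. - (real k / 2) * s powr (- (real k / 2) - 1))"
      using pos by (intro continuous_intros) auto
  qed (auto simp: at2 intro!: continuous_intros)
  moreover have "{\<epsilon>\<^sup>2..} \<union> {..\<epsilon>\<^sup>2} = UNIV" by auto
  ultimately show "continuous_on UNIV (kernel_profile_deriv k \<epsilon>)" by simp
qed

text \<open>For an affine profile \<open>a + c * s\<close> the expression is
  \<open>k * a + (k + 2) * c * s\<close>. The tangent has
  \<open>a = (1 + k / 2) / \<epsilon> ^ k\<close> and
  \<open>c = - (k / 2) / \<epsilon> ^ (k + 2)\<close>, and
  \<open>(k + 2) * (k / 2) = k * (1 + k / 2)\<close> gives the common factor.\<close>

lemma kernel_profile_divergence:
  assumes "0 < \<epsilon>"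
  shows "real k * kernel_profile k \<epsilon> s + 2 * s * kernel_profile_deriv k \<epsilon> s =
    (if \<epsilon>\<^sup>2 \<le> s then 0 else real k * (1 + k / 2) / \<epsilon> ^ k * (1 - s / \<epsilon>\<^sup>2))"
proof (cases "\<epsilon>\<^sup>2 \<le> s")
  case True
  then have "0 < s" using assms by (meson less_le_trans zero_less_power)
  then have "s * s powr (- (real k / 2) - 1) = s powr - (real k / 2)" by (simp add: powr_diff)
  then show ?thesis using True by (simp add: kernel_profile_def kernel_profile_deriv_def)
next
  case False
  then show ?thesis using assms
    by (simp add: kernel_profile_def kernel_profile_deriv_def field_simps)
qed

text \<open>Integration over spheres is replaced by \<open>1 - r\<^sup>2 / \<epsilon>\<^sup>2 = (\<integral>u=r..\<epsilon>. 2 u / \<epsilon>\<^sup>2)\<close>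
  and the volume of balls.\<close>

lemma nn_integral_paraboloid:
  fixes b :: "nat \<Rightarrow> 'a::euclidean_space"
  assumes on: "orthonormal_below k b" and \<epsilon>: "0 < \<epsilon>"
  shows "(\<integral>\<^sup>+y. ennreal (indicator (ball 0 \<epsilon>) y * (1 - (norm y)\<^sup>2 / \<epsilon>\<^sup>2)) \<partial>subspace_measure k b) =
    ennreal (2 * unit_ball_vol k * \<epsilon> ^ k / (k + 2))"
proof -
  let ?M = "subspace_measure k b"
  interpret M: sigma_finite_measure ?M by (rule sigma_finite_subspace_measure[OF on])
  interpret pair_sigma_finite ?M "lborel :: real measure" ..
  let ?g = "\<lambda>(y::'a) r. ennreal (2 * r / \<epsilon>\<^sup>2) * indicator {norm y..\<epsilon>} r"
  have g: "(\<integral>\<^sup>+r. ?g y r \<partial>lborel) = ennreal (indicator (ball 0 \<epsilon>) y * (1 - (norm y)\<^sup>2 / \<epsilon>\<^sup>2))" for y :: 'a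
  proof (cases "norm y < \<epsilon>")
    case True
    have "(\<integral>\<^sup>+r. ?g y r \<partial>lborel) = ennreal (\<epsilon>\<^sup>2 / \<epsilon>\<^sup>2 - (norm y)\<^sup>2 / \<epsilon>\<^sup>2)"
    proof (rule nn_integral_FTC_Icc)
      show "((\<lambda>r. r\<^sup>2 / \<epsilon>\<^sup>2) has_real_derivative 2 * r / \<epsilon>\<^sup>2) (at r)" for r :: real
        using DERIV_cdivide[OF DERIV_pow[of 2 r UNIV], of "\<epsilon>\<^sup>2"] by simp
      show "0 \<le> 2 * r / \<epsilon>\<^sup>2" if "r \<in> {norm y..\<epsilon>}" for r
        using order_trans[OF norm_ge_zero[of y], of r] that by simp
    qed (use True in auto)
    then show ?thesis using True \<epsilon> by simp
  next
    case False
    \<comment> \<open>The interval is empty, or the single point \<open>\<epsilon>\<close> if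
      \<open>norm y = \<epsilon>\<close>.\<close>
    have "AE r in lborel. r \<noteq> \<epsilon>" by (rule AE_lborel_singleton)
    then have "AE r in lborel. ?g y r = 0"
      by eventually_elim (use False in \<open>auto simp: indicator_def\<close>)
    then have "(\<integral>\<^sup>+r. ?g y r \<partial>lborel) = (\<integral>\<^sup>+r. 0 \<partial>(lborel :: real measure))" by (rule nn_integral_cong_AE)
    then show ?thesis using False by simp
  qed
  have "closed {p :: 'a \<times> real. norm (fst p) \<le> snd p \<and> snd p \<le> \<epsilon>}"
    by (intro closed_Collect_conj closed_Collect_le continuous_intros)
  moreover have "sets (?M \<Otimes>\<^sub>M (lborel :: real measure)) = sets (borel :: ('a \<times> real) measure)"
    by (metis borel_prod sets_lborel sets_pair_measure_cong sets_subspace_measure)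
  ultimately have S: "{p :: 'a \<times> real. norm (fst p) \<le> snd p \<and> snd p \<le> \<epsilon>} \<in> sets (?M \<Otimes>\<^sub>M lborel)"
    by (simp only: borel_closed)
  have "(\<lambda>p. ennreal (2 * snd p / \<epsilon>\<^sup>2) * indicator {p. norm (fst p) \<le> snd p \<and> snd p \<le> \<epsilon>} p)
      \<in> borel_measurable (?M \<Otimes>\<^sub>M lborel)"
    by (intro borel_measurable_times_ennreal borel_measurable_indicator S) measurable
  moreover have "(\<lambda>(y, r). ?g y r) = (\<lambda>p. ennreal (2 * snd p / \<epsilon>\<^sup>2) * indicator {p. norm (fst p) \<le> snd p \<and> snd p \<le> \<epsilon>} p)"
    by (auto simp: fun_eq_iff indicator_def)
  ultimately have m: "(\<lambda>(y, r). ?g y r) \<in> borel_measurable (?M \<Otimes>\<^sub>M lborel)" by (simp only:)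
  have "(\<integral>\<^sup>+y. ennreal (indicator (ball 0 \<epsilon>) y * (1 - (norm y)\<^sup>2 / \<epsilon>\<^sup>2)) \<partial>?M) = (\<integral>\<^sup>+y. \<integral>\<^sup>+r. ?g y r \<partial>lborel \<partial>?M)"
    by (simp add: g)
  also have "\<dots> = (\<integral>\<^sup>+r. \<integral>\<^sup>+y. ?g y r \<partial>?M \<partial>lborel)"
    by (rule Fubini'[OF m, symmetric])
  also have "\<dots> = (\<integral>\<^sup>+r. ennreal (2 * unit_ball_vol k / \<epsilon>\<^sup>2 * r ^ (k + 1)) * indicator {0..\<epsilon>} r \<partial>lborel)"
  proof (rule nn_integral_cong)
    fix r :: real
    show "(\<integral>\<^sup>+y. ?g y r \<partial>?M) = ennreal (2 * unit_ball_vol k / \<epsilon>\<^sup>2 * r ^ (k + 1)) * indicator {0..\<epsilon>} r"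
    proof (cases "0 < r \<and> r \<le> \<epsilon>")
      case True
      have "(\<integral>\<^sup>+y. ?g y r \<partial>?M) = (\<integral>\<^sup>+y. ennreal (2 * r / \<epsilon>\<^sup>2) * indicator (cball 0 r) y \<partial>?M)"
        using True by (intro nn_integral_cong) (auto simp: indicator_def)
      also have "\<dots> = ennreal (2 * r / \<epsilon>\<^sup>2) * ennreal (unit_ball_vol k * r ^ k)"
        using True by (subst nn_integral_cmult_indicator) (simp_all add: emeasure_subspace_measure_cball[OF on])
      also have "\<dots> = ennreal (2 * unit_ball_vol k / \<epsilon>\<^sup>2 * r ^ (k + 1))"
        using True by (simp add: ennreal_mult[symmetric] field_simps)
      finally show ?thesis using True by simp
    next
      case False
      \<comment> \<open>For \<open>r < 0\<close> or \<open>r > \<epsilon>\<close> the interval does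
        not contain \<open>r\<close>; for \<open>r = 0\<close> the weight
        \<open>2 * r / \<epsilon>\<^sup>2\<close> vanishes.\<close>
      have "?g y r = 0" for y :: 'a
        using False norm_ge_zero[of y] by (cases "r = 0") (auto simp: indicator_def simp del: norm_ge_zero)
      then have "(\<integral>\<^sup>+y. ?g y r \<partial>?M) = (\<integral>\<^sup>+y. 0 \<partial>?M)" by (intro nn_integral_cong)
      then show ?thesis using False by (cases "r = 0") (auto simp: indicator_def)
    qed
  qed
  also have "\<dots> = ennreal (2 * unit_ball_vol k / \<epsilon>\<^sup>2 * (\<epsilon> ^ (k + 2) / (k + 2)) - 2 * unit_ball_vol k / \<epsilon>\<^sup>2 * (0 ^ (k + 2) / (k + 2)))"
  proof (rule nn_integral_FTC_Icc)
    show "((\<lambda>r. 2 * unit_ball_vol k / \<epsilon>\<^sup>2 * (r ^ (k + 2) / (k + 2))) has_real_derivative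
        2 * unit_ball_vol k / \<epsilon>\<^sup>2 * r ^ (k + 1)) (at r)" for r :: real
      by (rule DERIV_cmult, rule DERIV_cdivide[THEN DERIV_cong], rule DERIV_pow) (simp add: field_simps)
    show "0 \<le> 2 * unit_ball_vol k / \<epsilon>\<^sup>2 * r ^ (k + 1)" if "r \<in> {0..\<epsilon>}" for r
      using that unit_ball_vol_nonneg[of "real k"] by simp
  qed (use \<epsilon> in auto)
  also have "2 * unit_ball_vol k / \<epsilon>\<^sup>2 * (\<epsilon> ^ (k + 2) / (k + 2)) - 2 * unit_ball_vol k / \<epsilon>\<^sup>2 * (0 ^ (k + 2) / (k + 2))
      = 2 * unit_ball_vol k * \<epsilon> ^ k / (k + 2)"
    using \<epsilon> by (simp add: power_add power2_eq_square)
  finally show ?thesis .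
qed

text \<open>With \<open>z = (m + 1) / 2\<close> this is \<open>Gamma (z + 1) = z * Gamma z\<close>
  together with \<open>Gamma (1 / 2) = sqrt pi\<close>.\<close>

lemma unit_sphere_volume_eq: "unit_sphere_volume m = real (m + 1) * unit_ball_vol (real (m + 1))"
proof -
  define z where "z = (real m + 1) / 2"
  have z: "0 < z" by (simp add: z_def)
  have "Gamma (z + 1) = z * Gamma z" using z by (intro Gamma_plus1) auto
  moreover have "Gamma (1 / 2 :: real) ^ (m + 1) = pi powr z"
  proof -
    have "Gamma (1 / 2 :: real) ^ (m + 1) = (pi powr (1 / 2)) powr real (m + 1)"
      by (subst powr_realpow) (auto simp: Gamma_one_half_real powr_half_sqrt)
    also have "\<dots> = pi powr z" by (simp add: powr_powr z_def add.commute)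
    finally show ?thesis .
  qed
  moreover have "Gamma z > 0" using z by (rule Gamma_real_pos)
  moreover have "real (m + 1) / 2 = z" "(real m + 1) / 2 = z" "real (m + 1) = 2 * z" by (simp_all add: z_def)
  ultimately show ?thesis
    using z unfolding unit_sphere_volume_def unit_ball_vol_def by (simp add: field_simps)
qed

lemma unit_sphere_volume_pos: "0 < unit_sphere_volume m"
  unfolding unit_sphere_volume_eq by (intro mult_pos_pos) auto

text \<open>The product and the norm are unrelated in the type, so boundedness comes from finite
  dimension.\<close>

lemma bounded_bilinear_algebra_mult:
  "bounded_bilinear ((*) :: 'a::{real_algebra_1, euclidean_space} \<Rightarrow> 'a \<Rightarrow> 'a)"
  unfolding bilinear_conv_bounded_bilinear[symmetric] bilinear_def
  by (auto intro!: linearI simp: algebra_simps)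

section \<open>Derivatives of the regularised kernel\<close>

lemma C1_on_kernel_profile:
  assumes "0 < \<epsilon>"
  shows "C1_on W Y (\<lambda>y. kernel_profile k \<epsilon> ((norm (y - x))\<^sup>2))"
  by (rule C1_on_compose_real[OF C1_on_norm_power2 kernel_profile_has_derivative[OF assms]])

lemma has_vector_derivative_affine:
  "((\<lambda>h. y + h *\<^sub>R u - x) has_vector_derivative u) (at t)"
  unfolding has_vector_derivative_def by (auto intro!: derivative_eq_intros)

lemma dir_deriv_kernel_profile:
  assumes "0 < \<epsilon>"
  shows "dir_deriv (\<lambda>y. kernel_profile k \<epsilon> ((norm (y - x))\<^sup>2)) u y =
    2 * ((y - x) \<bullet> u) * kernel_profile_deriv k \<epsilon> ((norm (y - x))\<^sup>2)"
proof (rule dir_deriv_eqI)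
  have "((\<lambda>h. (y + h *\<^sub>R u - x) \<bullet> (y + h *\<^sub>R u - x)) has_vector_derivative
      (y + 0 *\<^sub>R u - x) \<bullet> u + u \<bullet> (y + 0 *\<^sub>R u - x)) (at 0)"
    by (rule bounded_bilinear.has_vector_derivative[OF bounded_bilinear_inner
          has_vector_derivative_affine has_vector_derivative_affine])
  then have "((\<lambda>h. (norm (y + h *\<^sub>R u - x))\<^sup>2) has_real_derivative 2 * ((y - x) \<bullet> u)) (at 0)"
    by (simp add: power2_norm_eq_inner has_real_derivative_iff_has_vector_derivative inner_commute)
  from DERIV_chain2[OF kernel_profile_has_derivative(1)[OF assms] this]
  show "((\<lambda>h. kernel_profile k \<epsilon> ((norm (y + h *\<^sub>R u - x))\<^sup>2)) has_vector_derivative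
      2 * ((y - x) \<bullet> u) * kernel_profile_deriv k \<epsilon> ((norm (y - x))\<^sup>2)) (at 0)"
    by (simp add: has_real_derivative_iff_has_vector_derivative mult.commute)
qed

lemma dir_deriv_bounded_linear:
  "bounded_linear L \<Longrightarrow> dir_deriv (\<lambda>y. L (y - x)) u y = L u"
proof (rule dir_deriv_eqI)
  assume L: "bounded_linear L"
  from bounded_linear.has_vector_derivative[OF L has_vector_derivative_affine]
  show "((\<lambda>h. L (y + h *\<^sub>R u - x)) has_vector_derivative L u) (at 0)" by simp
qed

lemma C1_on_regularized_kernel:
  fixes cj :: "'a::{real_algebra_1, euclidean_space} \<Rightarrow> 'a"
  assumes "linear cj" "0 < \<epsilon>"
  shows "C1_on W Y (\<lambda>y. cj (y - x))"
    and "C1_on W Y (\<lambda>y. kernel_profile k \<epsilon> ((norm (y - x))\<^sup>2) *\<^sub>R cj (y - x))"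
proof -
  have "bounded_linear cj" using assms(1) by (simp add: linear_conv_bounded_linear)
  then show C: "C1_on W Y (\<lambda>y. cj (y - x))"
    using C1_on_diff[OF C1_on_bounded_linear C1_on_const[of W Y "cj x"]]
    by (simp add: linear_diff[OF assms(1)])
  show "C1_on W Y (\<lambda>y. kernel_profile k \<epsilon> ((norm (y - x))\<^sup>2) *\<^sub>R cj (y - x))"
    by (intro C1_on_scaleR C1_on_kernel_profile assms(2) C)
qed

text \<open>By the product rule the terms with derivatives of \<open>f\<close> are
  \<open>E y\<close> times the monogenic sum. In the others, \<open>cj (w s) * w s = 1\<close>
  contributes the dimension, and the radial terms recombine to \<open>cj z * z\<close>, a real
  number. What multiplies \<open>f y\<close> is therefore a scalar.\<close>

lemma divergence_kernel_product:
  fixes cj :: "'a::{real_algebra_1, euclidean_space} \<Rightarrow> 'a"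
  assumes on: "orthonormal_below (Suc m) w" and W: "W = span (w ` {..<Suc m})"
    and cj: "linear cj" "\<And>z. z \<in> W \<Longrightarrow> cj z * z = of_real ((norm z)\<^sup>2)"
    and \<epsilon>: "0 < \<epsilon>" and x: "x \<in> W" and y: "y \<in> W" and f: "C1_on W W f"
    and mono: "(\<Sum>s\<le>m. w s * dir_deriv f (w s) y) = 0"
  defines "E \<equiv> (\<lambda>y. kernel_profile (Suc m) \<epsilon> ((norm (y - x))\<^sup>2) *\<^sub>R cj (y - x))"
  shows "(\<Sum>s\<le>m. dir_deriv (\<lambda>y. E y * w s * f y) (w s) y) =
      (real (Suc m) * kernel_profile (Suc m) \<epsilon> ((norm (y - x))\<^sup>2)
        + 2 * (norm (y - x))\<^sup>2 * kernel_profile_deriv (Suc m) \<epsilon> ((norm (y - x))\<^sup>2)) *\<^sub>R f y"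
proof -
  let ?q = "kernel_profile (Suc m) \<epsilon> ((norm (y - x))\<^sup>2)"
    and ?q' = "kernel_profile_deriv (Suc m) \<epsilon> ((norm (y - x))\<^sup>2)" and ?z = "y - x"
  note mult = bounded_bilinear_algebra_mult
  have sW: "subspace W" and opW: "openin (top_of_set W) W" by (simp_all add: W)
  have wW: "w s \<in> W" if "s \<le> m" for s using that by (auto simp: W intro!: span_base)
  have bl: "bounded_linear cj" using cj(1) by (simp add: linear_conv_bounded_linear)
  note Ccj = C1_on_regularized_kernel(1)[OF cj(1) \<epsilon>]
  have CE: "C1_on W W E" unfolding E_def by (rule C1_on_regularized_kernel(2)[OF cj(1) \<epsilon>])
  have CEw: "C1_on W W (\<lambda>y. E y * w s)" for s
    by (rule C1_on_bilinear[OF mult CE C1_on_const])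
  have DE: "dir_deriv E (w s) y = ?q *\<^sub>R cj (w s) + (2 * (?z \<bullet> w s) * ?q') *\<^sub>R cj ?z" if "s \<le> m" for s
    unfolding E_def
    using dir_deriv_bilinear[OF bounded_bilinear_scaleR sW opW y wW[OF that] C1_on_kernel_profile[OF \<epsilon>] Ccj]
    by (simp add: dir_deriv_kernel_profile[OF \<epsilon>] dir_deriv_bounded_linear[OF bl])
  have D: "dir_deriv (\<lambda>y. E y * w s * f y) (w s) y =
      E y * w s * dir_deriv f (w s) y + dir_deriv E (w s) y * w s * f y" if s: "s \<le> m" for s
  proof -
    have "dir_deriv (\<lambda>_. w s) (w s) y = 0" by (rule dir_deriv_eqI) simp
    then show ?thesis
      using dir_deriv_bilinear[OF mult sW opW y wW[OF s] CEw f, of s]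
        dir_deriv_bilinear[OF mult sW opW y wW[OF s] CE C1_on_const, of "w s"] by simp
  qed
  have zW: "?z \<in> W" by (rule subspace_diff[OF sW y x])
  have unit: "cj (w s) * w s = 1" if "s \<le> m" for s
    using cj(2)[OF wW[OF that]] that on by (simp add: orthonormal_below_def power2_norm_eq_inner)
  have z: "(\<Sum>s\<le>m. (?z \<bullet> w s) *\<^sub>R w s) = ?z"
    using inner_expand_orthonormal[OF on] zW by (simp add: W lessThan_Suc_atMost)
  have "(\<Sum>s\<le>m. dir_deriv E (w s) y * w s) =
      (\<Sum>s\<le>m. ?q *\<^sub>R (cj (w s) * w s)) + (\<Sum>s\<le>m. (2 * ?q') *\<^sub>R (cj ?z * ((?z \<bullet> w s) *\<^sub>R w s)))"
    unfolding sum.distrib[symmetric]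
    by (intro sum.cong refl) (simp add: DE distrib_right)
  also have "(\<Sum>s\<le>m. ?q *\<^sub>R (cj (w s) * w s)) = (\<Sum>s\<le>m. ?q *\<^sub>R 1)"
    by (intro sum.cong refl) (simp add: unit)
  also have "\<dots> = (real (Suc m) * ?q) *\<^sub>R 1"
    by (simp only: sum_constant_scaleR card_atMost scaleR_scaleR)
  also have "(\<Sum>s\<le>m. (2 * ?q') *\<^sub>R (cj ?z * ((?z \<bullet> w s) *\<^sub>R w s))) = (2 * ?q') *\<^sub>R (cj ?z * ?z)"
    by (simp only: scaleR_sum_right[symmetric] sum_distrib_left[symmetric] z)
  also have "cj ?z * ?z = (norm ?z)\<^sup>2 *\<^sub>R 1" using cj(2)[OF zW] by (simp add: of_real_def)
  finally have S: "(\<Sum>s\<le>m. dir_deriv E (w s) y * w s) =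
      (real (Suc m) * ?q + 2 * (norm ?z)\<^sup>2 * ?q') *\<^sub>R 1"
    by (simp add: scaleR_left_distrib mult_ac del: of_nat_Suc)
  have "(\<Sum>s\<le>m. dir_deriv (\<lambda>y. E y * w s * f y) (w s) y) =
      E y * (\<Sum>s\<le>m. w s * dir_deriv f (w s) y) + (\<Sum>s\<le>m. dir_deriv E (w s) y * w s) * f y"
  proof -
    have "(\<Sum>s\<le>m. dir_deriv (\<lambda>y. E y * w s * f y) (w s) y) =
        (\<Sum>s\<le>m. E y * w s * dir_deriv f (w s) y + dir_deriv E (w s) y * w s * f y)"
      by (intro sum.cong refl D) simp
    then show ?thesis by (simp add: sum.distrib sum_distrib_left sum_distrib_right mult.assoc)
  qed
  then show "(\<Sum>s\<le>m. dir_deriv (\<lambda>y. E y * w s * f y) (w s) y) =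
      (real (Suc m) * ?q + 2 * (norm ?z)\<^sup>2 * ?q') *\<^sub>R f y"
    by (simp only: mono S) simp
qed

text \<open>The divergence that the tangent leaves inside the ball. Being nonnegative with a total
  mass independent of \<open>\<epsilon>\<close>, it is an approximate identity up to the factor
  \<open>real k * unit_ball_vol k\<close>.\<close>

definition kernel_mollifier :: "nat \<Rightarrow> real \<Rightarrow> 'a::real_normed_vector \<Rightarrow> real" where
  "kernel_mollifier k \<epsilon> z =
     real k * (1 + k / 2) / \<epsilon> ^ k * (indicator (ball 0 \<epsilon>) z * (1 - (norm z)\<^sup>2 / \<epsilon>\<^sup>2))"

lemma kernel_mollifier_eq:
  assumes "0 < \<epsilon>"
  shows "real k * kernel_profile k \<epsilon> ((norm z)\<^sup>2) + 2 * (norm z)\<^sup>2 * kernel_profile_deriv k \<epsilon> ((norm z)\<^sup>2)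
    = kernel_mollifier k \<epsilon> z"
proof -
  have "\<epsilon>\<^sup>2 \<le> (norm z)\<^sup>2 \<longleftrightarrow> \<not> norm z < \<epsilon>"
    using assms by (metis abs_le_square_iff abs_norm_cancel abs_of_pos not_le)
  then show ?thesis
    unfolding kernel_profile_divergence[OF assms] kernel_mollifier_def by (simp add: indicator_def)
qed

lemma kernel_mollifier_nonneg: "0 < \<epsilon> \<Longrightarrow> 0 \<le> kernel_mollifier k \<epsilon> z"
  and kernel_mollifier_zero: "\<not> norm z < \<epsilon> \<Longrightarrow> kernel_mollifier k \<epsilon> z = 0"
proof -
  assume \<epsilon>: "0 < \<epsilon>"
  show "0 \<le> kernel_mollifier k \<epsilon> z"
  proof (cases "norm z < \<epsilon>")
    case True
    then have "(norm z)\<^sup>2 \<le> \<epsilon>\<^sup>2" by (intro power_mono) auto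
    then have "0 \<le> 1 - (norm z)\<^sup>2 / \<epsilon>\<^sup>2" using \<epsilon> by simp
    then show ?thesis unfolding kernel_mollifier_def using \<epsilon>
      by (intro mult_nonneg_nonneg divide_nonneg_nonneg) auto
  qed (simp add: kernel_mollifier_def)
qed (simp add: kernel_mollifier_def)

lemma kernel_mollifier_integral:
  fixes b :: "nat \<Rightarrow> 'a::euclidean_space"
  assumes on: "orthonormal_below k b" and \<epsilon>: "0 < \<epsilon>" and x: "x \<in> span (b ` {..<k})"
  shows "integrable (subspace_measure k b) (\<lambda>y. kernel_mollifier k \<epsilon> (y - x))"
    and "(\<integral>y. kernel_mollifier k \<epsilon> (y - x) \<partial>subspace_measure k b) = real k * unit_ball_vol k"
proof -
  let ?M = "subspace_measure k b"
  let ?c = "real k * (1 + k / 2) / \<epsilon> ^ k"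
  let ?f = "\<lambda>z::'a. indicator (ball 0 \<epsilon>) z * (1 - (norm z)\<^sup>2 / \<epsilon>\<^sup>2)"
  have [measurable]: "ball (0::'a) \<epsilon> \<in> sets borel" by (rule borel_open[OF open_ball])
  have m [measurable]: "(\<lambda>z. kernel_mollifier k \<epsilon> (z :: 'a)) \<in> borel_measurable borel"
    unfolding kernel_mollifier_def
    by measurable
  have nn: "0 \<le> kernel_mollifier k \<epsilon> z" for z :: 'a by (rule kernel_mollifier_nonneg[OF \<epsilon>])
  have "(\<integral>\<^sup>+y. ennreal (kernel_mollifier k \<epsilon> (y - x)) \<partial>?M) = (\<integral>\<^sup>+y. ennreal (kernel_mollifier k \<epsilon> y) \<partial>?M)"
    using nn_integral_subspace_measure_translate[of "\<lambda>y. ennreal (kernel_mollifier k \<epsilon> y)" "- x" b k] x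
    by (simp add: span_neg)
  also have "\<dots> = (\<integral>\<^sup>+y. ennreal ?c * ennreal (?f y) \<partial>?M)"
    unfolding kernel_mollifier_def using \<epsilon> by (intro nn_integral_cong ennreal_mult') simp
  also have "\<dots> = ennreal ?c * ennreal (2 * unit_ball_vol k * \<epsilon> ^ k / (k + 2))"
    by (subst nn_integral_cmult) (simp_all add: nn_integral_paraboloid[OF on \<epsilon>])
  also have "\<dots> = ennreal (?c * (2 * unit_ball_vol k * \<epsilon> ^ k / (k + 2)))"
    using \<epsilon> by (intro ennreal_mult'[symmetric]) simp
  also have "?c * (2 * unit_ball_vol k * \<epsilon> ^ k / (k + 2)) = real k * unit_ball_vol k"
  proof -
    \<comment> \<open>The factors are regrouped so that \<open>(1 + k / 2) * 2\<close> meets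
      \<open>k + 2\<close> and the powers of \<open>\<epsilon>\<close> meet each other.\<close>
    have aux: "a * p / E * (2 * v * E / q) = a * v * (p * 2 / q) * (E / E)" for a p E v q :: real by simp
    have "?c * (2 * unit_ball_vol k * \<epsilon> ^ k / (k + 2)) =
        real k * unit_ball_vol k * ((1 + real k / 2) * 2 / (real k + 2)) * (\<epsilon> ^ k / \<epsilon> ^ k)"
      using aux[of "real k" "1 + real k / 2" "\<epsilon> ^ k" "unit_ball_vol k" "real k + 2"] by (simp only: of_nat_add of_nat_numeral)
    also have "(1 + real k / 2) * 2 = real k + 2" by simp
    also have "real k * unit_ball_vol k * ((real k + 2) / (real k + 2)) * (\<epsilon> ^ k / \<epsilon> ^ k) =
        real k * unit_ball_vol k"
      using \<epsilon> by simp
    finally show ?thesis .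
  qed
  finally have I: "(\<integral>\<^sup>+y. ennreal (kernel_mollifier k \<epsilon> (y - x)) \<partial>?M) = ennreal (real k * unit_ball_vol k)" .
  show "integrable ?M (\<lambda>y. kernel_mollifier k \<epsilon> (y - x))"
    by (rule integrableI_nonneg) (use nn I in auto)
  show "(\<integral>y. kernel_mollifier k \<epsilon> (y - x) \<partial>?M) = real k * unit_ball_vol k"
    by (subst integral_eq_nn_integral) (use nn I in auto)
qed

text \<open>The relation \<open>cj z * z = of_real ((norm z)\<^sup>2)\<close> on \<open>W\<close> is
  the only link between conjugation and scalar product that the formula uses; the hypercomplex
  structure serves to provide it.\<close>

theorem Cauchy_formula_subspace:
  fixes cj :: "'a::{real_algebra_1, euclidean_space} \<Rightarrow> 'a"
  assumes on: "orthonormal_below (Suc m) w" and W: "W = span (w ` {..<Suc m})"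
    and cj: "linear cj" "\<And>z. z \<in> W \<Longrightarrow> cj z * z = of_real ((norm z)\<^sup>2)"
    and G: "openin (top_of_set W) G" "bounded G" "C1_boundary m W G"
    and Y: "openin (top_of_set W) Y" "closure G \<subseteq> Y"
    and f: "C1_on W Y f" "\<And>y. y \<in> Y \<Longrightarrow> (\<Sum>s\<le>m. w s * dir_deriv f (w s) y) = 0"
    and x: "x \<in> W" "x \<notin> closure G - G"
  shows "boundary_form_integral m W G (\<lambda>y. (1 / norm (y - x) ^ (m + 1)) *\<^sub>R cj (y - x)) f =
    (if x \<in> G then unit_sphere_volume m *\<^sub>R f x else 0)" (is "?BI = _")
proof -
  let ?M = "subspace_measure (Suc m) w"
  have sW: "subspace W" and opW: "openin (top_of_set W) W" by (simp_all add: W)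
  have GW: "G \<subseteq> W" and YW: "Y \<subseteq> W" using G(1) Y(1) openin_imp_subset by blast+
  have wW: "w s \<in> W" if "s \<le> m" for s using that by (auto simp: W intro!: span_base)
  obtain U where U: "open U" "Y = W \<inter> U" using Y(1) by (auto simp: openin_open)
  have "compact (closure G)" using G(2) by (simp add: compact_closure)
  then obtain \<zeta> :: "'a \<Rightarrow> real" and Q K' where \<zeta>: "open Q" "closure G \<subseteq> Q" "\<And>y. y \<in> Q \<Longrightarrow> \<zeta> y = 1"
    "C1_on W W \<zeta>" "compact K'" "K' \<subseteq> U" "\<And>y. y \<notin> K' \<Longrightarrow> \<zeta> y = 0"
  proof (rule C1_cutoff[OF _ U(1)])
    show "closure G \<subseteq> U" using Y(2) U(2) by blast
  qed blast
  \<comment> \<open>\<open>f\<close> is of class C1 only on \<open>Y\<close>. The cut-off gives a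
    function of class C1 on all of \<open>W\<close> that has the values and derivatives of
    \<open>f\<close> on \<open>closure G\<close>.\<close>
  define \<phi> where "\<phi> = (\<lambda>y. \<zeta> y *\<^sub>R f y)"
  have \<phi>: "C1_on W W \<phi>"
  proof (rule C1_on_extend_zero[OF sW Y(1)])
    show "C1_on W Y \<phi>" unfolding \<phi>_def by (intro C1_on_scaleR f(1) C1_on_subset[OF \<zeta>(4) YW])
    show "compact (W \<inter> K')" by (intro closed_Int_compact closed_subspace sW \<zeta>(5))
  qed (use \<zeta>(6,7) U(2) in \<open>auto simp: \<phi>_def\<close>)
  have opQ: "openin (top_of_set W) (Y \<inter> Q)" using U \<zeta>(1) by (auto simp: openin_open)
  have \<phi>_eq: "\<phi> y = f y" "\<And>u. u \<in> W \<Longrightarrow> dir_deriv \<phi> u y = dir_deriv f u y" if y: "y \<in> closure G" for y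
  proof -
    have yQ: "y \<in> Y \<inter> Q" using y Y(2) \<zeta>(2) by blast
    then show "\<phi> y = f y" by (simp add: \<phi>_def \<zeta>(3))
    show "dir_deriv \<phi> u y = dir_deriv f u y" if "u \<in> W" for u
      by (rule dir_deriv_cong_openin[OF sW opQ yQ that C1_on_subset[OF f(1) Int_lower1]])
        (simp add: \<phi>_def \<zeta>(3))
  qed
  \<comment> \<open>The last property covers both positions of \<open>x\<close>: for
    \<open>x\<close> in \<open>G\<close> the boundary keeps the distance \<open>\<delta>\<close>,
    for \<open>x\<close> outside the whole closure does.\<close>
  obtain \<delta> where \<delta>: "0 < \<delta>" "x \<in> G \<Longrightarrow> W \<inter> ball x \<delta> \<subseteq> G"
    "\<And>p. p \<in> closure G \<Longrightarrow> p \<notin> G \<or> x \<notin> G \<Longrightarrow> \<delta> \<le> norm (p - x)"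
  proof (cases "x \<in> G")
    case True
    obtain O1 where O1: "open O1" "G = W \<inter> O1" using G(1) by (auto simp: openin_open)
    then obtain \<delta> where \<delta>: "0 < \<delta>" "ball x \<delta> \<subseteq> O1" using True open_contains_ball by blast
    have "W \<inter> ball x \<delta> \<subseteq> G" using \<delta>(2) O1(2) by blast
    moreover have "\<delta> \<le> norm (p - x)" if "p \<in> closure G" "p \<notin> G" for p
      using that \<open>W \<inter> ball x \<delta> \<subseteq> G\<close> Y(2) YW by (force simp: dist_norm norm_minus_commute)
    ultimately show thesis using \<delta>(1) True by (intro that[of \<delta>]) auto
  next
    case False
    then have "x \<in> - closure G" using x(2) by blast
    then obtain \<delta> where \<delta>: "0 < \<delta>" "ball x \<delta> \<subseteq> - closure G"
      using open_contains_ball[of "- closure G"] by auto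
    then have "\<delta> \<le> norm (p - x)" if "p \<in> closure G" for p
      using that by (force simp: dist_norm norm_minus_commute)
    then show thesis using \<delta>(1) False by (intro that[of \<delta>]) auto
  qed
  let ?k = "\<lambda>\<epsilon> y. kernel_mollifier (Suc m) \<epsilon> (y - x)"
  \<comment> \<open>The left side does not involve \<open>\<epsilon>\<close>: on the boundary the
    kernel is unchanged by the regularisation.\<close>
  have BI: "?BI = (\<integral>y. indicator G y *\<^sub>R (?k \<epsilon> y *\<^sub>R f y) \<partial>?M)" if \<epsilon>: "0 < \<epsilon>" "\<epsilon> \<le> \<delta>" for \<epsilon>
  proof -
    define E where "E = (\<lambda>y. kernel_profile (Suc m) \<epsilon> ((norm (y - x))\<^sup>2) *\<^sub>R cj (y - x))"
    have mono: "(\<Sum>s\<le>m. w s * dir_deriv \<phi> (w s) y) = 0" if "y \<in> G" for y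
    proof -
      have y: "y \<in> closure G" using that closure_subset by blast
      then have "(\<Sum>s\<le>m. w s * dir_deriv \<phi> (w s) y) = (\<Sum>s\<le>m. w s * dir_deriv f (w s) y)"
        by (intro sum.cong refl) (simp add: \<phi>_eq(2) wW)
      then show ?thesis using f(2) y Y(2) by auto
    qed
    have CF: "C1_on W W (\<lambda>y. E y * w s * \<phi> y)" for s
      unfolding E_def by (intro C1_on_bilinear[OF bounded_bilinear_algebra_mult] C1_on_const \<phi>
          C1_on_regularized_kernel(2) cj(1) \<epsilon>(1))
    have "?BI = (\<integral>y. indicator G y *\<^sub>R (\<Sum>s\<le>m. dir_deriv (\<lambda>y. E y * w s * \<phi> y) (w s) y) \<partial>?M)"
      unfolding boundary_form_integral_def
    proof (rule boundary_integral_divergence[OF on W G CF])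
      fix p assume p: "p \<in> closure G - G" and \<nu>W: "outward_normal W G p \<in> W"
      let ?\<nu> = "outward_normal W G p"
      have far: "\<epsilon> \<le> norm (p - x)" using \<delta>(3)[of p] p \<epsilon>(2) by auto
      then have "\<epsilon>\<^sup>2 \<le> (norm (p - x))\<^sup>2" using \<epsilon>(1) by (intro power_mono) auto
      then have "kernel_profile (Suc m) \<epsilon> ((norm (p - x))\<^sup>2) = 1 / norm (p - x) ^ (m + 1)"
        using power2_powr_minus_half[OF less_le_trans[OF \<epsilon>(1) far], of "Suc m"]
        by (simp add: kernel_profile_def)
      then have E: "E p = (1 / norm (p - x) ^ (m + 1)) *\<^sub>R cj (p - x)" by (simp add: E_def)
      have "(\<Sum>s\<le>m. (?\<nu> \<bullet> w s) *\<^sub>R (E p * w s * \<phi> p)) = E p * (\<Sum>s\<le>m. (?\<nu> \<bullet> w s) *\<^sub>R w s) * f p"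
        using p by (simp add: sum_distrib_left sum_distrib_right \<phi>_eq(1))
      also have "(\<Sum>s\<le>m. (?\<nu> \<bullet> w s) *\<^sub>R w s) = ?\<nu>"
        using inner_expand_orthonormal[OF on] \<nu>W by (simp add: W lessThan_Suc_atMost)
      finally show "(1 / norm (p - x) ^ (m + 1)) *\<^sub>R cj (p - x) * ?\<nu> * f p =
          (\<Sum>s\<le>m. (?\<nu> \<bullet> w s) *\<^sub>R (E p * w s * \<phi> p))"
        by (simp only: E)
    qed
    also have "\<dots> = (\<integral>y. indicator G y *\<^sub>R (?k \<epsilon> y *\<^sub>R f y) \<partial>?M)"
    proof (intro Bochner_Integration.integral_cong refl)
      fix y
      show "indicator G y *\<^sub>R (\<Sum>s\<le>m. dir_deriv (\<lambda>y. E y * w s * \<phi> y) (w s) y) =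
          indicator G y *\<^sub>R (?k \<epsilon> y *\<^sub>R f y)"
      proof (cases "y \<in> G")
        case True
        have "\<phi> y = f y" using True closure_subset by (intro \<phi>_eq(1)) blast
        then show ?thesis
          using divergence_kernel_product[OF on W cj \<epsilon>(1) x(1) _ \<phi> mono[OF True]] True GW
          by (auto simp: E_def kernel_mollifier_eq[OF \<epsilon>(1)] simp del: of_nat_Suc)
      qed simp
    qed
    finally show ?thesis .
  qed
  show ?thesis
  proof (cases "x \<in> G")
    case False
    have zero: "indicator G y *\<^sub>R (?k \<delta> y *\<^sub>R f y) = 0" for y
      using \<delta>(3)[of y] False closure_subset[of G] kernel_mollifier_zero[of "y - x" \<delta> "Suc m"]
      by (cases "y \<in> G") auto
    show ?thesis unfolding BI[OF \<delta>(1) order_refl] zero using False by simp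
  next
    case True
    let ?\<sigma> = "unit_sphere_volume m"
    \<comment> \<open>On a ball where \<open>f\<close> differs from \<open>f x\<close> by at most
      \<open>\<eta>\<close>, a mass of \<open>?\<sigma>\<close> yields this error. As
      \<open>?BI\<close> is a fixed vector, letting \<open>\<eta>\<close> tend to 0 needs no limit
      under the integral.\<close>
    have bound: "norm (?BI - ?\<sigma> *\<^sub>R f x) \<le> \<eta> * ?\<sigma>" if \<eta>: "0 < \<eta>" for \<eta>
    proof -
      have xY: "x \<in> Y" using True Y(2) closure_subset by blast
      obtain \<epsilon>0 where \<epsilon>0: "0 < \<epsilon>0" "\<And>y. y \<in> Y \<Longrightarrow> dist y x < \<epsilon>0 \<Longrightarrow> dist (f y) (f x) < \<eta>"
        using C1_on_continuous[OF f(1)] xY \<eta> unfolding continuous_on_iff by blast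
      define \<epsilon> where "\<epsilon> = min \<delta> \<epsilon>0"
      have \<epsilon>: "0 < \<epsilon>" "\<epsilon> \<le> \<delta>" "\<epsilon> \<le> \<epsilon>0" using \<delta>(1) \<epsilon>0(1) by (auto simp: \<epsilon>_def)
      have nn: "0 \<le> ?k \<epsilon> y" for y by (rule kernel_mollifier_nonneg[OF \<epsilon>(1)])
      have near: "y \<in> G" "norm (f y - f x) \<le> \<eta>" if "y \<in> W" "norm (y - x) < \<epsilon>" for y
      proof -
        show yG: "y \<in> G" using \<delta>(2)[OF True] that \<epsilon>(2) by (auto simp: dist_norm norm_minus_commute)
        then have "y \<in> Y" using Y(2) closure_subset by blast
        then show "norm (f y - f x) \<le> \<eta>" using \<epsilon>0(2)[of y] that(2) \<epsilon>(3) by (simp add: dist_norm)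
      qed
      have xs: "x \<in> span (w ` {..<Suc m})" using x(1) W by simp
      have int_k: "integrable ?M (?k \<epsilon>)" and k: "(\<integral>y. ?k \<epsilon> y \<partial>?M) = ?\<sigma>"
        using kernel_mollifier_integral[OF on \<epsilon>(1) xs] by (simp_all add: unit_sphere_volume_eq)
      have AE: "AE y in ?M. y \<in> W" using AE_subspace_measure[of w "Suc m"] by (simp add: W)
      have AE_bd: "AE y in ?M. norm (indicator G y *\<^sub>R (?k \<epsilon> y *\<^sub>R f y) - ?k \<epsilon> y *\<^sub>R f x) \<le> \<eta> * ?k \<epsilon> y"
        using AE
      proof eventually_elim
        case (elim y)
        show ?case
        proof (cases "norm (y - x) < \<epsilon>")
          case True
          have "indicator G y *\<^sub>R (?k \<epsilon> y *\<^sub>R f y) - ?k \<epsilon> y *\<^sub>R f x = ?k \<epsilon> y *\<^sub>R (f y - f x)"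
            using near(1)[OF elim True] by (simp add: scaleR_diff_right)
          then have "norm (indicator G y *\<^sub>R (?k \<epsilon> y *\<^sub>R f y) - ?k \<epsilon> y *\<^sub>R f x) = ?k \<epsilon> y * norm (f y - f x)"
            using nn[of y] by simp
          also have "\<dots> \<le> ?k \<epsilon> y * \<eta>" by (rule mult_left_mono[OF near(2)[OF elim True] nn])
          finally show ?thesis by (simp add: mult.commute)
        qed (simp add: kernel_mollifier_zero)
      qed
      have int_x: "integrable ?M (\<lambda>y. ?k \<epsilon> y *\<^sub>R f x)" using int_k by simp
      have int_d: "integrable ?M (\<lambda>y. indicator G y *\<^sub>R (?k \<epsilon> y *\<^sub>R f y) - ?k \<epsilon> y *\<^sub>R f x)"
      proof (rule Bochner_Integration.integrable_bound)
        show "integrable ?M (\<lambda>y. \<eta> * ?k \<epsilon> y)" using int_k by simp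
        have "(\<lambda>y. indicator G y *\<^sub>R f y) \<in> borel_measurable borel"
          by (rule borel_measurable_openin_indicator(1)[OF sW G(1) continuous_on_subset[OF C1_on_continuous[OF f(1)]]])
            (use Y(2) closure_subset in blast)
        then have "(\<lambda>y. indicator G y *\<^sub>R f y) \<in> borel_measurable ?M" by simp
        moreover have "?k \<epsilon> \<in> borel_measurable ?M" using int_k by simp
        ultimately have "(\<lambda>y. ?k \<epsilon> y *\<^sub>R (indicator G y *\<^sub>R f y)) \<in> borel_measurable ?M"
          by (rule borel_measurable_scaleR[rotated])
        then have "(\<lambda>y. indicator G y *\<^sub>R (?k \<epsilon> y *\<^sub>R f y)) \<in> borel_measurable ?M"
          by (simp add: mult.commute)
        then show "(\<lambda>y. indicator G y *\<^sub>R (?k \<epsilon> y *\<^sub>R f y) - ?k \<epsilon> y *\<^sub>R f x) \<in> borel_measurable ?M"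
          using int_x by (intro borel_measurable_diff) auto
        show "AE y in ?M. norm (indicator G y *\<^sub>R (?k \<epsilon> y *\<^sub>R f y) - ?k \<epsilon> y *\<^sub>R f x) \<le> norm (\<eta> * ?k \<epsilon> y)"
          using AE_bd by eventually_elim (use nn \<eta> in auto)
      qed
      have int_f: "integrable ?M (\<lambda>y. indicator G y *\<^sub>R (?k \<epsilon> y *\<^sub>R f y))"
        using Bochner_Integration.integrable_add[OF int_d int_x] by simp
      have "?BI - ?\<sigma> *\<^sub>R f x = (\<integral>y. indicator G y *\<^sub>R (?k \<epsilon> y *\<^sub>R f y) - ?k \<epsilon> y *\<^sub>R f x \<partial>?M)"
        unfolding BI[OF \<epsilon>(1,2)] Bochner_Integration.integral_diff[OF int_f int_x]
        using int_k k by simp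
      also have "norm \<dots> \<le> (\<integral>y. norm (indicator G y *\<^sub>R (?k \<epsilon> y *\<^sub>R f y) - ?k \<epsilon> y *\<^sub>R f x) \<partial>?M)"
        by (rule integral_norm_bound)
      also have "\<dots> \<le> (\<integral>y. \<eta> * ?k \<epsilon> y \<partial>?M)"
        using int_d int_k by (intro integral_mono_AE[OF _ _ AE_bd]) auto
      also have "\<dots> = \<eta> * ?\<sigma>" using k by simp
      finally show ?thesis .
    qed
    have small: "norm (?BI - ?\<sigma> *\<^sub>R f x) \<le> e" if "0 < e" for e
      using bound[of "e / ?\<sigma>"] unit_sphere_volume_pos[of m] that by simp
    have "norm (?BI - ?\<sigma> *\<^sub>R f x) \<le> 0" by (rule field_le_epsilon) (use small in simp)
    then show ?thesis using True by simp
  qed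
qed

section \<open>Slices of hypercomplex subspaces\<close>

text \<open>In the expansion of \<open>y\<close> the diagonal products \<open>cj (v s) * v s\<close>
  are 1. The mixed ones cancel in pairs, since distinct imaginary units anticommute and conjugation
  changes their sign.\<close>

lemma hypercomplex_conj_mult_self:
  fixes cj :: "'a::{real_algebra_1, euclidean_space} \<Rightarrow> 'a"
  assumes cj: "star_involution cj" and hb: "hypercomplex_basis cj V n v"
    and on: "orthonormal_below (Suc n) v" and y: "y \<in> V"
  shows "cj y * y = of_real ((norm y)\<^sup>2)"
proof -
  have lin: "linear cj" and inv: "\<And>x. cj (cj x) = x" and anti: "\<And>x y. cj (x * y) = cj y * cj x"
    using cj by (auto simp: star_involution_def)
  note hb' = hb[unfolded hypercomplex_basis_def ordered_basis_def, folded lessThan_Suc_atMost]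
  have v0: "v 0 = 1" and V: "V = span (v ` {..<Suc n})" using hb' by simp_all
  have unit: "v s \<in> imag_units cj" if "s \<in> {1..n}" for s using hb' that by blast
  have comm: "v s * v u = - (v u * v s)" if "s \<in> {1..n}" "u \<in> {1..n}" "s \<noteq> u" for s u
    using hb' that by blast
  \<comment> \<open>Applying \<open>cj\<close> to \<open>cj 1 * 1\<close> gives 1 on one side and
    \<open>cj 1 * 1\<close> on the other.\<close>
  have cj1: "cj 1 = 1" using anti[of "cj 1" 1] inv by simp
  have cjv: "cj (v s) = - v s" if "s \<in> {1..n}" for s
    using unit[OF that] by (simp add: imag_units_def eq_neg_iff_add_eq_0 add.commute)
  have diag: "cj (v s) * v s = 1" if "s \<le> n" for s
  proof (cases "s = 0")
    case False
    then have s: "s \<in> {1..n}" using that by simp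
    then have "v s * cj (v s) = 1" using unit by (simp add: imag_units_def)
    then show ?thesis by (simp add: cjv[OF s])
  qed (simp add: v0 cj1)
  have off: "cj (v s) * v u + cj (v u) * v s = 0" if "s \<le> n" "u \<le> n" "s \<noteq> u" for s u
  proof (cases "s = 0 \<or> u = 0")
    case True
    then show ?thesis using that cjv by (auto simp: v0 cj1)
  next
    case False
    then have "s \<in> {1..n}" "u \<in> {1..n}" using that by auto
    then show ?thesis using comm[of s u] that(3) by (simp add: cjv)
  qed
  define c where "c = (\<lambda>i. y \<bullet> v i)"
  have y_eq: "y = (\<Sum>i\<le>n. c i *\<^sub>R v i)"
    using inner_expand_orthonormal[OF on] y by (simp add: V c_def lessThan_Suc_atMost)
  let ?S = "\<Sum>i\<le>n. \<Sum>j\<le>n. (c i * c j) *\<^sub>R (cj (v i) * v j)"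
  have S: "cj y * y = ?S"
  proof -
    have "cj y = (\<Sum>i\<le>n. c i *\<^sub>R cj (v i))"
      by (subst y_eq) (simp add: linear_sum[OF lin] linear_cmul[OF lin])
    then have "cj y * y = (\<Sum>i\<le>n. c i *\<^sub>R cj (v i)) * (\<Sum>j\<le>n. c j *\<^sub>R v j)" using y_eq by simp
    then show ?thesis by (simp add: sum_product mult.commute)
  qed
  \<comment> \<open>The double sum is added to itself with the indices exchanged, so that each mixed
    term meets its partner.\<close>
  have "2 *\<^sub>R ?S = ?S + (\<Sum>i\<le>n. \<Sum>j\<le>n. (c j * c i) *\<^sub>R (cj (v j) * v i))"
    by (subst (3) sum.swap) (simp add: scaleR_2)
  also have "\<dots> = (\<Sum>i\<le>n. \<Sum>j\<le>n. if j = i then (2 * (c i)\<^sup>2) *\<^sub>R 1 else 0)"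
    unfolding sum.distrib[symmetric]
  proof (intro sum.cong refl)
    fix i j assume ij: "i \<in> {..n}" "j \<in> {..n}"
    show "(c i * c j) *\<^sub>R (cj (v i) * v j) + (c j * c i) *\<^sub>R (cj (v j) * v i) =
        (if j = i then (2 * (c i)\<^sup>2) *\<^sub>R 1 else 0)"
    proof (cases "j = i")
      case True
      then show ?thesis using diag[of i] ij by (simp add: power2_eq_square flip: scaleR_2)
    next
      case False
      have "(c i * c j) *\<^sub>R (cj (v i) * v j) + (c j * c i) *\<^sub>R (cj (v j) * v i) =
          (c i * c j) *\<^sub>R (cj (v i) * v j + cj (v j) * v i)"
        by (simp add: scaleR_add_right mult.commute)
      then show ?thesis using off[of i j] ij False by simp
    qed
  qed
  also have "\<dots> = (\<Sum>i\<le>n. (2 * (c i)\<^sup>2) *\<^sub>R 1)" by simp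
  also have "\<dots> = 2 *\<^sub>R of_real (\<Sum>i\<le>n. (c i)\<^sup>2)"
    by (simp add: of_real_def scaleR_sum_left scaleR_sum_right)
  finally have "?S = of_real (\<Sum>i\<le>n. (c i)\<^sup>2)" by simp
  moreover have "(norm y)\<^sup>2 = (\<Sum>i\<le>n. (c i)\<^sup>2)"
  proof -
    have "y = hyperplane_point (Suc n) v c" using y_eq by (simp add: hyperplane_point_def lessThan_Suc_atMost)
    then show ?thesis
      using norm_hyperplane_point[OF on, of c] by (simp add: sum_nonneg lessThan_Suc_atMost)
  qed
  ultimately show ?thesis using S by simp
qed

section \<open>Orthonormality of the slice basis\<close>

lemma inner_span_zero:
  assumes "\<And>x y. x \<in> A \<Longrightarrow> y \<in> B \<Longrightarrow> x \<bullet> y = 0" "x \<in> span A" "y \<in> span B"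
  shows "x \<bullet> y = 0"
proof -
  have "orthogonal a y" if "a \<in> A" for a
    by (rule orthogonal_to_span[OF assms(3)]) (use assms(1) that in \<open>auto simp: orthogonal_def\<close>)
  then have "orthogonal y x"
    by (intro orthogonal_to_span[OF assms(2)]) (auto simp: orthogonal_commute)
  then show ?thesis by (simp add: orthogonal_def inner_commute)
qed

lemma step_list_mono:
  assumes "step_list n \<tau> t" "i \<le> j" "j \<le> \<tau>"
  shows "t i \<le> t j"
proof (cases "i = j")
  case False
  then show ?thesis
    using assms by (auto simp: step_list_def dest!: strict_mono_onD[of _ _ i j])
qed simp

lemma torusD:
  assumes "J \<in> torus v \<tau> t" "1 \<le> k" "k \<le> \<tau>"
  shows "J k \<in> span (v ` {t (k - 1) + 1..t k})" "norm (J k) = 1"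
  using PiE_mem[OF assms(1)[unfolded torus_def], of k] assms(2,3) by (auto simp: sphere_between_def)

text \<open>Every slice vector lies in the span of its own block of basis vectors, and increasing
  steps make the blocks disjoint.\<close>

lemma orthonormal_slice_basis:
  assumes on: "orthonormal_below (Suc n) v" and t: "step_list n \<tau> t" and J: "J \<in> torus v \<tau> t"
  shows "orthonormal_below (Suc (t 0 + \<tau>)) (slice_basis v t J)"
    and "slice v \<tau> t J \<subseteq> span (v ` {..n})"
proof -
  let ?w = "slice_basis v t J"
  have tn: "t k \<le> n" if "k \<le> \<tau>" for k
    using step_list_mono[OF t that order_refl] t by (simp add: step_list_def)
  have t0: "t 0 \<le> n" by (rule tn) simp
  \<comment> \<open>Beyond \<open>t 0\<close>, the vector with index \<open>s\<close> is
    \<open>J (s - t 0)\<close>, taken from the sphere that these indices span.\<close>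
  define blk where "blk = (\<lambda>s. if s \<le> t 0 then {s} else {t (s - t 0 - 1) + 1..t (s - t 0)})"
  have w_span: "?w s \<in> span (v ` blk s)" and w_norm: "?w s \<bullet> ?w s = 1" and blk_n: "blk s \<subseteq> {..n}"
    if s: "s \<le> t 0 + \<tau>" for s
  proof -
    show "?w s \<in> span (v ` blk s)"
      using torusD(1)[OF J, of "s - t 0"] s by (auto simp: slice_basis_def blk_def intro: span_base)
    show "?w s \<bullet> ?w s = 1"
    proof (cases "s \<le> t 0")
      case True
      then show ?thesis using on t0 by (simp add: slice_basis_def orthonormal_below_def)
    next
      case False
      then show ?thesis
        using torusD(2)[OF J, of "s - t 0"] s by (simp add: slice_basis_def norm_eq_1)
    qed
    show "blk s \<subseteq> {..n}" using tn[of "s - t 0"] s t0 by (auto simp: blk_def)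
  qed
  have disj: "blk s \<inter> blk u = {}" if su: "s < u" "u \<le> t 0 + \<tau>" for s u
  proof (cases "u \<le> t 0")
    case False
    then have u: "u - t 0 - 1 \<le> \<tau>" using su(2) by linarith
    show ?thesis
    proof (cases "s \<le> t 0")
      case True
      then show ?thesis using False step_list_mono[OF t le0 u] by (auto simp: blk_def)
    next
      case s: False
      \<comment> \<open>The block of \<open>s\<close> ends at \<open>t (s - t 0)\<close>, which is
        at most \<open>t (u - t 0 - 1)\<close>; the block of \<open>u\<close> starts one
        later.\<close>
      then have "s - t 0 \<le> u - t 0 - 1" using su(1) by linarith
      then show ?thesis using False s step_list_mono[OF t _ u, of "s - t 0"] by (auto simp: blk_def)
    qed
  qed (use su in \<open>auto simp: blk_def\<close>)
  have orth: "?w s \<bullet> ?w u = 0" if su: "s < u" "u \<le> t 0 + \<tau>" for s u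
  proof (rule inner_span_zero[OF _ w_span w_span])
    fix x y assume "x \<in> v ` blk s" "y \<in> v ` blk u"
    then obtain i j where ij: "x = v i" "i \<in> blk s" "y = v j" "j \<in> blk u" by blast
    then have "i \<noteq> j" "i \<le> n" "j \<le> n" using disj[OF su] blk_n[of s] blk_n[of u] su by auto
    then show "x \<bullet> y = 0" using on by (simp add: ij orthonormal_below_def)
  qed (use su in auto)
  show "orthonormal_below (Suc (t 0 + \<tau>)) ?w"
    unfolding orthonormal_below_def
  proof (intro allI impI)
    fix s u assume "s < Suc (t 0 + \<tau>)" "u < Suc (t 0 + \<tau>)"
    then show "?w s \<bullet> ?w u = (if s = u then 1 else 0)"
      using w_norm[of s] orth[of s u] orth[of u s] by (cases s u rule: linorder_cases) (auto simp: inner_commute)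
  qed
  have "?w s \<in> span (v ` {..n})" if "s \<le> t 0 + \<tau>" for s
    using w_span[OF that] span_mono[OF image_mono[OF blk_n[OF that]]] by blast
  then show "slice v \<tau> t J \<subseteq> span (v ` {..n})"
    unfolding slice_def by (intro span_minimal) auto
qed

theorem proposition4p21:
  fixes cj :: "'a::{real_algebra_1, euclidean_space} \<Rightarrow> 'a"
    and V \<Omega> G :: "'a set"
    and v J :: "nat \<Rightarrow> 'a"
    and n d \<tau> :: nat
    and t :: "nat \<Rightarrow> nat"
    and f :: "'a \<Rightarrow> 'a"
    and x :: 'a
  assumes "star_involution cj"
    and "imag_units cj \<noteq> {}"
    and "hypercomplex_subspace cj V"
    and "hypercomplex_basis cj V n v"
    and "n \<le> d"
    and "ordered_basis d v UNIV"
    and "orthonormal_family d v"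
    and "step_list n \<tau> t"
    and "domain_in V \<Omega>"
    and "T_regular v \<tau> t \<Omega> f"
    and "J \<in> torus v \<tau> t"
    and "domain_in (slice v \<tau> t J) G"
    and "bounded G"
    and "C1_boundary (t 0 + \<tau>) (slice v \<tau> t J) G"
    and "closure G \<subseteq> \<Omega> \<inter> slice v \<tau> t J"
  shows "(x \<in> G \<longrightarrow>
       (1 / unit_sphere_volume (t 0 + \<tau>)) *\<^sub>R
         boundary_form_integral (t 0 + \<tau>) (slice v \<tau> t J) G
           (\<lambda>y. (1 / norm (y - x) ^ (t 0 + \<tau> + 1)) *\<^sub>R cj (y - x)) f = f x) \<and>
     (x \<in> slice v \<tau> t J - closure G \<longrightarrow>
       (1 / unit_sphere_volume (t 0 + \<tau>)) *\<^sub>R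
         boundary_form_integral (t 0 + \<tau>) (slice v \<tau> t J) G
           (\<lambda>y. (1 / norm (y - x) ^ (t 0 + \<tau> + 1)) *\<^sub>R cj (y - x)) f = 0)"
proof -
  let ?m = "t 0 + \<tau>" and ?W = "slice v \<tau> t J" and ?w = "slice_basis v t J"
  have on: "orthonormal_below (Suc n) v"
    using assms(5,7) by (auto simp: orthonormal_family_iff intro: orthonormal_below_mono)
  have onw: "orthonormal_below (Suc ?m) ?w"
    by (rule orthonormal_slice_basis(1)[OF on assms(8,11)])
  have W: "?W = span (?w ` {..<Suc ?m})" by (simp add: slice_def lessThan_Suc_atMost)
  have V: "V = span (v ` {..n})"
    using assms(4) by (simp add: hypercomplex_basis_def ordered_basis_def)
  have WV: "?W \<subseteq> V" unfolding V by (rule orthonormal_slice_basis(2)[OF on assms(8,11)])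
  have lin: "linear cj" using assms(1) by (simp add: star_involution_def)
  have norm: "cj z * z = of_real ((norm z)\<^sup>2)" if "z \<in> ?W" for z
    using that WV by (intro hypercomplex_conj_mult_self[OF assms(1,4) on]) auto
  have G: "openin (top_of_set ?W) G" using assms(12) by (simp add: domain_in_def)
  have GW: "G \<subseteq> ?W" using G openin_imp_subset by blast
  have Y: "openin (top_of_set ?W) (\<Omega> \<inter> ?W)"
  proof -
    obtain U where "open U" "\<Omega> = V \<inter> U" using assms(9) by (auto simp: domain_in_def openin_open)
    then show ?thesis using WV by (auto simp: openin_open)
  qed
  have mono: "(\<Sum>s\<le>?m. ?w s * dir_deriv f (?w s) y) = 0" if "y \<in> \<Omega> \<inter> ?W" for y
    using assms(10,11) that by (auto simp: T_regular_def monogenic_on_def)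
  have C1: "C1_on ?W (\<Omega> \<inter> ?W) f"
    using assms(10,11) by (auto simp: T_regular_def monogenic_on_def slice_def)
  note formula = Cauchy_formula_subspace[OF onw W lin norm G assms(13,14) Y assms(15) C1 mono]
  have "unit_sphere_volume ?m \<noteq> 0" using unit_sphere_volume_pos[of ?m] by simp
  \<comment> \<open>Points of \<open>G\<close> and points of the slice off \<open>closure G\<close>
    alike avoid \<open>closure G - G\<close>, so one formula serves both cases.\<close>
  then show ?thesis using formula GW closure_subset[of G] by auto
qed

end
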